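(* There exists an absolute constant $c > 0$ such that the following holds. Let $D = \{X \in \mathbf{S}^n : X \succeq 0,\ \operatorname{Tr}(X) = 1\}$. If $P$ is a polytope such that $D \subset P$ and $w_G(P) \leq 2\, w_G(D)$, then the extension complexity of $P$ is at least $e^{c n^{1/3}}$.
   Context: $\mathbf{S}^n$ denotes the real vector space of $n \times n$ real symmetric matrices, equipped with the trace inner product $\langle A, B\rangle = \operatorname{Tr}(AB)$, and $X \succeq 0$ means that $X$ is positive semidefinite; the polytope $P$ lives in this space. The Gaussian width of a set $S$ in a Euclidean space is $w_G(S) = \mathbb{E}_g\left[\max_{x \in S} \langle g, x\rangle\right]$, where $g$ is a standard Gaussian random vector in that space. A polytope is the convex hull of finitely many points. The extension complexity of a polytope $P$ is the smallest integer $k$ such that $P$ can be expressed as the linear image of a polytope with $k$ facets.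
   Formalization: The claim is proved for n at least 2; for n = 1 it fails, since D is the single point {1} of Gaussian width 0, and P = D is an admissible polytope with extension complexity 0, which is less than e^c. *)

theory Defs
  imports "HOL-Probability.Probability" "HOL-Analysis.Finite_Function_Topology"
begin

text \<open>
  The dimension \<open>n\<close> of the matrices and the dimension of the polytopes occurring in the
  definition of extension complexity are quantified inside formulas, so they cannot be type
  parameters. Vectors and matrices are therefore finitely supported functions, whose type is an
  (infinite-dimensional) real vector space containing every finite-dimensional space.
  The norm that the library puts on this type is irrelevant here.
\<close>

type_synonym fin_vec = "nat \<Rightarrow>\<^sub>0 real"
type_synonym fin_mat = "nat \<times> nat \<Rightarrow>\<^sub>0 real"

abbreviation entry :: "fin_mat \<Rightarrow> nat \<Rightarrow> nat \<Rightarrow> real" where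
  "entry X i j \<equiv> Poly_Mapping.lookup X (i, j)"

definition sym_mats :: "nat \<Rightarrow> fin_mat set" where
  "sym_mats n = {X. Poly_Mapping.keys X \<subseteq> {..<n} \<times> {..<n} \<and> (\<forall>i j. entry X i j = entry X j i)}"

definition mat_trace :: "nat \<Rightarrow> fin_mat \<Rightarrow> real" where
  "mat_trace n X = (\<Sum>i<n. entry X i i)"

definition psd :: "nat \<Rightarrow> fin_mat \<Rightarrow> bool" where
  "psd n X \<longleftrightarrow> (\<forall>v :: nat \<Rightarrow> real. 0 \<le> (\<Sum>i<n. \<Sum>j<n. v i * entry X i j * v j))"

text \<open>\<open>Tr(AB)\<close>, with the matrix product written out.\<close>

definition trace_inner :: "nat \<Rightarrow> fin_mat \<Rightarrow> fin_mat \<Rightarrow> real" where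
  "trace_inner n A B = (\<Sum>i<n. \<Sum>j<n. entry A i j * entry B j i)"

definition density_mats :: "nat \<Rightarrow> fin_mat set" where
  "density_mats n = {X \<in> sym_mats n. psd n X \<and> mat_trace n X = 1}"


text \<open>
  A standard Gaussian vector of a Euclidean space has independent standard normal coordinates
  with respect to an orthonormal basis. The basis of the symmetric matrices used here is
  \<open>E\<^sub>i\<^sub>i\<close> together with \<open>(E\<^sub>i\<^sub>j + E\<^sub>j\<^sub>i) / sqrt 2\<close> for \<open>i < j\<close>.
\<close>

definition sym_index :: "nat \<Rightarrow> (nat \<times> nat) set" where
  "sym_index n = {(i, j). i \<le> j \<and> j < n}"

definition sym_basis :: "nat \<times> nat \<Rightarrow> fin_mat" where
  "sym_basis = (\<lambda>(i, j). if i = j then Poly_Mapping.single (i, i) 1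
      else Poly_Mapping.single (i, j) (1 / sqrt 2) + Poly_Mapping.single (j, i) (1 / sqrt 2))"

definition gaussian_coords :: "nat \<Rightarrow> (nat \<times> nat \<Rightarrow> real) measure" where
  "gaussian_coords n = PiM (sym_index n) (\<lambda>_. std_normal_distribution)"

definition gaussian_mat :: "nat \<Rightarrow> (nat \<times> nat \<Rightarrow> real) \<Rightarrow> fin_mat" where
  "gaussian_mat n \<omega> = (\<Sum>p\<in>sym_index n. \<omega> p *\<^sub>R sym_basis p)"

text \<open>
  Only used for nonempty compact \<open>S\<close>, where the supremum is a maximum and its expectation is
  finite.
\<close>

definition gaussian_width :: "nat \<Rightarrow> fin_mat set \<Rightarrow> real" where
  "gaussian_width n S =
     (\<integral>\<omega>. (SUP X\<in>S. trace_inner n (gaussian_mat n \<omega>) X) \<partial>gaussian_coords n)"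


text \<open>
  The library's \<open>aff_dim\<close> and \<open>facet_of\<close> are restricted to Euclidean spaces (types of fixed
  finite dimension). The following versions make sense in every real vector space; they agree
  with the library's, see \<open>affine_facet_of_iff_facet_of\<close> below. In particular a point has
  no facets, so for \<open>n = 1\<close>, where \<open>density_mats n\<close> is a point, no exponential lower bound
  can hold.
\<close>

definition affine_dim :: "'a::real_vector set \<Rightarrow> nat" where
  "affine_dim S = dim {x - y | x y. x \<in> S \<and> y \<in> S}"

definition affine_facet_of :: "'a::real_vector set \<Rightarrow> 'a set \<Rightarrow> bool" where
  "affine_facet_of F S \<longleftrightarrow> F face_of S \<and> F \<noteq> {} \<and> affine_dim S = affine_dim F + 1"

text \<open>
  Every polytope of some \<open>\<real>\<^sup>d\<close> occurs in \<^typ>\<open>fin_vec\<close>, and every polytope in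
  \<^typ>\<open>fin_vec\<close> lies in some \<open>\<real>\<^sup>d\<close>; a linear map on \<open>\<real>\<^sup>d\<close> extends to the whole type.
\<close>

definition extension_complexity :: "'a::real_vector set \<Rightarrow> nat" where
  "extension_complexity P =
     (LEAST k. \<exists>(Q :: fin_vec set) f.
        polytope Q \<and> card {F. affine_facet_of F Q} = k \<and> linear f \<and> f ` Q = P)"


lemma aff_dim_eq_affine_dim:
  fixes S :: "'a::euclidean_space set"
  assumes "S \<noteq> {}"
  shows "aff_dim S = int (affine_dim S)"
proof -
  obtain a where a: "a \<in> S" using assms by blast
  have "span ((+) (- a) ` S) = span {x - y | x y. x \<in> S \<and> y \<in> S}" (is "_ = span ?D")
  proof (rule antisym)
    show "span ((+) (- a) ` S) \<subseteq> span ?D"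
      using a by (intro span_mono) force
    have "x - y \<in> span ((+) (- a) ` S)" if "x \<in> S" "y \<in> S" for x y
    proof -
      have "(- a + x) - (- a + y) \<in> span ((+) (- a) ` S)"
        using that by (intro span_diff span_base) auto
      then show ?thesis by simp
    qed
    then show "span ?D \<subseteq> span ((+) (- a) ` S)"
      by (intro span_minimal subspace_span) auto
  qed
  then have "dim (span ((+) (- a) ` S)) = dim (span ?D)"
    by (rule arg_cong)
  then have "dim ((+) (- a) ` S) = dim ?D"
    by (simp only: dim_span)
  moreover have "aff_dim S = int (dim ((+) (- a) ` S))"
    using a by (intro aff_dim_eq_dim hull_inc)
  ultimately show ?thesis by (simp add: affine_dim_def)
qed

lemma affine_facet_of_iff_facet_of:
  fixes S :: "'a::euclidean_space set"
  shows "affine_facet_of F S \<longleftrightarrow> F facet_of S"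
proof (cases "F face_of S \<and> F \<noteq> {}")
  case True
  then have "S \<noteq> {}" using face_of_imp_subset by blast
  then show ?thesis
    using True by (auto simp: affine_facet_of_def facet_of_def aff_dim_eq_affine_dim)
qed (auto simp: affine_facet_of_def facet_of_def)

lemma lookup_scaleR [simp]:
  "Poly_Mapping.lookup (c *\<^sub>R X) k = c *\<^sub>R Poly_Mapping.lookup X k"
proof -
  have "finite {i. c *\<^sub>R Poly_Mapping.lookup X i \<noteq> 0}"
    by (rule finite_subset[OF _ finite_lookup[of X]]) auto
  then show ?thesis
    by (simp add: scaleR_poly_mapping_def lookup_Abs_poly_mapping)
qed

lemma lookup_sym_basis:
  "entry (sym_basis (i, j)) k l =
     (if i = j then (if k = i \<and> l = i then 1 else 0)
      else if (k = i \<and> l = j) \<or> (k = j \<and> l = i) then 1 / sqrt 2 else 0)"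
proof (cases "i = j")
  case True
  then show ?thesis
    by (simp add: sym_basis_def lookup_single when_def eq_commute[of i])
next
  case False
  then show ?thesis
    unfolding sym_basis_def by (auto simp only: prod.case if_False lookup_add lookup_single when_def prod.inject split: if_split)
qed

lemma finite_sym_index: "finite (sym_index n)"
  by (rule finite_subset[of _ "{..<n} \<times> {..<n}"]) (auto simp: sym_index_def)

lemma sym_basis_in_sym_mats: "p \<in> sym_index n \<Longrightarrow> sym_basis p \<in> sym_mats n"
proof -
  assume "p \<in> sym_index n"
  then obtain i j where p: "p = (i, j)" "i < n" "j < n"
    by (auto simp: sym_index_def)
  have "(k, l) \<in> {..<n} \<times> {..<n}" if "(k, l) \<in> Poly_Mapping.keys (sym_basis p)" for k l
  proof -
    have "entry (sym_basis (i, j)) k l \<noteq> 0" using that p(1) by (simp add: in_keys_iff)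
    then have "k = i \<and> l = j \<or> k = j \<and> l = i"
      unfolding lookup_sym_basis by (simp split: if_splits)
    then show ?thesis using p by blast
  qed
  then have "Poly_Mapping.keys (sym_basis p) \<subseteq> {..<n} \<times> {..<n}"
    by (intro subrelI)
  moreover have "entry (sym_basis p) k l = entry (sym_basis p) l k" for k l
    unfolding p(1) lookup_sym_basis by (simp only: conj_commute disj_commute)
  ultimately show ?thesis unfolding sym_mats_def by blast
qed

lemma trace_inner_sym_basis:
  assumes "(i, j) \<in> sym_index n" "X \<in> sym_mats n"
  shows "trace_inner n (sym_basis (i, j)) X = (if i = j then 1 else sqrt 2) * entry X i j"
proof -
  have ij: "i < n" "j < n" using assms(1) by (auto simp: sym_index_def)
  have sym: "entry X j i = entry X i j" using assms(2) by (auto simp: sym_mats_def)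
  show ?thesis
  proof (cases "i = j")
    case True
    have "trace_inner n (sym_basis (i, j)) X
        = (\<Sum>k<n. \<Sum>l<n. if l = i then (if k = i then entry X i i else 0) else 0)"
      unfolding trace_inner_def using True by (intro sum.cong) (auto simp: lookup_sym_basis)
    also have "\<dots> = entry X i i" using ij by (simp add: sum.delta)
    finally show ?thesis using True by simp
  next
    case False
    have "trace_inner n (sym_basis (i, j)) X
        = (\<Sum>k<n. \<Sum>l<n. (if l = j then (if k = i then entry X j i / sqrt 2 else 0) else 0)
            + (if l = i then (if k = j then entry X i j / sqrt 2 else 0) else 0))"
      unfolding trace_inner_def using False by (intro sum.cong) (auto simp: lookup_sym_basis)
    also have "\<dots> = 2 / sqrt 2 * entry X i j"
      using ij by (simp add: sum.distrib sum.delta sym)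
    also have "2 / sqrt 2 = (sqrt 2 :: real)" by (simp add: real_div_sqrt)
    finally show ?thesis using False by simp
  qed
qed

lemma sym_basis_orthonormal:
  assumes "p \<in> sym_index n" "q \<in> sym_index n"
  shows "trace_inner n (sym_basis p) (sym_basis q) = (if p = q then 1 else 0)"
proof -
  obtain i j k l where pq: "p = (i, j)" "q = (k, l)" by (metis surj_pair)
  have "trace_inner n (sym_basis p) (sym_basis q)
      = (if i = j then 1 else sqrt 2) * entry (sym_basis (k, l)) i j"
    using assms pq trace_inner_sym_basis sym_basis_in_sym_mats by metis
  then show ?thesis
    using assms pq by (auto simp: lookup_sym_basis sym_index_def)
qed

lemma lookup_sym_basis_upper:
  assumes "i \<le> j" "k \<le> l"
  shows "entry (sym_basis (i, j)) k l = (if k = i \<and> l = j then (if i = j then 1 else 1 / sqrt 2) else 0)"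
proof (cases "i = j")
  case False
  then have "\<not> (k = j \<and> l = i)" using assms by arith
  then show ?thesis unfolding lookup_sym_basis using False by (simp only: if_False simp_thms)
qed (simp only: lookup_sym_basis if_True refl)

lemma subspace_sym_mats: "subspace (sym_mats n)"
proof (intro subspaceI)
  show "0 \<in> sym_mats n" by (simp add: sym_mats_def)
next
  fix X Y assume XY: "X \<in> sym_mats n" "Y \<in> sym_mats n"
  have "Poly_Mapping.keys (X + Y) \<subseteq> {..<n} \<times> {..<n}"
    using XY keys_add[of X Y] unfolding sym_mats_def by blast
  moreover have "entry (X + Y) i j = entry (X + Y) j i" for i j
  proof -
    have "entry X i j = entry X j i" "entry Y i j = entry Y j i"
      using XY unfolding sym_mats_def by blast+
    then show ?thesis by (simp only: lookup_add)
  qed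
  ultimately show "X + Y \<in> sym_mats n" unfolding sym_mats_def by blast
next
  fix c :: real and X assume X: "X \<in> sym_mats n"
  have "Poly_Mapping.keys (c *\<^sub>R X) \<subseteq> Poly_Mapping.keys X"
    by (auto simp: in_keys_iff)
  then have "Poly_Mapping.keys (c *\<^sub>R X) \<subseteq> {..<n} \<times> {..<n}"
    using X unfolding sym_mats_def by blast
  moreover have "entry (c *\<^sub>R X) i j = entry (c *\<^sub>R X) j i" for i j
  proof -
    have "entry X i j = entry X j i"
      using X unfolding sym_mats_def by blast
    then show ?thesis by (simp only: lookup_scaleR)
  qed
  ultimately show "c *\<^sub>R X \<in> sym_mats n" unfolding sym_mats_def by blast
qed

lemma span_sym_basis: "span (sym_basis ` sym_index n) = sym_mats n"
proof
  show *: "span (sym_basis ` sym_index n) \<subseteq> sym_mats n"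
    using subspace_sym_mats by (intro span_minimal) (auto intro: sym_basis_in_sym_mats)
  show "sym_mats n \<subseteq> span (sym_basis ` sym_index n)"
  proof
    fix X assume X: "X \<in> sym_mats n"
    define c where "c = (\<lambda>(i, j). (if i = j then 1 else sqrt 2) * entry X i j)"
    define Y where "Y = (\<Sum>p\<in>sym_index n. c p *\<^sub>R sym_basis p)"
    have Y: "Y \<in> span (sym_basis ` sym_index n)"
      unfolding Y_def by (intro span_sum span_scale span_base) auto
    have keys: "Poly_Mapping.keys X \<subseteq> {..<n} \<times> {..<n}"
      using X unfolding sym_mats_def by blast
    have upper: "entry Y k l = entry X k l" if kl: "k \<le> l" for k l
    proof -
      have summand: "c p * entry (sym_basis p) k l = (if p = (k, l) then entry X k l else 0)"
        if idx: "p \<in> sym_index n" for p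
      proof -
        obtain i j where p: "p = (i, j)" "i \<le> j"
          using idx by (auto simp: sym_index_def)
        show ?thesis
        proof (cases "(i, j) = (k, l)")
          case True
          then show ?thesis
            using p(1) lookup_sym_basis_upper[OF p(2) kl] by (simp add: c_def)
        next
          case False
          then have "\<not> (k = i \<and> l = j)" by blast
          then have "entry (sym_basis p) k l = 0"
            unfolding p(1) lookup_sym_basis_upper[OF p(2) kl] by (rule if_not_P)
          moreover have "p \<noteq> (k, l)" using False p(1) by simp
          ultimately show ?thesis by simp
        qed
      qed
      have "entry Y k l = (\<Sum>p\<in>sym_index n. c p * entry (sym_basis p) k l)"
        unfolding Y_def by (simp add: lookup_sum)
      also have "\<dots> = (\<Sum>p\<in>sym_index n. if p = (k, l) then entry X k l else 0)"
        by (rule sum.cong[OF refl summand])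
      also have "\<dots> = (if (k, l) \<in> sym_index n then entry X k l else 0)"
        by (rule sum.delta[OF finite_sym_index])
      also have "\<dots> = entry X k l"
      proof (cases "(k, l) \<in> sym_index n")
        case False
        then have "(k, l) \<notin> Poly_Mapping.keys X"
          using keys kl by (auto simp: sym_index_def)
        then show ?thesis using False by (simp add: in_keys_iff)
      qed simp
      finally show ?thesis .
    qed
    have "entry Y k l = entry X k l" for k l
    proof (cases "k \<le> l")
      case False
      have "Y \<in> sym_mats n" using Y * by (rule subsetD[rotated])
      then have "entry Y k l = entry Y l k" unfolding sym_mats_def by blast
      also have "\<dots> = entry X l k" using False by (intro upper) simp
      also have "\<dots> = entry X k l" using X unfolding sym_mats_def by blast
      finally show ?thesis .
    qed (rule upper)
    then have "X = Y"
      by (intro poly_mapping_eqI) (simp only: split_paired_all)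
    then show "X \<in> span (sym_basis ` sym_index n)" using Y by simp
  qed
qed

end

theory Submission
  imports Defs "HOL-Real_Asymp.Real_Asymp"
begin

text \<open>
  Let \<open>k\<close> be the extension complexity of \<open>P\<close>, let \<open>h G\<close> be the maximum of \<open>\<langle>G, X\<rangle>\<close> over
  \<open>X \<in> P\<close>, and let \<open>m = n div 2\<close>. The argument evaluates the inequality \<open>\<langle>G, X\<rangle> \<le> h G\<close> at
  the matrices \<open>X = x x\<^sup>T / (2 m)\<close> with \<open>x\<close> in the sign cube of dimension \<open>2 m\<close>. They lie in
  \<open>D\<close>, hence in \<open>P\<close>. An inequality that is valid on \<open>P\<close> pulls back to an extension with
  \<open>k\<close> facets, where it is a nonnegative combination of a constant and the facet slacks, so
  \<open>h G - \<langle>G, x x\<^sup>T / (2 m)\<rangle> = l\<^sub>0 + (\<Sum>F. l F * u F x)\<close> with at most \<open>k\<close> nonnegative functions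
  \<open>u F\<close> that do not depend on \<open>G\<close> (\<open>slack_factorization\<close>).

  Let \<open>G\<close> have random signs \<open>\<tau>\<close> as coordinates, and compare the coefficients at the products
  \<open>x i * x j\<close> with \<open>i < m \<le> j\<close>. On the left they are multiples of \<open>\<tau> (i, j)\<close>, so pairing them
  with \<open>- \<tau>\<close> gives \<open>m / sqrt 2\<close> for every \<open>\<tau>\<close> (\<open>slack_mean_and_pairing\<close>). On the right
  the pairing is \<open>\<Sum>F. l F * a F * \<langle>- \<tau>, U F\<rangle>\<close>, where \<open>a F\<close> is the mean of \<open>u F\<close> and
  \<open>U F\<close> consists of the correlations of the density \<open>u F / a F\<close> with the products. A density
  bounded by \<open>M\<close> has \<open>\<parallel>U F\<parallel> = O(log M)\<close>: this is the hypercontractive estimate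
  \<open>bilinear_correlations_le_ln\<close>. It can be used with \<open>M\<close> polynomial in \<open>k\<close> and \<open>n\<close>, because
  a function \<open>u F\<close> with a higher peak must have a negligible \<open>l F\<close> (\<open>slack_pairing_le\<close>). As
  the \<open>U F\<close> do not depend on \<open>\<tau>\<close>, the largest of the \<open>k\<close> pairings \<open>\<langle>- \<tau>, U F\<rangle>\<close> is on average at
  most of order \<open>log (k n) powr (3 / 2)\<close> (\<open>max_linear_signs_bound\<close>).

  Taking means in \<open>x\<close> bounds \<open>\<Sum>F. l F * a F\<close> by \<open>h G\<close> minus a term with mean \<open>0\<close>. So the
  average of \<open>h G\<close> over the signs is at least of order \<open>n / log (k n) powr (3 / 2)\<close>. It is also
  at most \<open>sqrt (pi / 2)\<close> times the Gaussian width of \<open>P\<close> (\<open>gaussian_width_ge_mean_signs\<close>),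
  which is at most twice that of \<open>D\<close> and therefore \<open>O(sqrt n)\<close>
  (\<open>gaussian_width_density_le\<close>). Hence \<open>log (k n)\<close> is at least of order
  \<open>n powr (1 / 3)\<close>. For large \<open>n\<close> the factor \<open>n\<close> in the logarithm is absorbed, and for the
  remaining \<open>n\<close> it suffices that \<open>P\<close> is not a point, so that \<open>k \<ge> 2\<close>.
\<close>


section \<open>Averages over the sign cube\<close>

definition mean :: "'b set \<Rightarrow> ('b \<Rightarrow> real) \<Rightarrow> real" where
  "mean A f = (\<Sum>a\<in>A. f a) / real (card A)"

definition cube :: "'a set \<Rightarrow> ('a \<Rightarrow> real) set" where
  "cube K = (\<Pi>\<^sub>E i\<in>K. {-1, 1})"

lemma mean_cong: "(\<And>a. a \<in> A \<Longrightarrow> f a = g a) \<Longrightarrow> mean A f = mean A g"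
  by (simp add: mean_def)

lemma mean_add: "mean A (\<lambda>a. f a + g a) = mean A f + mean A g"
  by (simp add: mean_def sum.distrib add_divide_distrib)

lemma mean_diff: "mean A (\<lambda>a. f a - g a) = mean A f - mean A g"
  by (simp add: mean_def sum_subtractf diff_divide_distrib)

lemma mean_cmult: "mean A (\<lambda>a. c * f a) = c * mean A f"
  by (simp add: mean_def sum_distrib_left)

lemma mean_sum: "mean A (\<lambda>a. \<Sum>i\<in>I. f i a) = (\<Sum>i\<in>I. mean A (f i))"
  unfolding mean_def by (subst sum.swap) (simp add: sum_divide_distrib)

lemma mean_mono: "(\<And>a. a \<in> A \<Longrightarrow> f a \<le> g a) \<Longrightarrow> mean A f \<le> mean A g"
  unfolding mean_def by (intro divide_right_mono sum_mono) auto

lemma mean_const: "finite A \<Longrightarrow> A \<noteq> {} \<Longrightarrow> mean A (\<lambda>_. c) = c"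
  by (simp add: mean_def)

lemma mean_nonneg: "(\<And>a. a \<in> A \<Longrightarrow> 0 \<le> f a) \<Longrightarrow> 0 \<le> mean A f"
  unfolding mean_def by (intro divide_nonneg_nonneg sum_nonneg) auto

lemma finite_cube: "finite K \<Longrightarrow> finite (cube K)"
  by (simp add: cube_def finite_PiE)

lemma cube_not_empty: "cube K \<noteq> {}"
  by (simp add: cube_def PiE_eq_empty_iff)

lemma cube_square: "x \<in> cube K \<Longrightarrow> i \<in> K \<Longrightarrow> (x i)\<^sup>2 = 1"
  by (auto simp: cube_def PiE_iff)

lemma cube_abs: "x \<in> cube K \<Longrightarrow> i \<in> K \<Longrightarrow> \<bar>x i\<bar> = 1"
  by (auto simp: cube_def PiE_iff)

text \<open>
  Invariance under a change of sign of one coordinate characterises the uniform distribution on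
  the cube; the orthogonality relations and the exponential moments below are derived from it.
\<close>

lemma mean_cube_flip:
  assumes "i \<in> K"
  shows "mean (cube K) (\<lambda>x. f (x(i := - x i))) = mean (cube K) f"
proof -
  have flip: "x(i := - x i) \<in> cube K" if "x \<in> cube K" for x
    using that assms by (auto simp: cube_def PiE_iff extensional_def)
  have "(\<Sum>x\<in>cube K. f (x(i := - x i))) = (\<Sum>x\<in>cube K. f x)"
    by (rule sum.reindex_bij_witness[where i = "\<lambda>x. x(i := - x i)" and j = "\<lambda>x. x(i := - x i)"])
       (auto intro: flip)
  then show ?thesis by (simp add: mean_def)
qed

lemma mean_cube_coordinate_mult:
  assumes "i \<in> K" "\<And>x v. g (x(i := v)) = g x"
  shows "mean (cube K) (\<lambda>x. x i * g x) = 0"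
proof -
  have "mean (cube K) (\<lambda>x. x i * g x) = mean (cube K) (\<lambda>x. - 1 * (x i * g x))"
    using mean_cube_flip[OF assms(1), of "\<lambda>x. x i * g x"] assms(2) by simp
  then show ?thesis unfolding mean_cmult by simp
qed

text \<open>Hoeffding's lemma for a random sign.\<close>

lemma cosh_le_exp_half_square: "(exp a + exp (- a)) / 2 \<le> exp (a\<^sup>2 / 2)" for a :: real
proof -
  have pos: "(exp b + exp (- b)) / 2 \<le> exp (b\<^sup>2 / 2)" if "0 \<le> b" for b :: real
  proof -
    have eq: "1 + 1 / 2 * (exp (2 * b) - 1) = exp b * ((exp b + exp (- b)) / 2)"
      by (simp add: field_simps flip: exp_add)
    have p: "0 < (exp b + exp (- b)) / 2" by (simp add: add_pos_pos)
    have "- (2 * b) * (1 / 2) + ln (1 + 1 / 2 * (exp (2 * b) - 1)) \<le> (2 * b)\<^sup>2 / 8"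
      using that by (intro Hoeffdings_lemma_aux) auto
    also have "ln (1 + 1 / 2 * (exp (2 * b) - 1)) = b + ln ((exp b + exp (- b)) / 2)"
      unfolding eq using p by (subst ln_mult_pos) auto
    finally have "ln ((exp b + exp (- b)) / 2) \<le> b\<^sup>2 / 2"
      by (simp add: power2_eq_square)
    then show ?thesis using p by (metis exp_le_cancel_iff exp_ln)
  qed
  show ?thesis using pos[of a] pos[of "- a"] by (cases "0 \<le> a") (auto simp: add.commute)
qed

text \<open>
  Averaging over one sign \<open>x j\<close> turns \<open>exp (x j * c)\<close> into a hyperbolic cosine, which is at most
  \<open>exp (c\<^sup>2 / 2)\<close>. The coefficients may depend on the signs outside \<open>J\<close>; this is what allows the
  lemma to be applied to bilinear forms as well as to linear ones.
\<close>

lemma mean_exp_signs_le: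
  assumes "finite J" "J \<subseteq> K"
    and "\<And>i j x v. i \<in> J \<Longrightarrow> j \<in> J \<Longrightarrow> c j (x(i := v)) = c j x"
    and "\<And>i x v. i \<in> J \<Longrightarrow> h (x(i := v)) = h x"
  shows "mean (cube K) (\<lambda>x. exp (h x + (\<Sum>j\<in>J. x j * c j x)))
      \<le> mean (cube K) (\<lambda>x. exp (h x + (\<Sum>j\<in>J. (c j x)\<^sup>2 / 2)))"
  using assms
proof (induction J arbitrary: h rule: finite_induct)
  case empty
  then show ?case by simp
next
  case (insert j J)
  define g where "g x = h x + (\<Sum>i\<in>J. x i * c i x)" for x
  have g: "g (x(j := v)) = g x" for x v
  proof -
    have "(\<Sum>i\<in>J. (x(j := v)) i * c i (x(j := v))) = (\<Sum>i\<in>J. x i * c i x)"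
    proof (intro sum.cong refl)
      fix i assume i: "i \<in> J"
      then have "i \<noteq> j" using insert.hyps by blast
      moreover have "c i (x(j := v)) = c i x" using insert.prems(2)[of j i] i by blast
      ultimately show "(x(j := v)) i * c i (x(j := v)) = x i * c i x" by simp
    qed
    moreover have "h (x(j := v)) = h x" using insert.prems(3) by blast
    ultimately show ?thesis by (simp only: g_def)
  qed
  have cj: "c j (x(j := v)) = c j x" for x v by (rule insert.prems(2)) simp_all
  let ?f = "\<lambda>x. exp (g x + x j * c j x)"
  have jK: "j \<in> K" using insert.prems(1) by blast
  have "mean (cube K) (\<lambda>x. exp (h x + (\<Sum>j\<in>insert j J. x j * c j x))) = mean (cube K) ?f"
    using insert.hyps by (intro mean_cong) (simp add: g_def ac_simps)
  also have "\<dots> = 1 / 2 * (mean (cube K) ?f + mean (cube K) (\<lambda>x. ?f (x(j := - x j))))"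
    unfolding mean_cube_flip[OF jK, of ?f] by simp
  also have "\<dots> = mean (cube K) (\<lambda>x. 1 / 2 * (?f x + ?f (x(j := - x j))))"
    by (simp only: mean_cmult mean_add)
  also have "\<dots> \<le> mean (cube K) (\<lambda>x. exp (g x + (c j x)\<^sup>2 / 2))"
  proof (rule mean_mono)
    fix x assume x: "x \<in> cube K"
    have "1 / 2 * (?f x + ?f (x(j := - x j)))
        = exp (g x) * ((exp (x j * c j x) + exp (- (x j * c j x))) / 2)"
      unfolding g cj by (simp add: exp_add exp_diff exp_minus field_simps)
    also have "\<dots> \<le> exp (g x) * exp ((x j * c j x)\<^sup>2 / 2)"
      by (intro mult_left_mono cosh_le_exp_half_square) simp
    also have "(x j * c j x)\<^sup>2 = (c j x)\<^sup>2"
      using cube_square[OF x, of j] insert.prems by (simp add: power_mult_distrib)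
    finally show "1 / 2 * (?f x + ?f (x(j := - x j))) \<le> exp (g x + (c j x)\<^sup>2 / 2)"
      by (simp only: exp_add)
  qed
  also have "\<dots> = mean (cube K) (\<lambda>x. exp ((h x + (c j x)\<^sup>2 / 2) + (\<Sum>i\<in>J. x i * c i x)))"
    by (intro mean_cong) (simp add: g_def ac_simps)
  also have "\<dots> \<le> mean (cube K) (\<lambda>x. exp ((h x + (c j x)\<^sup>2 / 2) + (\<Sum>i\<in>J. (c i x)\<^sup>2 / 2)))"
    using insert.prems by (intro insert.IH) auto
  also have "\<dots> = mean (cube K) (\<lambda>x. exp (h x + (\<Sum>j\<in>insert j J. (c j x)\<^sup>2 / 2)))"
    using insert.hyps by (intro mean_cong) (simp add: ac_simps)
  finally show ?case .
qed

lemma mean_exp_linear_le: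
  assumes "finite K"
  shows "mean (cube K) (\<lambda>x. exp (\<Sum>i\<in>K. x i * b i)) \<le> exp ((\<Sum>i\<in>K. (b i)\<^sup>2) / 2)"
  using mean_exp_signs_le[of K K "\<lambda>i _. b i" "\<lambda>_. 0"] assms
  by (simp add: mean_const finite_cube cube_not_empty sum_divide_distrib)


section \<open>Quadratic chaos on the sign cube\<close>

lemma std_normal_mgf:
  "has_bochner_integral lborel (\<lambda>x. std_normal_density x * exp (a * x)) (exp (a\<^sup>2 / 2))"
proof -
  have "has_bochner_integral lborel (\<lambda>x. exp (a\<^sup>2 / 2) * normal_density a 1 x) (exp (a\<^sup>2 / 2) * 1)"
    by (intro has_bochner_integral_mult_right)
       (simp add: has_bochner_integral_iff)
  moreover have "exp (a\<^sup>2 / 2) * normal_density a 1 x = std_normal_density x * exp (a * x)" for x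
    by (simp add: normal_density_def power2_eq_square field_simps flip: exp_add)
  ultimately show ?thesis by simp
qed

lemma std_normal_exp_square:
  "has_bochner_integral lborel (\<lambda>x. std_normal_density x * exp (x\<^sup>2 / 4)) (sqrt 2)"
proof -
  have "has_bochner_integral lborel (\<lambda>x. sqrt 2 * normal_density 0 (sqrt 2) x) (sqrt 2 * 1)"
    by (intro has_bochner_integral_mult_right)
       (simp add: has_bochner_integral_iff)
  moreover have "sqrt 2 * normal_density 0 (sqrt 2) x = std_normal_density x * exp (x\<^sup>2 / 4)" for x
    by (simp add: normal_density_def real_sqrt_mult field_simps flip: exp_add)
  ultimately show ?thesis by simp
qed

text \<open>
  The square in the exponent is linearised by an auxiliary standard Gaussian \<open>g\<close>: since
  \<open>exp (s\<^sup>2 / 4)\<close> is the expectation of \<open>exp (s * g / sqrt 2)\<close>, averaging over the signs first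
  replaces the linear form by its variance, which is at most \<open>1\<close>.
\<close>

lemma mean_exp_square_le:
  assumes K: "finite K" and b: "(\<Sum>i\<in>K. (b i)\<^sup>2) \<le> 1"
  shows "mean (cube K) (\<lambda>x. exp ((\<Sum>i\<in>K. x i * b i)\<^sup>2 / 4)) \<le> sqrt 2"
proof -
  let ?L = "\<lambda>x. \<Sum>i\<in>K. x i * b i"
  let ?F = "\<lambda>x g. std_normal_density g * exp ((?L x / sqrt 2) * g)"
  have F: "has_bochner_integral lborel (?F x) (exp ((?L x)\<^sup>2 / 4))" for x
    using std_normal_mgf[of "?L x / sqrt 2"] by (simp add: power_divide)
  have "has_bochner_integral lborel (\<lambda>g. \<Sum>x\<in>cube K. ?F x g) (\<Sum>x\<in>cube K. exp ((?L x)\<^sup>2 / 4))"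
    using F by (intro has_bochner_integral_sum)
  from has_bochner_integral_divide_zero[OF this, of "real (card (cube K))"]
  have M: "has_bochner_integral lborel (\<lambda>g. mean (cube K) (\<lambda>x. ?F x g))
      (mean (cube K) (\<lambda>x. exp ((?L x)\<^sup>2 / 4)))"
    by (simp add: mean_def)
  have "mean (cube K) (\<lambda>x. ?F x g) \<le> std_normal_density g * exp (g\<^sup>2 / 4)" for g :: real
  proof -
    have "mean (cube K) (\<lambda>x. exp ((?L x / sqrt 2) * g))
        = mean (cube K) (\<lambda>x. exp (\<Sum>i\<in>K. x i * (b i * g / sqrt 2)))"
      by (intro mean_cong arg_cong[of _ _ exp])
         (subst sum_divide_distrib, subst sum_distrib_right, simp add: mult_ac)
    also have "\<dots> \<le> exp ((\<Sum>i\<in>K. (b i * g / sqrt 2)\<^sup>2) / 2)"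
      by (rule mean_exp_linear_le[OF K])
    also have "(\<Sum>i\<in>K. (b i * g / sqrt 2)\<^sup>2) / 2 = (\<Sum>i\<in>K. (b i)\<^sup>2) * (g\<^sup>2 / 4)"
      by (simp add: power_divide power_mult_distrib sum_distrib_right sum_divide_distrib)
    also have "exp \<dots> \<le> exp (g\<^sup>2 / 4)"
      using mult_right_mono[OF b, of "g\<^sup>2 / 4"] by simp
    finally show ?thesis
      unfolding mean_cmult by (intro mult_left_mono) auto
  qed
  then have "(\<integral>g. mean (cube K) (\<lambda>x. ?F x g) \<partial>lborel) \<le> (\<integral>g. std_normal_density g * exp (g\<^sup>2 / 4) \<partial>lborel)"
    using M std_normal_exp_square by (intro integral_mono) (auto simp: has_bochner_integral_iff)
  then show ?thesis
    using M std_normal_exp_square by (simp add: has_bochner_integral_iff)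
qed

text \<open>
  Averaging over the signs in \<open>J\<close> bounds the exponential moment of the bilinear form by that of
  \<open>\<parallel>A\<^sup>T x\<parallel>\<^sup>2 / 4\<close>. This is a convex combination, weighted by the squared column norms of \<open>A\<close>, of
  squares of normalised linear forms, so convexity of \<open>exp\<close> reduces the claim to a single form.
\<close>

lemma mean_exp_bilinear_le:
  fixes A :: "'a \<Rightarrow> 'a \<Rightarrow> real"
  assumes K: "finite K" and IJ: "I \<subseteq> K" "J \<subseteq> K" "I \<inter> J = {}"
    and A: "(\<Sum>i\<in>I. \<Sum>j\<in>J. (A i j)\<^sup>2) = 1"
  shows "mean (cube K) (\<lambda>x. exp ((\<Sum>i\<in>I. \<Sum>j\<in>J. A i j * x i * x j) / sqrt 2)) \<le> sqrt 2"
proof -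
  have fin: "finite I" "finite J" using K IJ finite_subset by blast+
  define c where "c j x = (\<Sum>i\<in>I. A i j * x i)" for j x
  define p where "p j = (\<Sum>i\<in>I. (A i j)\<^sup>2)" for j
  have p0: "0 \<le> p j" for j by (simp add: p_def sum_nonneg)
  have p1: "sum p J = 1" unfolding p_def using A by (subst sum.swap) simp
  have cp: "p j = 0 \<Longrightarrow> c j x = 0" for j x
    unfolding p_def c_def using fin by (subst (asm) sum_nonneg_eq_0_iff) auto
  have c_upd: "c j (x(i := v)) = c j x" if "i \<in> J" for i j x v
    unfolding c_def using that IJ by (intro sum.cong) auto
  have "mean (cube K) (\<lambda>x. exp ((\<Sum>i\<in>I. \<Sum>j\<in>J. A i j * x i * x j) / sqrt 2))
      = mean (cube K) (\<lambda>x. exp (0 + (\<Sum>j\<in>J. x j * (c j x / sqrt 2))))"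
    unfolding c_def
    by (intro mean_cong arg_cong[of _ _ exp], subst sum.swap)
       (simp add: sum_divide_distrib sum_distrib_left mult_ac)
  also have "\<dots> \<le> mean (cube K) (\<lambda>x. exp (0 + (\<Sum>j\<in>J. (c j x / sqrt 2)\<^sup>2 / 2)))"
    using fin IJ c_upd by (intro mean_exp_signs_le) auto
  also have "\<dots> \<le> mean (cube K) (\<lambda>x. \<Sum>j\<in>J. p j * exp ((\<Sum>i\<in>K. x i * (if i \<in> I then A i j / sqrt (p j) else 0))\<^sup>2 / 4))"
  proof (rule mean_mono)
    fix x
    have cx: "(\<Sum>i\<in>K. x i * (if i \<in> I then A i j / sqrt (p j) else 0))\<^sup>2 = (c j x)\<^sup>2 / p j" for j
    proof -
      have "(\<Sum>i\<in>K. x i * (if i \<in> I then A i j / sqrt (p j) else 0)) = (\<Sum>i\<in>K \<inter> I. x i * (A i j / sqrt (p j)))"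
        using K by (subst sum.inter_restrict) (auto intro!: sum.cong)
      also have "\<dots> = c j x / sqrt (p j)"
        using IJ by (simp add: c_def Int_absorb1 sum_divide_distrib mult_ac)
      finally show ?thesis using p0[of j] by (simp add: power_divide)
    qed
    have "exp (0 + (\<Sum>j\<in>J. (c j x / sqrt 2)\<^sup>2 / 2)) = exp (\<Sum>j\<in>J. p j *\<^sub>R ((c j x)\<^sup>2 / p j / 4))"
      using cp by (intro arg_cong[of _ _ exp]) (auto intro!: sum.cong simp: power_divide)
    also have "\<dots> \<le> (\<Sum>j\<in>J. p j * exp ((c j x)\<^sup>2 / p j / 4))"
      using fin p0 p1 convex_on_exp[of 1]
      by (intro convex_on_sum[where C = UNIV]) auto
    finally show "exp (0 + (\<Sum>j\<in>J. (c j x / sqrt 2)\<^sup>2 / 2)) \<le> (\<Sum>j\<in>J. p j *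
        exp ((\<Sum>i\<in>K. x i * (if i \<in> I then A i j / sqrt (p j) else 0))\<^sup>2 / 4))"
      unfolding cx .
  qed
  also have "\<dots> = (\<Sum>j\<in>J. p j * mean (cube K) (\<lambda>x. exp ((\<Sum>i\<in>K. x i * (if i \<in> I then A i j / sqrt (p j) else 0))\<^sup>2 / 4)))"
    by (simp only: mean_sum mean_cmult)
  also have "\<dots> \<le> (\<Sum>j\<in>J. p j * sqrt 2)"
  proof (intro sum_mono mult_left_mono p0 mean_exp_square_le K)
    fix j
    have "(\<Sum>i\<in>K. (if i \<in> I then A i j / sqrt (p j) else 0)\<^sup>2) = (\<Sum>i\<in>K \<inter> I. (A i j / sqrt (p j))\<^sup>2)"
      using K by (subst sum.inter_restrict) (auto intro!: sum.cong)
    also have "\<dots> = p j / p j"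
      using IJ p0[of j] by (simp add: p_def Int_absorb1 power_divide flip: sum_divide_distrib)
    finally show "(\<Sum>i\<in>K. (if i \<in> I then A i j / sqrt (p j) else 0)\<^sup>2) \<le> 1" by simp
  qed
  also have "\<dots> = sqrt 2" using p1 by (simp flip: sum_distrib_right)
  finally show ?thesis .
qed

text \<open>Fenchel's inequality for the conjugate pair \<open>exp s\<close> and \<open>u * ln u - u\<close>.\<close>

lemma mult_le_entropy_plus_exp:
  fixes u s :: real
  assumes "0 \<le> u"
  shows "u * s \<le> u * ln u - u + exp s"
proof (cases "u = 0")
  case False
  have "1 + (s - ln u) \<le> exp (s - ln u)" by (rule exp_ge_add_one_self)
  then have "u * (1 + (s - ln u)) \<le> u * exp (s - ln u)"
    using assms by (rule mult_left_mono)
  also have "\<dots> = exp s" using assms False by (simp add: exp_diff)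
  finally show ?thesis by (simp add: algebra_simps)
qed simp

text \<open>
  A density \<open>u \<le> M\<close> has relative entropy at most \<open>ln M\<close>, so its correlation with any function
  exceeds the logarithm of the exponential moment of that function by at most \<open>ln M\<close>. The function used here is
  the bilinear form whose coefficients are the normalised correlations of \<open>u\<close> themselves.
\<close>

lemma bilinear_correlations_le_ln:
  fixes u :: "('a \<Rightarrow> real) \<Rightarrow> real"
  assumes K: "finite K" and IJ: "I \<subseteq> K" "J \<subseteq> K" "I \<inter> J = {}"
    and u0: "\<And>x. x \<in> cube K \<Longrightarrow> 0 \<le> u x" and u1: "mean (cube K) u = 1"
    and uM: "\<And>x. x \<in> cube K \<Longrightarrow> u x \<le> M"
  shows "sqrt (\<Sum>i\<in>I. \<Sum>j\<in>J. (mean (cube K) (\<lambda>x. u x * (x i * x j)))\<^sup>2) \<le> sqrt 2 * (ln M + 1 / 2)"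
proof -
  define U where "U i j = mean (cube K) (\<lambda>x. u x * (x i * x j))" for i j
  define N where "N = sqrt (\<Sum>i\<in>I. \<Sum>j\<in>J. (U i j)\<^sup>2)"
  have cube: "finite (cube K)" "cube K \<noteq> {}" by (simp_all add: K finite_cube cube_not_empty)
  have "mean (cube K) u \<le> mean (cube K) (\<lambda>_. M)" by (rule mean_mono[OF uM])
  then have M1: "1 \<le> M" using u1 mean_const[OF cube] by simp
  have N2: "N\<^sup>2 = (\<Sum>i\<in>I. \<Sum>j\<in>J. (U i j)\<^sup>2)" by (simp add: N_def sum_nonneg)
  have "N \<le> sqrt 2 * (ln M + 1 / 2)"
  proof (cases "N = 0")
    case True
    then show ?thesis using M1 by simp
  next
    case False
    let ?q = "\<lambda>x. (\<Sum>i\<in>I. \<Sum>j\<in>J. (U i j / N) * x i * x j) / sqrt 2"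
    have "(\<Sum>i\<in>I. \<Sum>j\<in>J. (U i j / N)\<^sup>2) = N\<^sup>2 / N\<^sup>2"
      by (simp only: power_divide sum_divide_distrib[symmetric] N2)
    then have chaos: "mean (cube K) (\<lambda>x. exp (?q x)) \<le> sqrt 2"
      using False by (intro mean_exp_bilinear_le K IJ) simp
    have "mean (cube K) (\<lambda>x. u x * ?q x)
        = mean (cube K) (\<lambda>x. \<Sum>i\<in>I. \<Sum>j\<in>J. (U i j / N / sqrt 2) * (u x * (x i * x j)))"
      by (intro mean_cong) (simp add: sum_divide_distrib sum_distrib_left mult_ac)
    also have "\<dots> = (\<Sum>i\<in>I. \<Sum>j\<in>J. (U i j / N / sqrt 2) * U i j)"
      unfolding mean_sum mean_cmult U_def ..
    also have "\<dots> = N\<^sup>2 / N / sqrt 2"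
      unfolding N2 by (simp add: sum_divide_distrib power2_eq_square)
    also have "\<dots> = N / sqrt 2" by (simp add: power2_eq_square)
    finally have "N / sqrt 2 = mean (cube K) (\<lambda>x. u x * ?q x)" by simp
    also have "\<dots> \<le> mean (cube K) (\<lambda>x. ln M * u x - u x + exp (?q x))"
    proof (rule mean_mono)
      fix x assume x: "x \<in> cube K"
      have "u x * ln (u x) \<le> u x * ln M"
        using u0[OF x] uM[OF x] by (cases "u x = 0") (auto intro!: mult_left_mono)
      then show "u x * ?q x \<le> ln M * u x - u x + exp (?q x)"
        using mult_le_entropy_plus_exp[OF u0[OF x], of "?q x"] by (simp add: mult.commute)
    qed
    also have "\<dots> = ln M - 1 + mean (cube K) (\<lambda>x. exp (?q x))"
      by (simp add: mean_add mean_diff mean_cmult u1)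
    also have "\<dots> \<le> ln M + 1 / 2"
    proof -
      have "sqrt 2 \<le> (3 / 2 :: real)" by (rule real_le_lsqrt) (auto simp: power2_eq_square)
      then show ?thesis using chaos by simp
    qed
    finally show ?thesis by (simp add: field_simps)
  qed
  then show ?thesis by (simp add: N_def U_def)
qed


section \<open>Slack functions of the facets of a polytope\<close>

definition affine_fun :: "('a::real_vector \<Rightarrow> real) \<Rightarrow> bool" where
  "affine_fun f \<longleftrightarrow> (\<exists>\<phi> c. linear \<phi> \<and> f = (\<lambda>x. \<phi> x + c))"

lemma affine_funI: "linear \<phi> \<Longrightarrow> affine_fun (\<lambda>x. \<phi> x + c)"
  by (auto simp: affine_fun_def)

lemma affine_fun_const: "affine_fun (\<lambda>_. c)"
  using affine_funI[OF linear_zero, of c] by simp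

lemma affine_fun_add:
  assumes "affine_fun f" "affine_fun g"
  shows "affine_fun (\<lambda>x. f x + g x)"
proof -
  obtain \<phi> c \<psi> d where lin: "linear \<phi>" "linear \<psi>"
    and fg: "f = (\<lambda>x. \<phi> x + c)" "g = (\<lambda>x. \<psi> x + d)"
    using assms unfolding affine_fun_def by blast
  have "(\<lambda>x. f x + g x) = (\<lambda>x. \<phi> x + \<psi> x + (c + d))" by (simp add: fg fun_eq_iff)
  then show ?thesis by (simp only: affine_funI linear_compose_add lin)
qed

lemma affine_fun_cmult:
  assumes "affine_fun f"
  shows "affine_fun (\<lambda>x. a * f x)"
proof -
  obtain \<phi> c where lin: "linear \<phi>" and f: "f = (\<lambda>x. \<phi> x + c)"
    using assms unfolding affine_fun_def by blast
  have "linear (\<lambda>x. a * \<phi> x)" using linear_compose_scale_right[OF lin, of a] by simp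
  moreover have "(\<lambda>x. a * f x) = (\<lambda>x. a * \<phi> x + a * c)" by (simp add: f distrib_left)
  ultimately show ?thesis by (simp only: affine_funI)
qed

lemma affine_fun_diff: "affine_fun f \<Longrightarrow> affine_fun g \<Longrightarrow> affine_fun (\<lambda>x. f x - g x)"
  using affine_fun_add[OF _ affine_fun_cmult[of g "- 1"], of f] by simp

lemma affine_fun_combination:
  assumes "affine_fun f" "a + b = 1"
  shows "f (a *\<^sub>R x + b *\<^sub>R y) = a * f x + b * f y"
proof -
  obtain \<phi> c where lin: "linear \<phi>" and f: "f = (\<lambda>x. \<phi> x + c)"
    using assms unfolding affine_fun_def by blast
  have "c = a * c + b * c" using assms(2) by (metis distrib_right mult_1)
  moreover have "\<phi> (a *\<^sub>R x + b *\<^sub>R y) = a * \<phi> x + b * \<phi> y"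
    by (simp add: linear_add[OF lin] linear_scale[OF lin])
  ultimately show ?thesis by (simp add: f distrib_left)
qed

lemma affine_fun_nonneg_hull:
  assumes "affine_fun f" "\<And>s. s \<in> S \<Longrightarrow> 0 \<le> f s" "x \<in> convex hull S"
  shows "0 \<le> f x"
proof -
  have "convex hull S \<subseteq> {x. 0 \<le> f x}"
    using assms(1,2) by (intro hull_minimal) (auto simp: convex_def affine_fun_combination)
  then show ?thesis using assms(3) by blast
qed

lemma affine_fun_eq_hull:
  assumes "affine_fun f" "affine_fun g" "\<And>s. s \<in> S \<Longrightarrow> f s = g s" "x \<in> convex hull S"
  shows "f x = g x"
proof -
  have "0 \<le> f x - g x"
    by (rule affine_fun_nonneg_hull[OF affine_fun_diff]) (use assms in auto)
  moreover have "0 \<le> g x - f x"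
    by (rule affine_fun_nonneg_hull[OF affine_fun_diff]) (use assms in auto)
  ultimately show ?thesis by simp
qed

lemma zero_set_face_of:
  assumes f: "affine_fun f" and Q: "convex Q" and f0: "\<And>x. x \<in> Q \<Longrightarrow> 0 \<le> f x"
  shows "{x \<in> Q. f x = 0} face_of Q"
proof -
  have "convex {x \<in> Q. f x = 0}"
    using Q f by (auto simp: convex_def affine_fun_combination)
  moreover have "f a = 0 \<and> f b = 0"
    if ab: "a \<in> Q" "b \<in> Q" "f x = 0" "x \<in> open_segment a b" for a b x
  proof -
    obtain u where u: "0 < u" "u < 1" "x = (1 - u) *\<^sub>R a + u *\<^sub>R b"
      using ab(4) by (auto simp: in_segment)
    then have "(1 - u) * f a + u * f b = 0"
      using affine_fun_combination[OF f, of "1 - u" u a b] ab(3) by simp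
    moreover have "0 \<le> (1 - u) * f a" "0 \<le> u * f b" using u f0 ab by auto
    ultimately have "(1 - u) * f a = 0" "u * f b = 0" by linarith+
    then show ?thesis using u by simp
  qed
  ultimately show ?thesis unfolding face_of_def by blast
qed

text \<open>
  A point of the face is a convex combination of points of \<open>S\<close>. Each of them with a nonzero
  coefficient is an end point of a segment through the given point, hence lies in the face.
\<close>

lemma face_of_convex_hull_finite:
  assumes S: "finite S" and F: "F face_of convex hull S"
  shows "F = convex hull (F \<inter> S)"
proof
  show "convex hull (F \<inter> S) \<subseteq> F"
    using F by (intro hull_minimal) (auto simp: face_of_def)
  show "F \<subseteq> convex hull (F \<inter> S)"
  proof
    fix x assume x: "x \<in> F"
    then have "x \<in> convex hull S" using F face_of_imp_subset by blast
    then obtain u where u: "\<And>s. s \<in> S \<Longrightarrow> 0 \<le> u s" "sum u S = 1" "(\<Sum>s\<in>S. u s *\<^sub>R s) = x"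
      unfolding convex_hull_finite[OF S] by blast
    have inF: "s \<in> F" if s: "s \<in> S" "u s \<noteq> 0" for s
    proof (cases "u s = 1")
      case True
      have "sum u (S - {s}) = 0" using S s u(2) True by (simp add: sum_diff1)
      then have "u t = 0" if "t \<in> S - {s}" for t
        using S u(1) that by (subst (asm) sum_nonneg_eq_0_iff) auto
      then have "(\<Sum>t\<in>S. u t *\<^sub>R t) = (\<Sum>t\<in>{s}. u t *\<^sub>R t)"
        using S s by (intro sum.mono_neutral_right) auto
      then show ?thesis using u(3) x True by simp
    next
      case False
      define y where "y = (\<Sum>t\<in>S - {s}. (u t / (1 - u s)) *\<^sub>R t)"
      have "u s \<le> sum u S" using s S u(1) by (intro member_le_sum) auto
      then have us: "0 < u s" "u s < 1" using u(1)[OF s(1)] s(2) u(2) False by auto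
      have "sum u (S - {s}) = 1 - u s" using S s u(2) by (simp add: sum_diff1)
      then have "(\<Sum>t\<in>S - {s}. u t / (1 - u s)) = 1"
        using us by (simp flip: sum_divide_distrib)
      then have "y \<in> convex hull (S - {s})"
        unfolding y_def using S us u(1) by (intro convex_sum convex_convex_hull) (auto intro: hull_inc)
      then have y: "y \<in> convex hull S" using hull_mono[of "S - {s}" S] by blast
      have "x = u s *\<^sub>R s + (\<Sum>t\<in>S - {s}. u t *\<^sub>R t)"
        using S s u(3) by (simp add: sum.remove[of S s])
      also have "(\<Sum>t\<in>S - {s}. u t *\<^sub>R t) = (1 - u s) *\<^sub>R y"
        unfolding y_def using us by (simp add: scaleR_sum_right)
      finally have xy: "x = (1 - u s) *\<^sub>R y + u s *\<^sub>R s" by (simp add: add.commute)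
      show ?thesis
      proof (cases "y = s")
        case True
        then have "x = s" using xy by (simp flip: scaleR_add_left)
        then show ?thesis using x by simp
      next
        case False
        then have "x \<in> open_segment y s" using xy us by (auto simp: in_segment)
        then show ?thesis using F x y s hull_inc[of s S] unfolding face_of_def by blast
      qed
    qed
    have "(\<Sum>s\<in>S. u s *\<^sub>R s) = (\<Sum>s\<in>F \<inter> S. u s *\<^sub>R s)" "sum u S = sum u (F \<inter> S)"
      using S inF by (auto intro!: sum.mono_neutral_right)
    moreover have "(\<Sum>s\<in>F \<inter> S. u s *\<^sub>R s) \<in> convex hull (F \<inter> S)" if "sum u (F \<inter> S) = 1"
      using S u(1) that by (intro convex_sum convex_convex_hull) (auto intro: hull_inc)
    ultimately show "x \<in> convex hull (F \<inter> S)" using u by simp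
  qed
qed

lemma finite_affine_facets:
  assumes "polytope Q"
  shows "finite {F. affine_facet_of F Q}"
proof -
  obtain S where S: "finite S" "Q = convex hull S" using assms unfolding polytope_def by blast
  have "{F. affine_facet_of F Q} \<subseteq> (hull) convex ` Pow S"
    using face_of_convex_hull_finite[OF S(1)] unfolding affine_facet_of_def S(2) by blast
  then show ?thesis by (rule finite_subset) (simp add: S(1))
qed

text \<open>
  \<open>f\<close> spans an extreme ray of the cone of affine functions that are nonnegative on \<open>Q\<close>, in the
  form of a uniqueness property of its zero set.
\<close>

definition extremal_slack :: "'a::real_vector set \<Rightarrow> ('a \<Rightarrow> real) \<Rightarrow> bool" where
  "extremal_slack Q f \<longleftrightarrow> affine_fun f \<and> (\<forall>x\<in>Q. 0 \<le> f x) \<and>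
     (\<forall>g. affine_fun g \<and> (\<forall>x\<in>Q. f x = 0 \<longrightarrow> g x = 0) \<longrightarrow> (\<exists>c. \<forall>x\<in>Q. g x = c * f x))"

text \<open>
  If the directions of the zero set and one direction leaving it did not span all directions of
  \<open>Q\<close>, a linear functional could vanish on all of the former and not on \<open>Q\<close>. It would give an
  affine function that vanishes on the zero set and at a point where \<open>f\<close> does not, without
  vanishing on \<open>Q\<close>, and so is not a multiple of \<open>f\<close>.
\<close>

lemma extremal_slack_facet:
  assumes Q: "polytope Q" and f: "extremal_slack Q f"
    and z: "z \<in> Q" "f z = 0" and s: "s \<in> Q" "f s \<noteq> 0"
  shows "affine_facet_of {x \<in> Q. f x = 0} Q"
proof -
  let ?Z = "{x \<in> Q. f x = 0}"
  define DQ where "DQ = {x - y | x y. x \<in> Q \<and> y \<in> Q}"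
  define DZ where "DZ = {x - y | x y. x \<in> ?Z \<and> y \<in> ?Z}"
  have aff: "affine_fun f" and nn: "\<And>x. x \<in> Q \<Longrightarrow> 0 \<le> f x" using f by (auto simp: extremal_slack_def)
  obtain \<phi> c where \<phi>: "linear \<phi>" "f = (\<lambda>x. \<phi> x + c)" using aff by (auto simp: affine_fun_def)
  obtain S where S: "finite S" "Q = convex hull S" using Q unfolding polytope_def by blast
  obtain B where B: "B \<subseteq> DZ" "independent B" "DZ \<subseteq> span B"
    by (rule maximal_independent_subset)
  define d where "d = s - z"
  have "span B \<subseteq> {x. \<phi> x = 0}"
    using B(1) by (intro span_minimal linear_subspace_kernel \<phi>(1))
      (auto simp: DZ_def \<phi>(2) linear_diff[OF \<phi>(1)])
  moreover have "\<phi> d \<noteq> 0" using s(2) z(2) by (simp add: d_def linear_diff[OF \<phi>(1)] \<phi>(2))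
  ultimately have d: "d \<notin> span B" by blast
  then have ind: "independent (insert d B)" using B(2) by (rule independent_insertI)
  have sub: "DQ \<subseteq> span (insert d B)"
  proof
    fix w assume w: "w \<in> DQ"
    show "w \<in> span (insert d B)"
    proof (rule ccontr)
      assume nw: "w \<notin> span (insert d B)"
      then have indw: "independent (insert w (insert d B))" using ind by (rule independent_insertI)
      obtain \<psi> :: "'a \<Rightarrow> real" where \<psi>: "linear \<psi>"
          "\<forall>x\<in>insert w (insert d B). \<psi> x = (if x = w then 1 else 0)"
        using linear_independent_extend[OF indw, of "\<lambda>x. if x = w then 1 else 0"] by blast
      have nwi: "w \<notin> insert d B" using nw span_base[of w "insert d B"] by blast
      have "span (insert d B) \<subseteq> {x. \<psi> x = 0}"
        using \<psi> nwi by (intro span_minimal linear_subspace_kernel) auto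
      then have \<psi>0: "\<psi> x = 0" if "x \<in> insert d (span B)" for x
        using that span_mono[of B "insert d B"] span_base[of d "insert d B"] by blast
      define g where "g x = \<psi> x + - \<psi> z" for x
      have g: "affine_fun g" unfolding g_def by (intro affine_funI \<psi>)
      have "g x = 0" if "x \<in> Q" "f x = 0" for x
      proof -
        have "x - z \<in> span B" using that z B(3) unfolding DZ_def by blast
        then have "\<psi> (x - z) = 0" using \<psi>0 by blast
        then show ?thesis by (simp add: g_def linear_diff[OF \<psi>(1)])
      qed
      then obtain a where a: "\<forall>x\<in>Q. g x = a * f x"
        using f g unfolding extremal_slack_def by blast
      have "g s = 0" using \<psi>0[of d] by (simp add: g_def d_def linear_diff[OF \<psi>(1)])
      then have "a = 0" using a s by auto
      then have g0: "g x = 0" if "x \<in> Q" for x using a that by simp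
      obtain x y where "x \<in> Q" "y \<in> Q" "w = x - y" using w unfolding DQ_def by blast
      then have "\<psi> w = g x - g y" "g x = 0" "g y = 0" using g0 by (simp_all add: g_def linear_diff[OF \<psi>(1)])
      then show False using \<psi>(2) by simp
    qed
  qed
  have "insert d B \<subseteq> DQ" using B(1) s z unfolding d_def DQ_def DZ_def by blast
  then have spanQ: "span (insert d B) = span DQ"
    using sub by (intro antisym span_mono span_minimal) auto
  have spanZ: "span B = span DZ" using B by (intro antisym span_mono span_minimal) auto
  have "DQ \<subseteq> span ((\<lambda>t. t - z) ` S)"
  proof -
    have "Q \<subseteq> {x. x - z \<in> span ((\<lambda>t. t - z) ` S)}"
      unfolding S(2)
    proof (intro hull_minimal)
      show "S \<subseteq> {x. x - z \<in> span ((\<lambda>t. t - z) ` S)}" by (auto intro: span_base)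
      show "convex {x. x - z \<in> span ((\<lambda>t. t - z) ` S)}"
      proof (rule convexI)
        fix x y and u v :: real
        assume xy: "x \<in> {x. x - z \<in> span ((\<lambda>t. t - z) ` S)}" "y \<in> {x. x - z \<in> span ((\<lambda>t. t - z) ` S)}"
          "0 \<le> u" "0 \<le> v" "u + v = 1"
        have "u *\<^sub>R z + v *\<^sub>R z = z" using xy(5) by (simp flip: scaleR_add_left)
        then have "u *\<^sub>R x + v *\<^sub>R y - z = u *\<^sub>R (x - z) + v *\<^sub>R (y - z)"
          by (simp add: scaleR_diff_right algebra_simps)
        then show "u *\<^sub>R x + v *\<^sub>R y \<in> {x. x - z \<in> span ((\<lambda>t. t - z) ` S)}"
          using xy by (simp add: span_add span_scale)
      qed
    qed
    then have "x - z - (y - z) \<in> span ((\<lambda>t. t - z) ` S)" if "x \<in> Q" "y \<in> Q" for x y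
      by (rule_tac span_diff) (use that in auto)
    then show ?thesis unfolding DQ_def by auto
  qed
  then have "insert d B \<subseteq> span ((\<lambda>t. t - z) ` S)" using \<open>insert d B \<subseteq> DQ\<close> by blast
  then have fin: "finite (insert d B)"
    using S(1) by (intro conjunct1[OF independent_span_bound[OF _ ind]]) auto
  have "dim DQ = card (insert d B)" using spanQ ind by (rule dim_eq_card)
  moreover have "dim DZ = card B" using spanZ B(2) by (rule dim_eq_card)
  moreover have "d \<notin> B" using d span_base[of d B] by blast
  ultimately have "affine_dim Q = affine_dim ?Z + 1"
    using fin by (simp add: affine_dim_def DQ_def DZ_def)
  moreover have "?Z face_of Q"
    using aff nn S(2) by (intro zero_set_face_of) (auto simp: convex_convex_hull)
  ultimately show ?thesis using z unfolding affine_facet_of_def by blast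
qed

text \<open>
  When \<open>g\<close> is not a multiple of \<open>f\<close>, its ratio to \<open>f\<close> at the vertices where \<open>f\<close> is
  positive has a minimum \<open>c1\<close> below its maximum \<open>c2\<close>. Then \<open>g - c1 f\<close> and \<open>c2 f - g\<close> are
  nonnegative, their sum is a multiple of \<open>f\<close>, and each vanishes at one more vertex.
\<close>

lemma split_non_extremal:
  assumes S: "finite S" and f: "affine_fun f" "\<And>s. s \<in> S \<Longrightarrow> 0 \<le> f s"
    and g: "affine_fun g" "\<And>s. s \<in> S \<Longrightarrow> f s = 0 \<Longrightarrow> g s = 0"
    and ng: "\<nexists>c. \<forall>s\<in>S. g s = c * f s"
  shows "\<exists>f1 f2 a. 0 \<le> a \<and> (\<forall>x. f x = a * f1 x + a * f2 x) \<and>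
    (\<forall>h\<in>{f1, f2}. affine_fun h \<and> (\<forall>s\<in>S. 0 \<le> h s) \<and> {s \<in> S. h s \<noteq> 0} \<subset> {s \<in> S. f s \<noteq> 0})"
proof -
  define T where "T = {s \<in> S. f s \<noteq> 0}"
  define r where "r s = g s / f s" for s
  have T: "finite T" using S by (simp add: T_def)
  have gr: "g s = r s * f s" if "s \<in> S" for s using that g(2) by (auto simp: r_def)
  have "T \<noteq> {}"
  proof
    assume "T = {}"
    then have "\<forall>s\<in>S. g s = 0 * f s" using g(2) by (auto simp: T_def)
    then show False using ng by blast
  qed
  define c1 c2 where "c1 = Min (r ` T)" and "c2 = Max (r ` T)"
  have c1: "c1 \<le> r s" and c2: "r s \<le> c2" if "s \<in> T" for s
    using that T by (auto simp: c1_def c2_def)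
  have "c1 \<in> r ` T" "c2 \<in> r ` T"
    unfolding c1_def c2_def using T \<open>T \<noteq> {}\<close> by (auto intro!: Min_in Max_in simp del: Min_in Max_in)
  then obtain t1 t2 where t1: "t1 \<in> T" "r t1 = c1" and t2: "t2 \<in> T" "r t2 = c2"
    by blast
  have "c1 < c2"
  proof (rule ccontr)
    assume "\<not> c1 < c2"
    then have "r s = c1" if "s \<in> T" for s using c1[OF that] c2[OF that] by simp
    then have "\<forall>s\<in>S. g s = c1 * f s" using gr g(2) by (auto simp: T_def)
    then show False using ng by blast
  qed
  define f1 f2 where "f1 x = g x - c1 * f x" and "f2 x = c2 * f x - g x" for x
  have f1r: "f1 s = (r s - c1) * f s" and f2r: "f2 s = (c2 - r s) * f s" if "s \<in> S" for s
    using gr[OF that] by (simp_all add: f1_def f2_def algebra_simps)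
  show ?thesis
  proof (rule exI[of _ f1], rule exI[of _ f2], rule exI[of _ "1 / (c2 - c1)"], intro conjI)
    show "0 \<le> 1 / (c2 - c1)" using \<open>c1 < c2\<close> by simp
    show "\<forall>x. f x = 1 / (c2 - c1) * f1 x + 1 / (c2 - c1) * f2 x"
    proof
      fix x
      have "1 / (c2 - c1) * f1 x + 1 / (c2 - c1) * f2 x = (f1 x + f2 x) / (c2 - c1)"
        by (simp add: add_divide_distrib)
      also have "f1 x + f2 x = f x * (c2 - c1)" by (simp add: f1_def f2_def algebra_simps)
      finally show "f x = 1 / (c2 - c1) * f1 x + 1 / (c2 - c1) * f2 x" using \<open>c1 < c2\<close> by simp
    qed
  next
    show "\<forall>h\<in>{f1, f2}. affine_fun h \<and> (\<forall>s\<in>S. 0 \<le> h s) \<and> {s \<in> S. h s \<noteq> 0} \<subset> {s \<in> S. f s \<noteq> 0}"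
    proof
      fix h assume h: "h \<in> {f1, f2}"
      have "affine_fun f1" "affine_fun f2"
        unfolding f1_def f2_def by (intro affine_fun_diff affine_fun_cmult f g)+
      moreover have "0 \<le> f1 s" "0 \<le> f2 s" if "s \<in> S" for s
        using c1[of s] c2[of s] f(2)[OF that] that unfolding f1r[OF that] f2r[OF that]
        by (cases "f s = 0"; simp add: T_def)+
      moreover have "f1 t1 = 0" "f2 t2 = 0" "f t1 \<noteq> 0" "f t2 \<noteq> 0" "t1 \<in> S" "t2 \<in> S"
        using t1 t2 f1r[of t1] f2r[of t2] by (auto simp: T_def)
      moreover have "{s \<in> S. h s \<noteq> 0} \<subseteq> {s \<in> S. f s \<noteq> 0}"
        using h f1r f2r by auto
      ultimately show "affine_fun h \<and> (\<forall>s\<in>S. 0 \<le> h s) \<and> {s \<in> S. h s \<noteq> 0} \<subset> {s \<in> S. f s \<noteq> 0}"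
        using h by blast
    qed
  qed
qed

text \<open>
  The extremal slacks with a given zero set are proportional to each other, and one of them is
  selected. The default value \<open>0\<close> keeps the function nonnegative on \<open>Q\<close> for every \<open>F\<close>.
\<close>

definition facet_slack :: "'a::real_vector set \<Rightarrow> 'a set \<Rightarrow> 'a \<Rightarrow> real" where
  "facet_slack Q F = (if \<exists>f. extremal_slack Q f \<and> {x \<in> Q. f x = 0} = F
     then SOME f. extremal_slack Q f \<and> {x \<in> Q. f x = 0} = F else (\<lambda>_. 0))"

lemma facet_slack_nonneg: "x \<in> Q \<Longrightarrow> 0 \<le> facet_slack Q F x"
proof (cases "\<exists>f. extremal_slack Q f \<and> {x \<in> Q. f x = 0} = F")
  case True
  assume x: "x \<in> Q"
  have "extremal_slack Q (facet_slack Q F)"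
    using someI_ex[OF True] by (simp only: facet_slack_def if_P[OF True])
  then show ?thesis using x unfolding extremal_slack_def by blast
next
  case False
  then show ?thesis by (simp only: facet_slack_def False if_False order_refl)
qed

text \<open>
  Splitting terminates because the set of vertices at which the functions are positive shrinks,
  and a function that cannot be split is a multiple of the slack function of its zero set.
\<close>

lemma affine_fun_eq_facet_slack_sum:
  assumes Q: "polytope Q" "Q = convex hull S" "finite S"
    and f: "affine_fun f" "\<And>s. s \<in> S \<Longrightarrow> 0 \<le> f s" and z: "z \<in> S" "f z = 0"
  shows "\<exists>l. (\<forall>F. 0 \<le> l F) \<and>
    (\<forall>x\<in>Q. f x = (\<Sum>F | affine_facet_of F Q. l F * facet_slack Q F x))"
  using f z(2)
proof (induction "card {s \<in> S. f s \<noteq> 0}" arbitrary: f rule: less_induct)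
  case less
  let ?FF = "{F. affine_facet_of F Q}"
  have finFF: "finite ?FF" by (rule finite_affine_facets[OF Q(1)])
  have SQ: "S \<subseteq> Q" by (simp add: Q(2) hull_subset)
  have nonneg: "0 \<le> f x" if "x \<in> Q" for x
    using affine_fun_nonneg_hull[OF less.prems(1,2)] that Q(2) by blast
  show ?case
  proof (cases "\<forall>s\<in>S. f s = 0")
    case True
    then have "f x = 0" if "x \<in> Q" for x
      using affine_fun_eq_hull[OF less.prems(1) affine_fun_const, of S 0] that Q(2) by simp
    then show ?thesis by (intro exI[of _ "\<lambda>_. 0"]) simp
  next
    case False
    then obtain s where s: "s \<in> Q" "f s \<noteq> 0" using SQ by blast
    show ?thesis
    proof (cases "extremal_slack Q f")
      case True
      let ?Z = "{x \<in> Q. f x = 0}"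
      have Z: "?Z \<in> ?FF"
        using extremal_slack_facet[OF Q(1) True _ less.prems(3) s] z(1) SQ by blast
      have ex: "\<exists>h. extremal_slack Q h \<and> {x \<in> Q. h x = 0} = ?Z" using True by blast
      let ?h = "facet_slack Q ?Z"
      have h: "extremal_slack Q ?h" "{x \<in> Q. ?h x = 0} = ?Z"
        using someI_ex[OF ex] by (simp_all only: facet_slack_def if_P[OF ex])
      have "\<forall>x\<in>Q. ?h x = 0 \<longrightarrow> f x = 0" using h(2) by blast
      then obtain c where c: "\<forall>x\<in>Q. f x = c * ?h x"
        using h(1) less.prems(1) unfolding extremal_slack_def by blast
      have "0 < f s" using nonneg[OF s(1)] s(2) by simp
      moreover have "0 \<le> ?h s" "f s = c * ?h s" using facet_slack_nonneg[OF s(1)] c s(1) by blast+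
      ultimately have "0 \<le> c" by (smt (verit) mult_nonpos_nonneg)
      have "f x = (\<Sum>F\<in>?FF. (if F = ?Z then c else 0) * facet_slack Q F x)" if "x \<in> Q" for x
      proof -
        have "(\<Sum>F\<in>?FF. (if F = ?Z then c else 0) * facet_slack Q F x)
            = (\<Sum>F\<in>?FF. if F = ?Z then c * facet_slack Q F x else 0)"
          by (intro sum.cong) auto
        also have "\<dots> = c * ?h x" using Z finFF by simp
        finally show ?thesis using c that by simp
      qed
      then show ?thesis
        using \<open>0 \<le> c\<close> by (intro exI[of _ "\<lambda>F. if F = ?Z then c else 0"]) auto
    next
      case False
      then obtain g where g: "affine_fun g" "\<And>x. x \<in> Q \<Longrightarrow> f x = 0 \<Longrightarrow> g x = 0"
          "\<nexists>c. \<forall>x\<in>Q. g x = c * f x"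
        using nonneg less.prems(1) unfolding extremal_slack_def by blast
      have ng: "\<nexists>c. \<forall>x\<in>S. g x = c * f x"
      proof
        assume "\<exists>c. \<forall>x\<in>S. g x = c * f x"
        then obtain c where c: "\<forall>x\<in>S. g x = c * f x" by blast
        have "\<forall>x\<in>Q. g x = c * f x"
          using affine_fun_eq_hull[OF g(1) affine_fun_cmult[OF less.prems(1), of c], of S] c Q(2) by blast
        then show False using g(3) by blast
      qed
      have gS: "g s = 0" if "s \<in> S" "f s = 0" for s using g(2) SQ that by blast
      have "\<exists>f1 f2 a. 0 \<le> a \<and> (\<forall>x. f x = a * f1 x + a * f2 x) \<and>
        (\<forall>h\<in>{f1, f2}. affine_fun h \<and> (\<forall>s\<in>S. 0 \<le> h s) \<and> {s \<in> S. h s \<noteq> 0} \<subset> {s \<in> S. f s \<noteq> 0})"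
        by (rule split_non_extremal[OF Q(3) less.prems(1) less.prems(2) g(1) gS ng])
      then obtain f1 f2 a where a: "0 \<le> a" "\<forall>x. f x = a * f1 x + a * f2 x"
        and h: "\<forall>h\<in>{f1, f2}. affine_fun h \<and> (\<forall>s\<in>S. 0 \<le> h s) \<and> {s \<in> S. h s \<noteq> 0} \<subset> {s \<in> S. f s \<noteq> 0}"
        by (elim exE conjE)
      have part: "\<exists>l. (\<forall>F. 0 \<le> l F) \<and> (\<forall>x\<in>Q. h x = (\<Sum>F\<in>?FF. l F * facet_slack Q F x))"
        if "h \<in> {f1, f2}" for h
      proof (rule less.hyps)
        show "card {s \<in> S. h s \<noteq> 0} < card {s \<in> S. f s \<noteq> 0}"
          using bspec[OF h that] Q(3) by (intro psubset_card_mono) auto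
        show "affine_fun h" "\<And>s. s \<in> S \<Longrightarrow> 0 \<le> h s" using bspec[OF h that] by auto
        show "h z = 0" using bspec[OF h that] z(1) less.prems(3) by blast
      qed
      obtain l1 where l1: "\<forall>F. 0 \<le> l1 F" "\<forall>x\<in>Q. f1 x = (\<Sum>F\<in>?FF. l1 F * facet_slack Q F x)"
        using part[of f1] by blast
      obtain l2 where l2: "\<forall>F. 0 \<le> l2 F" "\<forall>x\<in>Q. f2 x = (\<Sum>F\<in>?FF. l2 F * facet_slack Q F x)"
        using part[of f2] by blast
      show ?thesis
      proof (intro exI conjI allI ballI)
        show "0 \<le> a * l1 F + a * l2 F" for F using a(1) l1(1) l2(1) by simp
        show "f x = (\<Sum>F\<in>?FF. (a * l1 F + a * l2 F) * facet_slack Q F x)" if "x \<in> Q" for x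
        proof -
          have "f x = a * (\<Sum>F\<in>?FF. l1 F * facet_slack Q F x) + a * (\<Sum>F\<in>?FF. l2 F * facet_slack Q F x)"
            using a(2) l1(2) l2(2) that by simp
          then show ?thesis by (simp add: distrib_right mult.assoc sum.distrib sum_distrib_left)
        qed
      qed
    qed
  qed
qed


text \<open>
  With at most one facet, the functions \<open>\<phi> - min \<phi>\<close> and \<open>max \<phi> - \<phi>\<close> would be multiples of the
  same function and have a common zero; so every linear functional \<open>\<phi>\<close> would be constant.
\<close>

lemma two_le_card_facets:
  assumes Q: "polytope Q" and ab: "a \<in> Q" "b \<in> Q" "a \<noteq> b"
  shows "2 \<le> card {F. affine_facet_of F Q}"
proof (rule ccontr)
  let ?FF = "{F. affine_facet_of F Q}"
  assume "\<not> 2 \<le> card ?FF"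
  then have "card ?FF = 0 \<or> card ?FF = 1" by linarith
  then have "?FF = {} \<or> (\<exists>F. ?FF = {F})"
    using finite_affine_facets[OF Q] by (auto simp: card_1_singleton_iff)
  then obtain G where G: "?FF \<subseteq> {G}" by (metis empty_subsetI order_refl)
  obtain S where S: "finite S" "Q = convex hull S" using Q unfolding polytope_def by blast
  have ind: "independent {a - b}" using ab(3) by simp
  obtain \<phi> :: "'a \<Rightarrow> real" where \<phi>: "linear \<phi>" "\<forall>x\<in>{a - b}. \<phi> x = 1"
    using linear_independent_extend[OF ind, of "\<lambda>_. 1"] by blast
  have "S \<noteq> {}" using ab(1) S by auto
  then have "Min (\<phi> ` S) \<in> \<phi> ` S" "Max (\<phi> ` S) \<in> \<phi> ` S"
    using S(1) by (intro Min_in Max_in; simp)+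
  then obtain p q where p: "p \<in> S" "Min (\<phi> ` S) = \<phi> p" and q: "q \<in> S" "Max (\<phi> ` S) = \<phi> q"
    by (elim imageE)
  have pmin: "\<phi> p \<le> \<phi> s" and qmax: "\<phi> s \<le> \<phi> q" if "s \<in> S" for s
    using that S(1) p(2) q(2) Min_le[of "\<phi> ` S" "\<phi> s"] Max_ge[of "\<phi> ` S" "\<phi> s"] by simp_all
  have pqQ: "p \<in> Q" "q \<in> Q" by (simp_all add: S(2) p(1) q(1) hull_inc)
  have aff: "affine_fun (\<lambda>x. \<phi> x - \<phi> p)" "affine_fun (\<lambda>x. \<phi> q - \<phi> x)"
    using affine_funI[OF \<phi>(1), of 0] by (auto intro!: affine_fun_diff affine_fun_const)
  obtain l where l: "\<And>x. x \<in> Q \<Longrightarrow> \<phi> x - \<phi> p = (\<Sum>F\<in>?FF. l F * facet_slack Q F x)"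
    using affine_fun_eq_facet_slack_sum[OF Q S(2,1) aff(1) _ p(1)] pmin by auto
  obtain l' where l': "\<And>x. x \<in> Q \<Longrightarrow> \<phi> q - \<phi> x = (\<Sum>F\<in>?FF. l' F * facet_slack Q F x)"
    using affine_fun_eq_facet_slack_sum[OF Q S(2,1) aff(2) _ q(1)] qmax by auto
  have "\<phi> p = \<phi> q"
  proof (cases "?FF = {}")
    case True
    then show ?thesis using l[OF pqQ(2)] by simp
  next
    case False
    then have FF: "?FF = {G}" using G by blast
    have "\<phi> q - \<phi> p = l G * facet_slack Q G q" "0 = l' G * facet_slack Q G q"
      "0 = l G * facet_slack Q G p" "\<phi> q - \<phi> p = l' G * facet_slack Q G p"
      using l[OF pqQ(2)] l[OF pqQ(1)] l'[OF pqQ(1)] l'[OF pqQ(2)] by (simp_all add: FF)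
    then show ?thesis by auto
  qed
  then have const: "\<phi> s = \<phi> p" if "s \<in> S" for s using pmin[OF that] qmax[OF that] by simp
  have "\<phi> x - \<phi> p = 0" if "x \<in> Q" for x
    using affine_fun_eq_hull[OF aff(1) affine_fun_const, of S 0 x] const that S(2) by simp
  from this[of a] this[of b] ab have "\<phi> a = \<phi> b" by simp
  then show False using \<phi> by (simp add: linear_diff)
qed


section \<open>Factorisation of the slacks of a polytope through an extension\<close>

text \<open>
  The set of extensions over which the extension complexity is a minimum is not empty: the unit
  vectors can be mapped to the vertices.
\<close>

lemma polytope_linear_image_simplex:
  fixes P :: "'a::real_vector set"
  assumes "polytope P"
  obtains Q :: "fin_vec set" and f where "polytope Q" "linear f" "f ` Q = P"
proof -
  obtain S where S: "finite S" "P = convex hull S" using assms unfolding polytope_def by blast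
  obtain h where h: "bij_betw h {..<card S} S"
    using ex_bij_betw_nat_finite[OF S(1)] by (auto simp: atLeast0LessThan)
  define e where "e i = (Poly_Mapping.single i 1 :: fin_vec)" for i
  define f where "f x = (\<Sum>i<card S. Poly_Mapping.lookup x i *\<^sub>R h i)" for x :: fin_vec
  have lin: "linear f"
    by (rule linearI) (simp_all add: f_def lookup_add scaleR_add_left sum.distrib scaleR_sum_right)
  have "f (e i) = h i" if "i < card S" for i
  proof -
    have "f (e i) = (\<Sum>j<card S. if j = i then h j else 0)"
      unfolding f_def e_def by (intro sum.cong) (auto simp: lookup_single)
    then show ?thesis using that by simp
  qed
  then have "f ` e ` {..<card S} = h ` {..<card S}" by (auto simp: image_image intro!: image_cong)
  also have "\<dots> = S" using h by (rule bij_betw_imp_surj_on)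
  finally have "f ` (convex hull (e ` {..<card S})) = P"
    using convex_hull_linear_image[OF lin, of "e ` {..<card S}"] S(2) by simp
  moreover have "polytope (convex hull (e ` {..<card S}))"
    unfolding polytope_def by (intro exI[of _ "e ` {..<card S}"]) simp
  ultimately show ?thesis using lin by (intro that)
qed

lemma extension_complexity_attained:
  assumes "polytope P"
  obtains Q :: "fin_vec set" and f where "polytope Q" "linear f" "f ` Q = P"
    "card {F. affine_facet_of F Q} = extension_complexity P"
proof -
  let ?ok = "\<lambda>k. \<exists>(Q :: fin_vec set) f. polytope Q \<and> card {F. affine_facet_of F Q} = k \<and> linear f \<and> f ` Q = P"
  have "\<exists>k. ?ok k" using polytope_linear_image_simplex[OF assms] by metis
  then have "?ok (extension_complexity P)"
    unfolding extension_complexity_def by (rule LeastI_ex)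
  then show ?thesis by (elim exE conjE) (rule that)
qed

lemma two_le_extension_complexity:
  assumes "polytope P" "X \<in> P" "Y \<in> P" "X \<noteq> Y"
  shows "2 \<le> extension_complexity P"
proof -
  obtain Q :: "fin_vec set" and f where Q: "polytope Q" "linear f" "f ` Q = P"
    "card {F. affine_facet_of F Q} = extension_complexity P"
    using extension_complexity_attained[OF assms(1)] by blast
  obtain a b where "a \<in> Q" "b \<in> Q" "f a = X" "f b = Y" using assms Q(3) by blast
  then show ?thesis using two_le_card_facets[OF Q(1), of a b] assms(4) Q(4) by auto
qed

text \<open>
  Every point of \<open>P\<close> is lifted to the extension once and for all. A linear inequality that is
  valid on \<open>P\<close> pulls back to one on the extension, where the facet slacks express it.
\<close>

lemma slack_factorization:
  fixes P :: "'a::real_vector set"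
  assumes P: "polytope P" "P \<noteq> {}"
  obtains \<F> :: "fin_vec set set" and u :: "fin_vec set \<Rightarrow> 'a \<Rightarrow> real" where
    "finite \<F>" "card \<F> = extension_complexity P" "\<forall>F. \<forall>X\<in>P. 0 \<le> u F X"
    "\<forall>\<phi> b. linear \<phi> \<and> (\<forall>X\<in>P. \<phi> X \<le> b) \<longrightarrow>
      (\<exists>l0 l. 0 \<le> l0 \<and> (\<forall>F. 0 \<le> l F) \<and> (\<forall>X\<in>P. b - \<phi> X = l0 + (\<Sum>F\<in>\<F>. l F * u F X)))"
proof -
  obtain Q :: "fin_vec set" and f where Q: "polytope Q" "linear f" "f ` Q = P"
    "card {F. affine_facet_of F Q} = extension_complexity P"
    using extension_complexity_attained[OF P(1)] by blast
  obtain S where S: "finite S" "Q = convex hull S" using Q(1) unfolding polytope_def by blast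
  have "S \<noteq> {}" using P(2) Q(3) S(2) by auto
  define \<sigma> where "\<sigma> = inv_into Q f"
  have \<sigma>: "\<sigma> X \<in> Q" "f (\<sigma> X) = X" if "X \<in> P" for X
    using that Q(3) unfolding \<sigma>_def by (auto intro: inv_into_into f_inv_into_f)
  show ?thesis
  proof (rule that[of "{F. affine_facet_of F Q}" "\<lambda>F X. facet_slack Q F (\<sigma> X)"])
    show "finite {F. affine_facet_of F Q}" by (rule finite_affine_facets[OF Q(1)])
    show "\<forall>F. \<forall>X\<in>P. 0 \<le> facet_slack Q F (\<sigma> X)"
      using facet_slack_nonneg \<sigma>(1) by blast
  next
    have "\<exists>l0 l. 0 \<le> l0 \<and> (\<forall>F. 0 \<le> l F) \<and>
        (\<forall>X\<in>P. b - \<phi> X = l0 + (\<Sum>F | affine_facet_of F Q. l F * facet_slack Q F (\<sigma> X)))"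
      if \<phi>: "linear \<phi>" "\<And>X. X \<in> P \<Longrightarrow> \<phi> X \<le> b" for \<phi> :: "'a \<Rightarrow> real" and b
    proof -
      define g where "g x = b - \<phi> (f x)" for x
      have g: "affine_fun g"
        unfolding g_def using affine_funI[OF linear_compose[OF Q(2) \<phi>(1)], of 0]
        by (intro affine_fun_diff affine_fun_const) (simp add: o_def)
      define l0 where "l0 = Min (g ` S)"
      have "l0 \<in> g ` S" unfolding l0_def using S(1) \<open>S \<noteq> {}\<close> by (intro Min_in) auto
      then obtain z where z: "z \<in> S" "g z = l0" by (elim imageE) simp
      have min: "l0 \<le> g s" if "s \<in> S" for s using that S(1) by (simp add: l0_def)
      have "z \<in> Q" by (simp add: S(2) z(1) hull_inc)
      then have "0 \<le> l0" using \<phi>(2)[of "f z"] Q(3) z(2) by (auto simp: g_def)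
      have aff: "affine_fun (\<lambda>x. g x - l0)" by (intro affine_fun_diff g affine_fun_const)
      obtain l where l: "\<forall>F. 0 \<le> l F"
        "\<forall>x\<in>Q. g x - l0 = (\<Sum>F | affine_facet_of F Q. l F * facet_slack Q F x)"
        using affine_fun_eq_facet_slack_sum[OF Q(1) S(2,1) aff _ z(1)] min z(2) by auto
      have "b - \<phi> X = l0 + (\<Sum>F | affine_facet_of F Q. l F * facet_slack Q F (\<sigma> X))" if "X \<in> P" for X
        using l(2) \<sigma>[OF that] by (metis g_def diff_add_cancel add.commute)
      then show ?thesis using \<open>0 \<le> l0\<close> l(1) by blast
    qed
    then show "\<forall>\<phi> b. linear \<phi> \<and> (\<forall>X\<in>P. \<phi> X \<le> b) \<longrightarrow>
      (\<exists>l0 l. 0 \<le> l0 \<and> (\<forall>F. 0 \<le> l F) \<and>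
        (\<forall>X\<in>P. b - \<phi> X = l0 + (\<Sum>F | affine_facet_of F Q. l F * facet_slack Q F (\<sigma> X))))"
      by blast
  qed (rule Q(4))
qed


section \<open>Gaussian vectors with independent coordinates\<close>

abbreviation gauss :: "'i set \<Rightarrow> ('i \<Rightarrow> real) measure" where
  "gauss I \<equiv> PiM I (\<lambda>_. std_normal_distribution)"

lemma prob_space_std_normal: "prob_space std_normal_distribution"
  by (rule prob_space_normal_density) simp

lemma has_bochner_integral_std_normal:
  fixes f :: "real \<Rightarrow> real"
  assumes "f \<in> borel_measurable borel"
    and "has_bochner_integral lborel (\<lambda>x. std_normal_density x * f x) v"
  shows "has_bochner_integral std_normal_distribution f v"
  using assms by (intro has_bochner_integral_density) auto

lemma std_normal_expectations:
  shows "has_bochner_integral std_normal_distribution (\<lambda>x. exp (a * x)) (exp (a\<^sup>2 / 2))"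
    and "has_bochner_integral std_normal_distribution (\<lambda>x. x\<^sup>2) 1"
    and "has_bochner_integral std_normal_distribution (\<lambda>x. 1) (1::real)"
    and "has_bochner_integral std_normal_distribution (\<lambda>x. x) 0"
    and "has_bochner_integral std_normal_distribution (\<lambda>x. \<bar>x\<bar>) (sqrt (2 / pi))"
    and "has_bochner_integral std_normal_distribution sgn (0::real)"
proof -
  show "has_bochner_integral std_normal_distribution (\<lambda>x. exp (a * x)) (exp (a\<^sup>2 / 2))"
    using std_normal_mgf by (intro has_bochner_integral_std_normal) auto
  show "has_bochner_integral std_normal_distribution (\<lambda>x. x\<^sup>2) 1"
    using std_normal_moment_even[of 1] by (intro has_bochner_integral_std_normal) auto
  show "has_bochner_integral std_normal_distribution (\<lambda>x. 1) (1::real)"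
    using std_normal_moment_even[of 0] by (intro has_bochner_integral_std_normal) auto
  show "has_bochner_integral std_normal_distribution (\<lambda>x. x) 0"
    using std_normal_moment_odd[of 0] by (intro has_bochner_integral_std_normal) auto
  show "has_bochner_integral std_normal_distribution (\<lambda>x. \<bar>x\<bar>) (sqrt (2 / pi))"
    using std_normal_moment_abs_odd[of 0] by (intro has_bochner_integral_std_normal) auto
  have "integrable lborel (\<lambda>x. std_normal_density x * sgn x)"
    by (rule Bochner_Integration.integrable_bound[OF integrable_normal_density[of 1 0]])
       (auto simp: abs_mult abs_sgn_eq)
  moreover have "(\<integral>x. std_normal_density x * sgn x \<partial>lborel) = (\<integral>x. - (std_normal_density x * sgn x) \<partial>lborel)"
    using lborel_integral_real_affine[of "- 1" "\<lambda>x. std_normal_density x * sgn x" 0]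
    by (simp add: std_normal_density_def sgn_minus)
  then have "(\<integral>x. std_normal_density x * sgn x \<partial>lborel) = 0" by simp
  ultimately show "has_bochner_integral std_normal_distribution sgn (0::real)"
    by (intro has_bochner_integral_std_normal) (auto simp: has_bochner_integral_iff)
qed

lemma has_bochner_integral_gauss_prod:
  fixes f :: "'i \<Rightarrow> real \<Rightarrow> real"
  assumes "finite I" "\<And>i. i \<in> I \<Longrightarrow> has_bochner_integral std_normal_distribution (f i) (v i)"
  shows "has_bochner_integral (gauss I) (\<lambda>\<omega>. \<Prod>i\<in>I. f i (\<omega> i)) (\<Prod>i\<in>I. v i)"
proof -
  interpret product_sigma_finite "\<lambda>_ :: 'i. std_normal_distribution"
    by (rule product_sigma_finite.intro) (rule prob_space_imp_sigma_finite[OF prob_space_std_normal])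
  have "integrable (gauss I) (\<lambda>\<omega>. \<Prod>i\<in>I. f i (\<omega> i))"
    using assms by (intro product_integrable_prod) (auto simp: has_bochner_integral_iff)
  moreover have "(\<integral>\<omega>. (\<Prod>i\<in>I. f i (\<omega> i)) \<partial>gauss I) = (\<Prod>i\<in>I. v i)"
    using assms by (subst product_integral_prod) (auto simp: has_bochner_integral_iff)
  ultimately show ?thesis by (simp add: has_bochner_integral_iff)
qed

lemma has_bochner_integral_gauss_coordinate:
  fixes f :: "real \<Rightarrow> real"
  assumes I: "finite I" "p \<in> I" and f: "has_bochner_integral std_normal_distribution f v"
  shows "has_bochner_integral (gauss I) (\<lambda>\<omega>. f (\<omega> p)) v"
proof -
  have "has_bochner_integral (gauss I) (\<lambda>\<omega>. \<Prod>i\<in>I. (if i = p then f else (\<lambda>_. 1)) (\<omega> i)) (\<Prod>i\<in>I. if i = p then v else 1)"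
    using f std_normal_expectations(3) by (intro has_bochner_integral_gauss_prod I(1)) auto
  also have "(\<lambda>\<omega>. \<Prod>i\<in>I. (if i = p then f else (\<lambda>_. 1)) (\<omega> i)) = (\<lambda>\<omega>. f (\<omega> p))"
  proof
    fix \<omega> :: "'a \<Rightarrow> real"
    have "(\<Prod>i\<in>I. (if i = p then f else (\<lambda>_. 1)) (\<omega> i)) = (\<Prod>i\<in>I. if i = p then f (\<omega> i) else 1)"
      by (intro prod.cong) auto
    then show "(\<Prod>i\<in>I. (if i = p then f else (\<lambda>_. 1)) (\<omega> i)) = f (\<omega> p)" using I by simp
  qed
  also have "(\<Prod>i\<in>I. if i = p then v else 1) = v" using I by simp
  finally show ?thesis .
qed

lemma has_bochner_integral_gauss_exp_linear:
  assumes "finite I"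
  shows "has_bochner_integral (gauss I) (\<lambda>\<omega>. exp (\<Sum>p\<in>I. a p * \<omega> p)) (exp ((\<Sum>p\<in>I. (a p)\<^sup>2) / 2))"
proof -
  have "has_bochner_integral (gauss I) (\<lambda>\<omega>. \<Prod>p\<in>I. exp (a p * \<omega> p)) (\<Prod>p\<in>I. exp ((a p)\<^sup>2 / 2))"
    using std_normal_expectations(1) by (intro has_bochner_integral_gauss_prod assms)
  then show ?thesis using assms by (simp add: exp_sum sum_divide_distrib)
qed

text \<open>
  The indicator that \<open>\<omega>\<close> has sign pattern \<open>\<tau>\<close>, except that a coordinate equal to \<open>0\<close> is split
  evenly between the two signs.
\<close>

definition sign_weight :: "'i set \<Rightarrow> ('i \<Rightarrow> real) \<Rightarrow> ('i \<Rightarrow> real) \<Rightarrow> real" where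
  "sign_weight I \<tau> \<omega> = (\<Prod>i\<in>I. (1 + \<tau> i * sgn (\<omega> i)) / 2)"

lemma sign_weight_nonneg: "\<tau> \<in> cube I \<Longrightarrow> 0 \<le> sign_weight I \<tau> \<omega>"
  unfolding sign_weight_def
  by (intro prod_nonneg) (auto simp: cube_def PiE_iff sgn_if)

lemma sum_sign_weight:
  assumes "finite I"
  shows "(\<Sum>\<tau>\<in>cube I. sign_weight I \<tau> \<omega>) = 1"
proof -
  have "(\<Sum>\<tau>\<in>cube I. sign_weight I \<tau> \<omega>) = (\<Prod>i\<in>I. \<Sum>t\<in>{- 1, 1}. (1 + t * sgn (\<omega> i)) / 2)"
    unfolding cube_def sign_weight_def using assms by (subst prod_sum_PiE) auto
  then show ?thesis by (simp add: field_simps)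
qed

lemma has_bochner_integral_sign_weight:
  assumes I: "finite I" "p \<in> I"
  shows "has_bochner_integral (gauss I) (\<lambda>\<omega>. \<omega> p * sign_weight I \<tau> \<omega>) (\<tau> p * sqrt (2 / pi) / 2 ^ card I)"
proof -
  let ?f = "\<lambda>i x. (if i = p then x else 1) * ((1 + \<tau> i * sgn x) / 2)"
  have "has_bochner_integral std_normal_distribution (\<lambda>x. 1 / 2 * x + \<tau> p / 2 * \<bar>x\<bar>) (1 / 2 * 0 + \<tau> p / 2 * sqrt (2 / pi))"
    by (intro has_bochner_integral_add has_bochner_integral_mult_right std_normal_expectations)
  moreover have "(\<lambda>x. 1 / 2 * x + \<tau> p / 2 * \<bar>x\<bar>) = ?f p"
    by (auto simp: fun_eq_iff sgn_if abs_if field_simps)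
  ultimately have p: "has_bochner_integral std_normal_distribution (?f p) (\<tau> p / 2 * sqrt (2 / pi))"
    by (simp only: mult_zero_right add_0_left)
  have np: "has_bochner_integral std_normal_distribution (?f i) (1 / 2)" if "i \<noteq> p" for i
  proof -
    have "has_bochner_integral std_normal_distribution (\<lambda>x. 1 / 2 * 1 + \<tau> i / 2 * sgn x) (1 / 2 * 1 + \<tau> i / 2 * 0)"
      by (intro has_bochner_integral_add has_bochner_integral_mult_right std_normal_expectations)
    moreover have "(\<lambda>x. 1 / 2 * 1 + \<tau> i / 2 * sgn x) = ?f i"
      using that by (auto simp: fun_eq_iff field_simps)
    ultimately show ?thesis by (simp only: mult_zero_right add_0_right mult_1_right)
  qed
  have "has_bochner_integral std_normal_distribution (?f i) (if i = p then \<tau> p / 2 * sqrt (2 / pi) else 1 / 2)" for i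
    using p np by (cases "i = p") (simp_all only: if_True if_False refl)
  from has_bochner_integral_gauss_prod[OF I(1) this]
  have "has_bochner_integral (gauss I) (\<lambda>\<omega>. \<Prod>i\<in>I. ?f i (\<omega> i)) (\<Prod>i\<in>I. if i = p then \<tau> p / 2 * sqrt (2 / pi) else 1 / 2)" .
  also have "(\<lambda>\<omega>. \<Prod>i\<in>I. ?f i (\<omega> i)) = (\<lambda>\<omega>. \<omega> p * sign_weight I \<tau> \<omega>)"
    unfolding sign_weight_def prod.distrib using I by simp
  also have "(\<Prod>i\<in>I. if i = p then \<tau> p / 2 * sqrt (2 / pi) else 1 / 2) = \<tau> p / 2 * sqrt (2 / pi) * (\<Prod>i\<in>I - {p}. 1 / 2)"
    using I by (subst prod.remove[OF I]) (auto intro!: prod.cong)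
  also have "\<dots> = \<tau> p * sqrt (2 / pi) / (2 * 2 ^ card (I - {p}))"
    by (simp add: power_divide)
  also have "(2::real) * 2 ^ card (I - {p}) = 2 ^ card I"
    using card_Suc_Diff1[OF I] by (metis power_Suc)
  finally show ?thesis .
qed


section \<open>Comparing the Gaussian width with random signs\<close>

lemma linear_trace_inner: "linear (trace_inner n A)"
  by (rule linearI)
     (simp_all add: trace_inner_def lookup_add distrib_left sum.distrib sum_distrib_left mult_ac)

lemma trace_inner_gaussian_mat:
  "trace_inner n (gaussian_mat n \<omega>) X = (\<Sum>p\<in>sym_index n. \<omega> p * trace_inner n (sym_basis p) X)"
proof -
  have "trace_inner n (gaussian_mat n \<omega>) X
      = (\<Sum>i<n. \<Sum>j<n. \<Sum>p\<in>sym_index n. \<omega> p * (entry (sym_basis p) i j * entry X j i))"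
    by (simp add: trace_inner_def gaussian_mat_def lookup_sum sum_distrib_right mult.assoc)
  also have "\<dots> = (\<Sum>i<n. \<Sum>p\<in>sym_index n. \<Sum>j<n. \<omega> p * (entry (sym_basis p) i j * entry X j i))"
    by (intro sum.cong refl sum.swap)
  also have "\<dots> = (\<Sum>p\<in>sym_index n. \<Sum>i<n. \<Sum>j<n. \<omega> p * (entry (sym_basis p) i j * entry X j i))"
    by (rule sum.swap)
  finally show ?thesis by (simp add: trace_inner_def sum_distrib_left)
qed

lemma linear_le_Max_hull:
  fixes \<phi> :: "'a::real_vector \<Rightarrow> real"
  assumes "linear \<phi>" "finite S" "X \<in> convex hull S"
  shows "\<phi> X \<le> Max (\<phi> ` S)"
proof -
  have "convex {X. \<phi> X \<le> Max (\<phi> ` S)}"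
    using convex_linear_vimage[OF assms(1), of "{..Max (\<phi> ` S)}"] by (simp add: vimage_def)
  then have "convex hull S \<subseteq> {X. \<phi> X \<le> Max (\<phi> ` S)}"
    using assms(2) by (intro hull_minimal) auto
  then show ?thesis using assms(3) by blast
qed

lemma SUP_linear_hull:
  fixes \<phi> :: "'a::real_vector \<Rightarrow> real"
  assumes "linear \<phi>" "finite S" "S \<noteq> {}"
  shows "(SUP X\<in>convex hull S. \<phi> X) = Max (\<phi> ` S)"
proof (rule cSup_eq_maximum)
  have "Max (\<phi> ` S) \<in> \<phi> ` S" using assms by (intro Max_in) auto
  then show "Max (\<phi> ` S) \<in> \<phi> ` (convex hull S)" using hull_subset[of S convex] by blast
qed (use linear_le_Max_hull[OF assms(1,2)] in auto)

text \<open>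
  Fixing for every sign pattern \<open>\<tau>\<close> a maximiser \<open>X \<tau>\<close> of the corresponding linear functional
  gives, for a Gaussian vector with signs \<open>\<tau>\<close>, the feasible point \<open>X \<tau>\<close>. Conditionally on the
  signs, each coordinate has mean \<open>sqrt (2 / pi)\<close> times its sign.
\<close>

lemma gaussian_width_ge_mean_signs:
  assumes P: "polytope P" "P \<noteq> {}"
  shows "sqrt (2 / pi) * mean (cube (sym_index n)) (\<lambda>\<tau>. SUP X\<in>P. trace_inner n (gaussian_mat n \<tau>) X)
    \<le> gaussian_width n P"
proof -
  let ?I = "sym_index n"
  obtain S where S: "finite S" "P = convex hull S" using P(1) unfolding polytope_def by blast
  have "S \<noteq> {}" using P(2) S(2) by auto
  define L where "L \<omega> X = trace_inner n (gaussian_mat n \<omega>) X" for \<omega> X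
  define a where "a X p = trace_inner n (sym_basis p) X" for X p
  have L: "L \<omega> X = (\<Sum>p\<in>?I. \<omega> p * a X p)" for \<omega> X
    unfolding L_def a_def by (rule trace_inner_gaussian_mat)
  have SUP: "(SUP X\<in>P. L \<omega> X) = Max (L \<omega> ` S)" for \<omega>
    unfolding L_def S(2) by (intro SUP_linear_hull linear_trace_inner S \<open>S \<noteq> {}\<close>)
  have int_L: "integrable (gauss ?I) (\<lambda>\<omega>. L \<omega> X)" for X
  proof -
    have "integrable (gauss ?I) (\<lambda>\<omega>. \<omega> p * a X p)" if "p \<in> ?I" for p
      using has_bochner_integral_gauss_coordinate[OF finite_sym_index that std_normal_expectations(4)]
      by (intro integrable_mult_left) (simp add: has_bochner_integral_iff)
    then show ?thesis unfolding L by (intro Bochner_Integration.integrable_sum)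
  qed
  have int_Max: "integrable (gauss ?I) (\<lambda>\<omega>. Max (L \<omega> ` S))"
  proof (rule Bochner_Integration.integrable_bound)
    show "integrable (gauss ?I) (\<lambda>\<omega>. \<Sum>X\<in>S. \<bar>L \<omega> X\<bar>)"
      using int_L by (intro Bochner_Integration.integrable_sum integrable_abs)
    show "(\<lambda>\<omega>. Max (L \<omega> ` S)) \<in> borel_measurable (gauss ?I)"
      using S(1) int_L by (intro borel_measurable_Max borel_measurable_integrable)
    have "\<bar>Max (L \<omega> ` S)\<bar> \<le> (\<Sum>X\<in>S. \<bar>L \<omega> X\<bar>)" for \<omega>
    proof -
      have "Max (L \<omega> ` S) \<in> L \<omega> ` S" using S(1) \<open>S \<noteq> {}\<close> by (intro Max_in) auto
      then obtain X where X: "X \<in> S" "Max (L \<omega> ` S) = L \<omega> X" by (elim imageE)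
      then show ?thesis using S(1) member_le_sum[of X S "\<lambda>X. \<bar>L \<omega> X\<bar>"] by simp
    qed
    then show "AE \<omega> in gauss ?I. norm (Max (L \<omega> ` S)) \<le> norm (\<Sum>X\<in>S. \<bar>L \<omega> X\<bar>)"
      by (intro AE_I2) (simp add: sum_nonneg)
  qed
  have "\<exists>X\<in>S. Max (L \<tau> ` S) = L \<tau> X" for \<tau>
  proof -
    have "Max (L \<tau> ` S) \<in> L \<tau> ` S" using S(1) \<open>S \<noteq> {}\<close> by (intro Max_in) auto
    then show ?thesis by (elim imageE) auto
  qed
  then obtain best where best: "\<And>\<tau>. best \<tau> \<in> S" "\<And>\<tau>. Max (L \<tau> ` S) = L \<tau> (best \<tau>)"
    by metis
  have opt: "(SUP X\<in>P. L \<tau> X) = (\<Sum>p\<in>?I. \<tau> p * a (best \<tau>) p)" for \<tau>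
    unfolding SUP best(2) by (rule L)
  have "has_bochner_integral (gauss ?I)
      (\<lambda>\<omega>. \<Sum>\<tau>\<in>cube ?I. \<Sum>p\<in>?I. a (best \<tau>) p * (\<omega> p * sign_weight ?I \<tau> \<omega>))
      (\<Sum>\<tau>\<in>cube ?I. \<Sum>p\<in>?I. a (best \<tau>) p * (\<tau> p * sqrt (2 / pi) / 2 ^ card ?I))"
    by (intro has_bochner_integral_sum has_bochner_integral_mult_right
        has_bochner_integral_sign_weight finite_sym_index)
  moreover have "(\<Sum>\<tau>\<in>cube ?I. \<Sum>p\<in>?I. a (best \<tau>) p * (\<tau> p * sqrt (2 / pi) / 2 ^ card ?I))
      = sqrt (2 / pi) * mean (cube ?I) (\<lambda>\<tau>. SUP X\<in>P. L \<tau> X)"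
    unfolding opt mean_def
    by (simp add: cube_def card_PiE finite_sym_index sum_distrib_left sum_divide_distrib mult_ac numeral_2_eq_2)
  moreover have "(\<Sum>\<tau>\<in>cube ?I. \<Sum>p\<in>?I. a (best \<tau>) p * (\<omega> p * sign_weight ?I \<tau> \<omega>)) \<le> Max (L \<omega> ` S)" for \<omega>
  proof -
    have "(\<Sum>\<tau>\<in>cube ?I. \<Sum>p\<in>?I. a (best \<tau>) p * (\<omega> p * sign_weight ?I \<tau> \<omega>))
        = (\<Sum>\<tau>\<in>cube ?I. sign_weight ?I \<tau> \<omega> * L \<omega> (best \<tau>))"
      unfolding L by (simp add: sum_distrib_left mult_ac)
    also have "\<dots> \<le> (\<Sum>\<tau>\<in>cube ?I. sign_weight ?I \<tau> \<omega> * Max (L \<omega> ` S))"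
      using best(1) S(1) by (intro sum_mono mult_left_mono sign_weight_nonneg) auto
    also have "\<dots> = Max (L \<omega> ` S)"
      by (simp add: sum_sign_weight finite_sym_index flip: sum_distrib_right)
    finally show ?thesis .
  qed
  ultimately have "sqrt (2 / pi) * mean (cube ?I) (\<lambda>\<tau>. SUP X\<in>P. L \<tau> X) \<le> (\<integral>\<omega>. Max (L \<omega> ` S) \<partial>gauss ?I)"
    using int_Max by (metis (no_types, lifting) has_bochner_integral_iff integral_mono)
  then show ?thesis unfolding gaussian_width_def gaussian_coords_def SUP[symmetric] by (simp add: L_def)
qed


section \<open>The Gaussian width of the density matrices\<close>

definition outer_mat :: "nat \<Rightarrow> (nat \<Rightarrow> real) \<Rightarrow> fin_mat" where
  "outer_mat n x = (\<Sum>p\<in>{..<n} \<times> {..<n}. Poly_Mapping.single p (x (fst p) * x (snd p)))"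

lemma entry_outer_mat: "entry (outer_mat n x) i j = (if i < n \<and> j < n then x i * x j else 0)"
proof -
  have "entry (outer_mat n x) i j
      = (\<Sum>p\<in>{..<n} \<times> {..<n}. if p = (i, j) then x (fst p) * x (snd p) else 0)"
    unfolding outer_mat_def lookup_sum by (intro sum.cong) (auto simp: lookup_single when_def)
  then show ?thesis by simp
qed

lemma outer_mat_density:
  assumes "(\<Sum>i<n. (x i)\<^sup>2) = 1"
  shows "outer_mat n x \<in> density_mats n"
proof -
  have "Poly_Mapping.keys (outer_mat n x) \<subseteq> {..<n} \<times> {..<n}"
  proof (intro subrelI)
    fix i j assume "(i, j) \<in> Poly_Mapping.keys (outer_mat n x)"
    then have "entry (outer_mat n x) i j \<noteq> 0" by (simp add: in_keys_iff)
    then show "(i, j) \<in> {..<n} \<times> {..<n}" by (simp add: entry_outer_mat split: if_splits)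
  qed
  then have "outer_mat n x \<in> sym_mats n" by (auto simp: sym_mats_def entry_outer_mat)
  moreover have "psd n (outer_mat n x)"
    unfolding psd_def
  proof
    fix v :: "nat \<Rightarrow> real"
    have "(\<Sum>i<n. \<Sum>j<n. v i * entry (outer_mat n x) i j * v j) = (\<Sum>i<n. v i * x i) * (\<Sum>j<n. v j * x j)"
      unfolding sum_product by (intro sum.cong) (auto simp: entry_outer_mat)
    then show "0 \<le> (\<Sum>i<n. \<Sum>j<n. v i * entry (outer_mat n x) i j * v j)" by simp
  qed
  moreover have "mat_trace n (outer_mat n x) = 1"
    using assms by (simp add: mat_trace_def entry_outer_mat power2_eq_square)
  ultimately show ?thesis by (simp add: density_mats_def)
qed

text \<open>
  Cholesky's algorithm: the last column, divided by the square root of the last diagonal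
  entry \<open>d\<close>, is split off. When \<open>d = 0\<close> the whole column vanishes, and since \<open>x / 0 = 0\<close>
  the same formulas remain correct.
\<close>

lemma psd_eq_sum_rank_one:
  fixes X :: "nat \<Rightarrow> nat \<Rightarrow> real"
  assumes "\<And>i j. X i j = X j i"
    and "\<And>u. 0 \<le> (\<Sum>i<n. \<Sum>j<n. u i * X i j * u j)"
  shows "\<exists>v. \<forall>i<n. \<forall>j<n. X i j = (\<Sum>k<n. v k i * v k j)"
  using assms
proof (induction n arbitrary: X)
  case 0
  then show ?case by simp
next
  case (Suc n)
  define d where "d = X n n"
  define Y where "Y i j = X i j - X i n * X j n / d" for i j
  have quad: "(\<Sum>i<Suc n. \<Sum>j<Suc n. u i * X i j * u j)
      = (\<Sum>i<n. \<Sum>j<n. u i * X i j * u j) + 2 * u n * (\<Sum>i<n. u i * X i n) + (u n)\<^sup>2 * d" for u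
  proof -
    have "(\<Sum>j<n. u n * X n j * u j) = u n * (\<Sum>i<n. u i * X i n)"
      using Suc.prems(1)[of n] by (simp add: sum_distrib_left mult_ac)
    moreover have "(\<Sum>i<n. u i * X i n * u n) = u n * (\<Sum>i<n. u i * X i n)"
      by (simp add: sum_distrib_left mult_ac)
    ultimately show ?thesis by (simp add: sum.distrib d_def power2_eq_square algebra_simps)
  qed
  have d0: "0 \<le> d"
  proof -
    have "(\<Sum>i<n. \<Sum>j<n. (if i = n then 1 else 0) * X i j * (if j = n then 1 else 0)) = 0"
      by (intro sum.neutral ballI) auto
    moreover have "(\<Sum>i<n. (if i = n then 1 else 0) * X i n) = 0"
      by (intro sum.neutral ballI) auto
    ultimately show ?thesis
      using Suc.prems(2)[of "\<lambda>i. if i = n then 1 else 0"] unfolding quad by simp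
  qed
  have column: "X i n = 0" if "d = 0" "i < n" for i
  proof (rule ccontr)
    assume nz: "X i n \<noteq> 0"
    define t where "t = - (X i i + 1) / (2 * X i n)"
    define u where "u k = (if k = i then 1 else if k = n then t else 0)" for k :: nat
    have "(\<Sum>k<n. \<Sum>j<n. u k * X k j * u j) = (\<Sum>k<n. \<Sum>j<n. if j = i then if k = i then X k j else 0 else 0)"
      by (intro sum.cong refl) (auto simp: u_def)
    then have 1: "(\<Sum>k<n. \<Sum>j<n. u k * X k j * u j) = X i i" using that by simp
    have "(\<Sum>k<n. u k * X k n) = (\<Sum>k<n. if k = i then X k n else 0)"
      using that by (intro sum.cong) (auto simp: u_def)
    then have 2: "(\<Sum>k<n. u k * X k n) = X i n" using that by simp
    have "0 \<le> X i i + 2 * t * X i n"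
      using Suc.prems(2)[of u] that unfolding quad 1 2 by (simp add: u_def)
    moreover have "2 * t * X i n = - (X i i + 1)" using nz by (simp add: t_def)
    ultimately show False by simp
  qed
  have "0 \<le> (\<Sum>i<n. \<Sum>j<n. u i * Y i j * u j)" for u
  proof -
    define s where "s = (\<Sum>i<n. u i * X i n)"
    define u' where "u' = u(n := - s / d)"
    have ij: "(\<Sum>i<n. \<Sum>j<n. u' i * X i j * u' j) = (\<Sum>i<n. \<Sum>j<n. u i * X i j * u j)"
      "(\<Sum>i<n. u' i * X i n) = s"
      unfolding s_def by (auto simp: u'_def intro!: sum.cong)
    have "0 \<le> (\<Sum>i<n. \<Sum>j<n. u i * X i j * u j) + 2 * u' n * s + (u' n)\<^sup>2 * d"
      using Suc.prems(2)[of u'] unfolding quad ij .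
    also have "2 * u' n * s + (u' n)\<^sup>2 * d = - (s * s / d)"
      by (cases "d = 0") (auto simp: u'_def power2_eq_square field_simps)
    then have "(\<Sum>i<n. \<Sum>j<n. u i * X i j * u j) + 2 * u' n * s + (u' n)\<^sup>2 * d
        = (\<Sum>i<n. \<Sum>j<n. u i * X i j * u j) - s * s / d" by simp
    also have "s * s / d = (\<Sum>i<n. \<Sum>j<n. u i * (X i n * X j n / d) * u j)"
      unfolding s_def sum_product by (simp add: sum_divide_distrib mult_ac)
    finally show ?thesis
      by (simp add: Y_def right_diff_distrib left_diff_distrib sum_subtractf)
  qed
  moreover have "Y i j = Y j i" for i j using Suc.prems(1)[of i j] by (simp add: Y_def mult.commute)
  ultimately obtain v where v: "\<forall>i<n. \<forall>j<n. Y i j = (\<Sum>k<n. v k i * v k j)"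
    using Suc.IH[of Y] by blast
  define w where "w k i = (if k = n then X i n / sqrt d else if i = n then 0 else v k i)" for k i
  have "X i j = (\<Sum>k<Suc n. w k i * w k j)" if "i < Suc n" "j < Suc n" for i j
  proof -
    have n: "w n i * w n j = X i n * X j n / d" using d0 by (simp add: w_def)
    have "X i j - X i n * X j n / d = (\<Sum>k<n. w k i * w k j)"
    proof (cases "i < n \<and> j < n")
      case True
      then have "(\<Sum>k<n. w k i * w k j) = (\<Sum>k<n. v k i * v k j)" by (simp add: w_def)
      then show ?thesis using v True by (simp add: Y_def)
    next
      case False
      then have "(\<Sum>k<n. w k i * w k j) = 0" by (intro sum.neutral ballI) (use that in \<open>auto simp: w_def\<close>)
      moreover have "X i j = X i n * X j n / d"
      proof (cases "d = 0")
        case True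
        have "X k n = 0" if "k < Suc n" for k using column True that d_def by (cases "k = n") auto
        then show ?thesis using False that Suc.prems(1) by (metis less_SucE mult_zero_left div_0)
      next
        case d: False
        have "i = n \<or> j = n" using False that by auto
        then show ?thesis using d Suc.prems(1)[of n j] by (auto simp: d_def)
      qed
      ultimately show ?thesis by simp
    qed
    then show ?thesis using n by simp
  qed
  then show ?case by blast
qed

text \<open>
  A function that is affine in each variable separately does not decrease when one coordinate
  after the other is moved to the better of the two neighbouring integers.
\<close>

lemma multiaffine_integer_rounding:
  fixes q :: "('a \<Rightarrow> real) \<Rightarrow> real"
  assumes "finite A" and "\<And>x i. i \<in> A \<Longrightarrow> \<exists>a b. \<forall>t. q (x(i := t)) = a + t * b"
  shows "\<exists>w. (\<forall>i\<in>A. w i \<in> \<int> \<and> \<bar>w i - x i\<bar> \<le> 1) \<and> (\<forall>i. i \<notin> A \<longrightarrow> w i = x i) \<and> q x \<le> q w"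
  using assms
proof (induction A rule: finite_induct)
  case empty
  then show ?case by blast
next
  case (insert i A)
  then obtain w where w: "\<forall>i\<in>A. w i \<in> \<int> \<and> \<bar>w i - x i\<bar> \<le> 1" "\<forall>i. i \<notin> A \<longrightarrow> w i = x i" "q x \<le> q w"
    by blast
  obtain a b where ab: "\<And>t. q (w(i := t)) = a + t * b" using insert.prems[of i w] by blast
  have "q w = a + w i * b" using ab[of "w i"] by simp
  define t where "t = (if 0 \<le> b then of_int \<lfloor>w i\<rfloor> + 1 else of_int \<lfloor>w i\<rfloor> :: real)"
  have t: "t \<in> \<int>" "\<bar>t - w i\<bar> \<le> 1" by (auto simp: t_def) linarith+
  have "w i * b \<le> t * b"
  proof (cases "0 \<le> b")
    case True
    then show ?thesis unfolding t_def using floor_correct[of "w i"] by (auto intro!: mult_right_mono)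
  next
    case False
    then show ?thesis unfolding t_def using floor_correct[of "w i"] by (auto intro!: mult_right_mono_neg)
  qed
  then have "q w \<le> q (w(i := t))" using ab \<open>q w = a + w i * b\<close> by simp
  then have "q x \<le> q (w(i := t))" using w(3) by (rule order_trans[rotated])
  moreover have "\<forall>j\<in>insert i A. (w(i := t)) j \<in> \<int> \<and> \<bar>(w(i := t)) j - x j\<bar> \<le> 1"
    using w(1,2) t insert.hyps(2) by auto
  moreover have "\<forall>j. j \<notin> insert i A \<longrightarrow> (w(i := t)) j = x j" using w(2) by auto
  ultimately show ?case by blast
qed

definition offdiag :: "nat \<Rightarrow> (nat \<times> nat) set" where
  "offdiag n = {(i, j). i < j \<and> j < n}"

definition offdiag_form :: "nat \<Rightarrow> (nat \<times> nat \<Rightarrow> real) \<Rightarrow> (nat \<Rightarrow> real) \<Rightarrow> real" where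
  "offdiag_form n \<omega> x = (\<Sum>(i, j)\<in>offdiag n. \<omega> (i, j) * (x i * x j))"

lemma finite_offdiag: "finite (offdiag n)"
  by (rule finite_subset[of _ "{..<n} \<times> {..<n}"]) (auto simp: offdiag_def)

lemma sum_sym_index:
  "(\<Sum>p\<in>sym_index n. f p) = (\<Sum>i<n. f (i, i)) + (\<Sum>p\<in>offdiag n. f p)"
proof -
  have "sym_index n = (\<lambda>i. (i, i)) ` {..<n} \<union> offdiag n"
    by (auto simp: sym_index_def offdiag_def image_iff)
  moreover have "(\<lambda>i. (i, i)) ` {..<n} \<inter> offdiag n = {}" by (auto simp: offdiag_def)
  moreover have "(\<Sum>p\<in>(\<lambda>i. (i, i)) ` {..<n}. f p) = (\<Sum>i<n. f (i, i))"
    by (subst sum.reindex) (auto simp: inj_on_def)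
  ultimately show ?thesis by (simp add: sum.union_disjoint finite_offdiag)
qed

lemma trace_inner_gaussian_mat_entries:
  assumes "X \<in> sym_mats n"
  shows "trace_inner n (gaussian_mat n \<omega>) X
    = (\<Sum>i<n. \<omega> (i, i) * entry X i i) + sqrt 2 * (\<Sum>(i, j)\<in>offdiag n. \<omega> (i, j) * entry X i j)"
proof -
  have "(\<Sum>i<n. \<omega> (i, i) * trace_inner n (sym_basis (i, i)) X) = (\<Sum>i<n. \<omega> (i, i) * entry X i i)"
    using trace_inner_sym_basis[OF _ assms] by (intro sum.cong) (auto simp: sym_index_def)
  moreover have "(\<Sum>p\<in>offdiag n. \<omega> p * trace_inner n (sym_basis p) X)
      = sqrt 2 * (\<Sum>(i, j)\<in>offdiag n. \<omega> (i, j) * entry X i j)"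
    unfolding sum_distrib_left
  proof (intro sum.cong refl)
    fix p assume "p \<in> offdiag n"
    then obtain i j where p: "p = (i, j)" "i < j" "j < n" by (auto simp: offdiag_def)
    then have "trace_inner n (sym_basis (i, j)) X = sqrt 2 * entry X i j"
      using trace_inner_sym_basis[of i j n X] assms by (auto simp: sym_index_def)
    then show "\<omega> p * trace_inner n (sym_basis p) X = sqrt 2 * (case p of (i, j) \<Rightarrow> \<omega> (i, j) * entry X i j)"
      by (simp add: p(1))
  qed
  ultimately show ?thesis unfolding trace_inner_gaussian_mat sum_sym_index by simp
qed

text \<open>
  The integer points of norm at most \<open>2 sqrt n\<close>, the largest norm that rounding the coordinates
  of a vector of norm \<open>sqrt n\<close> can produce.
\<close>

definition lattice_ball :: "nat \<Rightarrow> (nat \<Rightarrow> int) set" where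
  "lattice_ball n = {w \<in> {..<n} \<rightarrow>\<^sub>E {- int (4 * n)..int (4 * n)}. (\<Sum>i<n. (w i)\<^sup>2) \<le> int (4 * n)}"

lemma finite_lattice_ball: "finite (lattice_ball n)"
  by (rule finite_subset[of _ "{..<n} \<rightarrow>\<^sub>E {- int (4 * n)..int (4 * n)}"])
     (auto simp: lattice_ball_def intro: finite_PiE)

text \<open>
  Every point \<open>w\<close> of the ball has \<open>\<Sum> \<bar>w i\<bar> \<le> 4 n\<close>, so its weight in the expansion of
  \<open>(\<Sum>a. 2 ^ (- \<bar>a\<bar>)) ^ n \<le> 3 ^ n\<close> is at least \<open>16 ^ (- n)\<close>.
\<close>

lemma card_lattice_ball_le: "real (card (lattice_ball n)) \<le> exp (5 * real n)"
proof -
  have geometric: "(\<Sum>a\<in>{- int N..int N}. (1 / 2 :: real) ^ nat \<bar>a\<bar>) \<le> 3" for N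
  proof -
    have "(\<Sum>a\<in>{- int N..int N}. (1 / 2 :: real) ^ nat \<bar>a\<bar>) = 3 - 2 * (1 / 2) ^ N"
    proof (induction N)
      case (Suc N)
      have "{- int (Suc N)..int (Suc N)} = insert (- int (Suc N)) (insert (int (Suc N)) {- int N..int N})"
        by auto
      then show ?case using Suc by (simp add: nat_add_distrib)
    qed simp
    then show ?thesis by simp
  qed
  let ?box = "{..<n} \<rightarrow>\<^sub>E {- int (4 * n)..int (4 * n)}"
  have "real (card (lattice_ball n)) * (1 / 2) ^ (4 * n) = (\<Sum>w\<in>lattice_ball n. (1 / 2) ^ (4 * n))"
    by simp
  also have "\<dots> \<le> (\<Sum>w\<in>lattice_ball n. \<Prod>i<n. (1 / 2) ^ nat \<bar>w i\<bar>)"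
  proof (rule sum_mono)
    fix w assume w: "w \<in> lattice_ball n"
    have "\<bar>a\<bar> \<le> a\<^sup>2" for a :: int
      using self_le_power[of "\<bar>a\<bar>" 2] by (cases "a = 0") auto
    then have "(\<Sum>i<n. \<bar>w i\<bar>) \<le> (\<Sum>i<n. (w i)\<^sup>2)" by (intro sum_mono)
    also have "\<dots> \<le> int (4 * n)" using w by (simp add: lattice_ball_def)
    finally have "(\<Sum>i<n. nat \<bar>w i\<bar>) \<le> 4 * n"
      by (simp add: nat_le_iff flip: of_nat_sum) (metis (no_types, lifting) int_nat_eq of_nat_le_iff of_nat_sum sum.cong abs_ge_zero nat_0_le of_nat_mult of_nat_numeral)
    then have "(1 / 2 :: real) ^ (4 * n) \<le> (1 / 2) ^ (\<Sum>i<n. nat \<bar>w i\<bar>)"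
      by (intro power_decreasing) auto
    then show "(1 / 2 :: real) ^ (4 * n) \<le> (\<Prod>i<n. (1 / 2) ^ nat \<bar>w i\<bar>)" by (simp add: power_sum)
  qed
  also have "\<dots> \<le> (\<Sum>w\<in>?box. \<Prod>i<n. (1 / 2) ^ nat \<bar>w i\<bar>)"
  proof (rule sum_mono2)
    show "finite ?box" by (intro finite_PiE) auto
    show "lattice_ball n \<subseteq> ?box" by (auto simp: lattice_ball_def)
  qed (intro prod_nonneg, simp)
  also have "\<dots> = (\<Prod>i<n. \<Sum>a\<in>{- int (4 * n)..int (4 * n)}. (1 / 2) ^ nat \<bar>a\<bar>)"
    by (rule prod_sum_PiE[symmetric]) auto
  also have "\<dots> \<le> (\<Prod>i<n. 3)"
    by (intro prod_mono conjI sum_nonneg geometric) simp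
  finally have "real (card (lattice_ball n)) * (1 / 2) ^ (4 * n) \<le> 3 ^ n" by simp
  then have "real (card (lattice_ball n)) \<le> 3 ^ n * 2 ^ (4 * n)"
    by (simp add: power_one_over field_simps)
  also have "\<dots> = (3 * 2 ^ 4) ^ n" by (simp only: power_mult_distrib power_mult)
  also have "\<dots> \<le> exp 5 ^ n"
  proof (rule power_mono)
    have "(5 / 2 :: real) \<le> exp 1" using exp_lower_Taylor_quadratic[of 1] by simp
    then have "(5 / 2 :: real) ^ 5 \<le> exp 1 ^ 5" by (rule power_mono) simp
    moreover have "(3 * 2 ^ 4 :: real) \<le> (5 / 2) ^ 5" by (simp add: power_divide)
    ultimately show "(3 * 2 ^ 4 :: real) \<le> exp 5" by (simp flip: exp_of_nat_mult)
  qed simp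
  also have "exp 5 ^ n = exp (5 * real n)" by (simp add: exp_of_nat2_mult)
  finally show ?thesis .
qed

lemma offdiag_form_scale: "offdiag_form n \<omega> (\<lambda>i. c * x i) = c\<^sup>2 * offdiag_form n \<omega> x"
  by (simp add: offdiag_form_def sum_distrib_left power2_eq_square split_def mult_ac)

lemma offdiag_form_multiaffine: "\<exists>a b. \<forall>t. offdiag_form n \<omega> (x(i := t)) = a + t * b"
proof -
  define \<alpha> \<beta> where "\<alpha> p = (if fst p = i \<or> snd p = i then 0 else \<omega> p * (x (fst p) * x (snd p)))"
    and "\<beta> p = (if fst p = i then \<omega> p * x (snd p) else if snd p = i then \<omega> p * x (fst p) else 0)" for p
  have "offdiag_form n \<omega> (x(i := t)) = (\<Sum>p\<in>offdiag n. \<alpha> p + t * \<beta> p)" for t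
    unfolding offdiag_form_def by (intro sum.cong) (auto simp: \<alpha>_def \<beta>_def offdiag_def)
  then show ?thesis
    by (intro exI[of _ "sum \<alpha> (offdiag n)"] exI[of _ "sum \<beta> (offdiag n)"])
       (simp add: sum.distrib sum_distrib_left)
qed

text \<open>
  Scaled to norm \<open>sqrt n\<close>, a vector is at distance at most \<open>sqrt n\<close> from an integer point obtained
  by rounding its coordinates, and the rounding can be done without decreasing the form, which
  has no diagonal terms and so is affine in each coordinate.
\<close>

lemma offdiag_form_le_lattice:
  assumes R: "\<And>w. w \<in> lattice_ball n \<Longrightarrow> offdiag_form n \<omega> (\<lambda>i. of_int (w i)) \<le> R" and n: "0 < n"
  shows "offdiag_form n \<omega> v \<le> (\<Sum>i<n. (v i)\<^sup>2) * (R / real n)"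
proof (cases "(\<Sum>i<n. (v i)\<^sup>2) = 0")
  case True
  then have "v i = 0" if "i < n" for i using that by (subst (asm) sum_nonneg_eq_0_iff) auto
  then have "offdiag_form n \<omega> v = 0"
    unfolding offdiag_form_def by (intro sum.neutral) (auto simp: offdiag_def)
  then show ?thesis using True by simp
next
  case False
  define N where "N = (\<Sum>i<n. (v i)\<^sup>2)"
  have N: "0 < N" using False sum_nonneg[of "{..<n}" "\<lambda>i. (v i)\<^sup>2"] by (simp add: N_def less_le)
  define c where "c = sqrt (real n / N)"
  have c2: "c\<^sup>2 = real n / N" using N by (simp add: c_def)
  define x where "x i = c * v i" for i
  have "(\<Sum>i<n. (x i)\<^sup>2) = c\<^sup>2 * N"
    by (simp add: x_def power_mult_distrib N_def sum_distrib_left)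
  then have x2: "(\<Sum>i<n. (x i)\<^sup>2) = real n" using N by (simp add: c2)
  obtain z where z: "\<forall>i\<in>{..<n}. z i \<in> \<int> \<and> \<bar>z i - x i\<bar> \<le> 1" "offdiag_form n \<omega> x \<le> offdiag_form n \<omega> z"
    using multiaffine_integer_rounding[of "{..<n}" "offdiag_form n \<omega>" x] offdiag_form_multiaffine by blast
  define w where "w = restrict (\<lambda>i. \<lfloor>z i\<rfloor>) {..<n}"
  have wz: "of_int (w i) = z i" if "i < n" for i using z(1) that by (simp add: w_def)
  have "(z i)\<^sup>2 \<le> 2 * (x i)\<^sup>2 + 2" if "i < n" for i
  proof -
    have "(z i - x i)\<^sup>2 \<le> 1" using z(1) that by (simp add: abs_square_le_1)
    moreover have "0 \<le> (z i - 2 * x i)\<^sup>2" by simp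
    ultimately show ?thesis by (simp add: power2_eq_square algebra_simps)
  qed
  then have "(\<Sum>i<n. (z i)\<^sup>2) \<le> (\<Sum>i<n. 2 * (x i)\<^sup>2 + 2)" by (intro sum_mono) auto
  also have "\<dots> = 4 * real n" by (simp add: sum.distrib x2 flip: sum_distrib_left)
  finally have "(\<Sum>i<n. (of_int (w i) :: real)\<^sup>2) \<le> 4 * real n" using wz by simp
  then have "real_of_int (\<Sum>i<n. (w i)\<^sup>2) \<le> real_of_int (int (4 * n))" by simp
  then have w2: "(\<Sum>i<n. (w i)\<^sup>2) \<le> int (4 * n)" by (simp only: of_int_le_iff)
  have "\<bar>w i\<bar> \<le> int (4 * n)" if "i < n" for i
  proof -
    have "\<bar>w i\<bar> \<le> (w i)\<^sup>2" using self_le_power[of "\<bar>w i\<bar>" 2] by (cases "w i = 0") auto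
    also have "\<dots> \<le> (\<Sum>i<n. (w i)\<^sup>2)" using that by (intro member_le_sum) auto
    finally show ?thesis using w2 by simp
  qed
  then have "w i \<in> {- int (4 * n)..int (4 * n)}" if "i < n" for i using that by (simp add: abs_le_iff minus_le_iff)
  then have "w \<in> lattice_ball n" using w2 by (auto simp: lattice_ball_def w_def)
  then have "offdiag_form n \<omega> (\<lambda>i. of_int (w i)) \<le> R" by (rule R)
  moreover have "offdiag_form n \<omega> (\<lambda>i. of_int (w i)) = offdiag_form n \<omega> z"
    unfolding offdiag_form_def using wz by (intro sum.cong) (auto simp: offdiag_def)
  moreover have "offdiag_form n \<omega> x = c\<^sup>2 * offdiag_form n \<omega> v"
    unfolding x_def by (rule offdiag_form_scale)
  ultimately have "real n / N * offdiag_form n \<omega> v \<le> R" using z(2) by (simp add: c2)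
  then show ?thesis using N n by (simp add: N_def[symmetric] field_simps)
qed

text \<open>
  The diagonal part of \<open>\<langle>G, X\<rangle>\<close> is bounded through \<open>2 a \<le> sqrt n + a\<^sup>2 / sqrt n\<close>, and the rest
  through a decomposition of \<open>X\<close> into matrices of rank one with traces summing to \<open>1\<close>.
\<close>

lemma trace_inner_density_le:
  assumes R: "\<And>w. w \<in> lattice_ball n \<Longrightarrow> offdiag_form n \<omega> (\<lambda>i. of_int (w i)) \<le> R" and n: "0 < n"
    and X: "X \<in> density_mats n"
  shows "trace_inner n (gaussian_mat n \<omega>) X
    \<le> sqrt (real n) / 2 + (\<Sum>i<n. (\<omega> (i, i))\<^sup>2) / (2 * sqrt (real n)) + sqrt 2 * (R / real n)"
proof -
  let ?s = "sqrt (real n)"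
  have sym: "X \<in> sym_mats n" and psd: "psd n X" and tr: "(\<Sum>i<n. entry X i i) = 1"
    using X by (auto simp: density_mats_def mat_trace_def)
  obtain v where v: "\<forall>i<n. \<forall>j<n. entry X i j = (\<Sum>k<n. v k i * v k j)"
    using psd_eq_sum_rank_one[of "entry X" n] sym psd unfolding psd_def sym_mats_def by blast
  have diag: "0 \<le> entry X i i" if "i < n" for i using v that by (auto intro!: sum_nonneg)
  have s: "0 < ?s" using n by simp
  have "(\<Sum>i<n. \<omega> (i, i) * entry X i i) \<le> (\<Sum>i<n. ?s / 2 * entry X i i + (\<omega> (i, i))\<^sup>2 / (2 * ?s))"
  proof (rule sum_mono)
    fix i assume i: "i \<in> {..<n}"
    let ?a = "\<omega> (i, i)"
    have "0 \<le> (?a - ?s)\<^sup>2 / (2 * ?s)" using s by simp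
    also have "(?a - ?s)\<^sup>2 / (2 * ?s) = ?a\<^sup>2 / (2 * ?s) - ?a + ?s / 2"
      using s by (simp add: power2_diff field_simps power2_eq_square)
    finally have a: "?a \<le> ?s / 2 + ?a\<^sup>2 / (2 * ?s)" by simp
    have "entry X i i \<le> (\<Sum>i<n. entry X i i)" using i diag by (intro member_le_sum) auto
    then have "entry X i i \<le> 1" using tr by simp
    then have "?a\<^sup>2 / (2 * ?s) * entry X i i \<le> ?a\<^sup>2 / (2 * ?s)"
      using s by (intro mult_left_le) auto
    moreover have "?a * entry X i i \<le> (?s / 2 + ?a\<^sup>2 / (2 * ?s)) * entry X i i"
      using a diag i by (intro mult_right_mono) auto
    ultimately show "?a * entry X i i \<le> ?s / 2 * entry X i i + ?a\<^sup>2 / (2 * ?s)"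
      by (simp add: distrib_right)
  qed
  also have "\<dots> = ?s / 2 + (\<Sum>i<n. (\<omega> (i, i))\<^sup>2) / (2 * ?s)"
    by (simp only: sum.distrib sum_distrib_left[symmetric] sum_divide_distrib[symmetric] tr mult_1_right)
  finally have 1: "(\<Sum>i<n. \<omega> (i, i) * entry X i i) \<le> ?s / 2 + (\<Sum>i<n. (\<omega> (i, i))\<^sup>2) / (2 * ?s)" .
  have "(\<Sum>(i, j)\<in>offdiag n. \<omega> (i, j) * entry X i j)
      = (\<Sum>p\<in>offdiag n. \<Sum>k<n. case p of (i, j) \<Rightarrow> \<omega> (i, j) * (v k i * v k j))"
    using v by (intro sum.cong) (auto simp: offdiag_def sum_distrib_left)
  also have "\<dots> = (\<Sum>k<n. offdiag_form n \<omega> (v k))"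
    unfolding offdiag_form_def by (rule sum.swap)
  also have "\<dots> \<le> (\<Sum>k<n. (\<Sum>i<n. (v k i)\<^sup>2) * (R / real n))"
    by (intro sum_mono offdiag_form_le_lattice R n)
  also have "\<dots> = (\<Sum>i<n. \<Sum>k<n. (v k i)\<^sup>2) * (R / real n)"
    unfolding sum_distrib_right[symmetric] by (subst sum.swap) simp
  also have "(\<Sum>i<n. \<Sum>k<n. (v k i)\<^sup>2) = (\<Sum>i<n. entry X i i)"
    using v by (intro sum.cong) (auto simp: power2_eq_square)
  finally have 2: "(\<Sum>(i, j)\<in>offdiag n. \<omega> (i, j) * entry X i j) \<le> R / real n" by (simp add: tr)
  have "sqrt 2 * (\<Sum>(i, j)\<in>offdiag n. \<omega> (i, j) * entry X i j) \<le> sqrt 2 * (R / real n)"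
    using 2 by (intro mult_left_mono) auto
  then show ?thesis using 1 unfolding trace_inner_gaussian_mat_entries[OF sym] by linarith
qed

lemma has_bochner_integral_exp_offdiag_form:
  "has_bochner_integral (gauss (sym_index n)) (\<lambda>\<omega>. exp (c * offdiag_form n \<omega> x))
    (exp ((\<Sum>(i, j)\<in>offdiag n. (c * (x i * x j))\<^sup>2) / 2))"
proof -
  define a where "a p = (if p \<in> offdiag n then c * (x (fst p) * x (snd p)) else 0)" for p
  have sub: "sym_index n \<inter> offdiag n = offdiag n" by (auto simp: sym_index_def offdiag_def)
  have "(\<Sum>p\<in>sym_index n. a p * \<omega> p) = c * offdiag_form n \<omega> x" for \<omega>
  proof -
    have "(\<Sum>p\<in>sym_index n. a p * \<omega> p) = (\<Sum>p\<in>sym_index n \<inter> offdiag n. a p * \<omega> p)"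
      by (subst sum.inter_restrict[OF finite_sym_index]) (auto simp: a_def intro!: sum.cong)
    then show ?thesis
      unfolding sub offdiag_form_def sum_distrib_left by (auto simp: a_def intro!: sum.cong)
  qed
  moreover have "(\<Sum>p\<in>sym_index n. (a p)\<^sup>2) = (\<Sum>(i, j)\<in>offdiag n. (c * (x i * x j))\<^sup>2)"
  proof -
    have "(\<Sum>p\<in>sym_index n. (a p)\<^sup>2) = (\<Sum>p\<in>sym_index n \<inter> offdiag n. (a p)\<^sup>2)"
      by (subst sum.inter_restrict[OF finite_sym_index]) (auto simp: a_def intro!: sum.cong)
    then show ?thesis unfolding sub by (auto simp: a_def intro!: sum.cong)
  qed
  ultimately show ?thesis
    using has_bochner_integral_gauss_exp_linear[OF finite_sym_index[of n], of a] by simp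
qed

text \<open>
  On the lattice ball the form divided by \<open>sqrt n\<close> is Gaussian with variance at most \<open>8 n\<close>, so the
  exponential moments of the at most \<open>exp (5 n)\<close> points add up to at most \<open>exp (9 n)\<close>. The
  inequality \<open>s \<le> ln K - 1 + exp s / K\<close> is used instead of Jensen's inequality for the logarithm.
\<close>

lemma gaussian_width_density_le:
  assumes n: "0 < n"
  shows "gaussian_width n (density_mats n) \<le> 14 * sqrt (real n)"
proof -
  let ?s = "sqrt (real n)" and ?I = "sym_index n"
  have s: "0 < ?s" "?s * ?s = real n" using n by auto
  define q where "q \<omega> w = offdiag_form n \<omega> (\<lambda>i. of_int (w i))" for \<omega> and w :: "nat \<Rightarrow> int"
  define Z where "Z \<omega> = (\<Sum>w\<in>lattice_ball n. exp (1 / ?s * q \<omega> w)) * exp (- (9 * real n))" for \<omega>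
  define R where "R \<omega> = ?s * (9 * real n - 1 + Z \<omega>)" for \<omega>
  define H where "H \<omega> = ?s / 2 + (\<Sum>i<n. (\<omega> (i, i))\<^sup>2) / (2 * ?s) + sqrt 2 * (R \<omega> / real n)"
    for \<omega> :: "nat \<times> nat \<Rightarrow> real"
  have R: "q \<omega> w \<le> R \<omega>" if w: "w \<in> lattice_ball n" for \<omega> w
  proof -
    have "exp (1 / ?s * q \<omega> w) \<le> (\<Sum>w\<in>lattice_ball n. exp (1 / ?s * q \<omega> w))"
      using w finite_lattice_ball by (intro member_le_sum) auto
    then have "exp (1 / ?s * q \<omega> w) * exp (- (9 * real n)) \<le> Z \<omega>"
      unfolding Z_def by (intro mult_right_mono) auto
    then have "exp (1 / ?s * q \<omega> w - 9 * real n) \<le> Z \<omega>"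
      by (simp only: exp_add[symmetric] add_uminus_conv_diff)
    moreover have "1 + (1 / ?s * q \<omega> w - 9 * real n) \<le> exp (1 / ?s * q \<omega> w - 9 * real n)"
      by (rule exp_ge_add_one_self)
    ultimately have "1 / ?s * q \<omega> w \<le> 9 * real n - 1 + Z \<omega>" by linarith
    then show ?thesis using s(1) by (simp add: R_def field_simps)
  qed
  have SUP: "(SUP X\<in>density_mats n. trace_inner n (gaussian_mat n \<omega>) X) \<le> H \<omega>" for \<omega>
  proof (rule cSUP_least)
    have "outer_mat n (\<lambda>i. if i = 0 then 1 else 0) \<in> density_mats n"
      using n by (intro outer_mat_density) (simp add: if_distrib[of power2] cong: if_cong)
    then show "density_mats n \<noteq> {}" by blast
    show "trace_inner n (gaussian_mat n \<omega>) X \<le> H \<omega>" if "X \<in> density_mats n" for X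
      unfolding H_def using R n that unfolding q_def by (intro trace_inner_density_le)
  qed
  define zv where "zv = (\<Sum>w\<in>lattice_ball n. exp ((\<Sum>(i, j)\<in>offdiag n. (1 / ?s * (of_int (w i) * of_int (w j)))\<^sup>2) / 2))
      * exp (- (9 * real n))"
  have Z: "has_bochner_integral (gauss ?I) Z zv"
    unfolding Z_def zv_def q_def
    by (intro has_bochner_integral_mult_left has_bochner_integral_sum has_bochner_integral_exp_offdiag_form)
  have "(\<Sum>(i, j)\<in>offdiag n. (1 / ?s * (of_int (w i) * of_int (w j)))\<^sup>2) / 2 \<le> 4 * real n"
    if w: "w \<in> lattice_ball n" for w
  proof -
    let ?w = "\<lambda>i. (of_int (w i) :: real)\<^sup>2"
    have w2: "(\<Sum>i<n. ?w i) \<le> 4 * real n"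
    proof -
      have "(\<Sum>i<n. (w i)\<^sup>2) \<le> int (4 * n)" using w by (simp add: lattice_ball_def)
      then have "real_of_int (\<Sum>i<n. (w i)\<^sup>2) \<le> real_of_int (int (4 * n))" by (simp only: of_int_le_iff)
      then show ?thesis by simp
    qed
    have "2 * (\<Sum>(i, j)\<in>offdiag n. ?w i * ?w j) = (\<Sum>(i, j)\<in>offdiag n. ?w i * ?w j) + (\<Sum>(j, i)\<in>offdiag n. ?w i * ?w j)"
      by (simp add: split_def mult.commute)
    also have "(\<Sum>(j, i)\<in>offdiag n. ?w i * ?w j) = (\<Sum>(i, j)\<in>prod.swap ` offdiag n. ?w i * ?w j)"
      by (subst sum.reindex) (auto simp: split_def)
    also have "(\<Sum>(i, j)\<in>offdiag n. ?w i * ?w j) + (\<Sum>(i, j)\<in>prod.swap ` offdiag n. ?w i * ?w j)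
        = (\<Sum>(i, j)\<in>offdiag n \<union> prod.swap ` offdiag n. ?w i * ?w j)"
      by (intro sum.union_disjoint[symmetric] finite_imageI finite_offdiag) (auto simp: offdiag_def)
    also have "\<dots> \<le> (\<Sum>(i, j)\<in>{..<n} \<times> {..<n}. ?w i * ?w j)"
      by (intro sum_mono2) (auto simp: offdiag_def)
    also have "\<dots> = (\<Sum>i<n. ?w i) * (\<Sum>j<n. ?w j)"
      by (simp add: sum_product sum.cartesian_product)
    also have "\<dots> \<le> (4 * real n) * (4 * real n)"
      using w2 by (intro mult_mono) (auto intro!: sum_nonneg)
    finally have 8: "(\<Sum>(i, j)\<in>offdiag n. ?w i * ?w j) \<le> 8 * (real n * real n)" by simp
    have "(\<Sum>(i, j)\<in>offdiag n. (1 / ?s * (of_int (w i) * of_int (w j)))\<^sup>2) = (\<Sum>(i, j)\<in>offdiag n. ?w i * ?w j) / real n"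
      by (simp add: sum_divide_distrib power_divide power_mult_distrib split_def)
    also have "\<dots> \<le> 8 * (real n * real n) / real n" using 8 by (intro divide_right_mono) auto
    finally show ?thesis using n by simp
  qed
  then have "(\<Sum>w\<in>lattice_ball n. exp ((\<Sum>(i, j)\<in>offdiag n. (1 / ?s * (of_int (w i) * of_int (w j)))\<^sup>2) / 2))
      \<le> (\<Sum>w\<in>lattice_ball n. exp (4 * real n))"
    by (intro sum_mono) auto
  also have "\<dots> \<le> exp (5 * real n) * exp (4 * real n)"
    using card_lattice_ball_le[of n] by (simp add: mult_right_mono)
  also have "\<dots> = exp (9 * real n)" by (simp flip: exp_add)
  finally have "zv \<le> exp (9 * real n) * exp (- (9 * real n))"
    unfolding zv_def by (intro mult_right_mono) auto
  then have zv: "zv \<le> 1" by (simp flip: exp_add)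
  define hv where "hv = ?s / 2 + (\<Sum>i<n. 1) / (2 * ?s) + sqrt 2 * (?s * (9 * real n - 1 + zv) / real n)"
  interpret prob_space "gauss ?I" by (intro prob_space_PiM prob_space_std_normal)
  have const: "has_bochner_integral (gauss ?I) (\<lambda>_. c) c" for c :: real
    using prob_space by (simp add: has_bochner_integral_iff)
  have diag: "has_bochner_integral (gauss ?I) (\<lambda>\<omega>. (\<omega> (i, i))\<^sup>2) 1" if "i \<in> {..<n}" for i
    using has_bochner_integral_gauss_coordinate[OF finite_sym_index _ std_normal_expectations(2)] that
    by (simp add: sym_index_def)
  have H: "has_bochner_integral (gauss ?I) H hv"
    unfolding H_def hv_def R_def
    by (intro has_bochner_integral_add has_bochner_integral_mult_right has_bochner_integral_divide_zero
        has_bochner_integral_sum has_bochner_integral_diff const Z diag)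
  have T0: "0 \<le> ?s * (9 * real n - 1 + zv) / real n"
  proof -
    have "0 \<le> zv" unfolding zv_def by (intro mult_nonneg_nonneg sum_nonneg) auto
    then show ?thesis using n s(1) by (intro divide_nonneg_nonneg mult_nonneg_nonneg) auto
  qed
  have "hv \<le> 14 * ?s"
  proof -
    have "?s * (9 * real n - 1 + zv) / real n \<le> ?s * (9 * real n) / real n"
      using zv s(1) by (intro divide_right_mono mult_left_mono) auto
    also have "\<dots> = 9 * ?s" using n by simp
    finally have "sqrt 2 * (?s * (9 * real n - 1 + zv) / real n) \<le> 13 / 9 * (9 * ?s)"
    proof (rule mult_mono[rotated])
      show "sqrt 2 \<le> 13 / 9" by (rule real_le_lsqrt) (auto simp: power2_eq_square)
    qed (use T0 in auto)
    moreover have "(\<Sum>i<n. 1 :: real) / (2 * ?s) = ?s / 2" using s by (simp add: field_simps)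
    ultimately show ?thesis unfolding hv_def by simp
  qed
  moreover have "gaussian_width n (density_mats n) \<le> hv"
  proof (cases "integrable (gauss ?I) (\<lambda>\<omega>. SUP X\<in>density_mats n. trace_inner n (gaussian_mat n \<omega>) X)")
    case True
    then have "gaussian_width n (density_mats n) \<le> (\<integral>\<omega>. H \<omega> \<partial>gauss ?I)"
      unfolding gaussian_width_def gaussian_coords_def using H SUP
      by (intro integral_mono) (auto simp: has_bochner_integral_iff)
    then show ?thesis using H by (simp add: has_bochner_integral_iff)
  next
    case False
    then have "gaussian_width n (density_mats n) = 0"
      unfolding gaussian_width_def gaussian_coords_def by (rule not_integrable_integral_eq)
    moreover have "0 \<le> hv"
      unfolding hv_def using T0 by (intro add_nonneg_nonneg mult_nonneg_nonneg[of "sqrt 2"]) auto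
    ultimately show ?thesis by simp
  qed
  ultimately show ?thesis by simp
qed


section \<open>Slacks of random sign matrices at the sign vectors\<close>

definition sign_point :: "nat \<Rightarrow> nat \<Rightarrow> (nat \<Rightarrow> real) \<Rightarrow> fin_mat" where
  "sign_point n N x = outer_mat n (\<lambda>i. if i < N then x i / sqrt (real N) else 0)"

lemma sum_restrict_lessThan:
  fixes f :: "nat \<Rightarrow> real"
  assumes "N \<le> n"
  shows "(\<Sum>i<n. if i < N then f i else 0) = (\<Sum>i<N. f i)"
proof -
  have "(\<Sum>i<n. if i < N then f i else 0) = (\<Sum>i<N. if i < N then f i else 0)"
    using assms by (intro sum.mono_neutral_right) auto
  then show ?thesis by simp
qed

lemma sign_point_density:
  assumes "x \<in> cube {..<N}" "0 < N" "N \<le> n"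
  shows "sign_point n N x \<in> density_mats n"
  unfolding sign_point_def
proof (rule outer_mat_density)
  have "(\<Sum>i<n. (if i < N then x i / sqrt (real N) else 0)\<^sup>2) = (\<Sum>i<n. if i < N then (x i)\<^sup>2 / real N else 0)"
    by (intro sum.cong) (auto simp: power_divide)
  also have "\<dots> = (\<Sum>i<N. 1 / real N)"
    unfolding sum_restrict_lessThan[OF assms(3)] using assms(1) by (intro sum.cong) (auto simp: cube_square)
  finally show "(\<Sum>i<n. (if i < N then x i / sqrt (real N) else 0)\<^sup>2) = 1" using assms(2) by simp
qed

lemma trace_inner_sign_point:
  assumes x: "x \<in> cube {..<N}" and N: "0 < N" "N \<le> n"
  shows "trace_inner n (gaussian_mat n \<tau>) (sign_point n N x)
    = ((\<Sum>i<N. \<tau> (i, i)) + sqrt 2 * offdiag_form N \<tau> x) / real N"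
proof -
  let ?X = "sign_point n N x"
  have X: "?X \<in> sym_mats n" using sign_point_density[OF assms] by (simp add: density_mats_def)
  have entry: "entry ?X i j = (if i < N \<and> j < N then x i * x j / real N else 0)" for i j
    unfolding sign_point_def entry_outer_mat using N by auto
  have "(\<Sum>i<n. \<tau> (i, i) * entry ?X i i) = (\<Sum>i<n. if i < N then \<tau> (i, i) * (x i * x i / real N) else 0)"
    by (intro sum.cong) (auto simp: entry)
  also have "\<dots> = (\<Sum>i<N. \<tau> (i, i) / real N)"
    unfolding sum_restrict_lessThan[OF N(2)]
    using x by (intro sum.cong) (auto simp: cube_square simp flip: power2_eq_square)
  finally have 1: "(\<Sum>i<n. \<tau> (i, i) * entry ?X i i) = (\<Sum>i<N. \<tau> (i, i)) / real N"
    by (simp add: sum_divide_distrib)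
  have "(\<Sum>(i, j)\<in>offdiag n. \<tau> (i, j) * entry ?X i j) = (\<Sum>(i, j)\<in>offdiag N. \<tau> (i, j) * entry ?X i j)"
    using N(2) finite_offdiag[of n] by (intro sum.mono_neutral_right) (auto simp: offdiag_def entry split: if_splits)
  also have "\<dots> = offdiag_form N \<tau> x / real N"
    unfolding offdiag_form_def sum_divide_distrib by (intro sum.cong) (auto simp: offdiag_def entry)
  finally show ?thesis
    unfolding trace_inner_gaussian_mat_entries[OF X] 1 by (simp add: add_divide_distrib)
qed

lemma mean_offdiag_form: "mean (cube {..<N}) (offdiag_form N \<tau>) = 0"
proof -
  have "mean (cube {..<N}) (offdiag_form N \<tau>)
      = (\<Sum>p\<in>offdiag N. mean (cube {..<N}) (\<lambda>x. \<tau> p * (x (fst p) * x (snd p))))"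
    unfolding offdiag_form_def mean_sum[symmetric] by (simp add: split_def)
  also have "\<dots> = 0"
  proof (intro sum.neutral ballI)
    fix p assume "p \<in> offdiag N"
    then have p: "fst p \<noteq> snd p" "fst p \<in> {..<N}" by (auto simp: offdiag_def)
    have "mean (cube {..<N}) (\<lambda>x. x (fst p) * x (snd p)) = 0"
      using p by (intro mean_cube_coordinate_mult) auto
    then show "mean (cube {..<N}) (\<lambda>x. \<tau> p * (x (fst p) * x (snd p))) = 0"
      unfolding mean_cmult by simp
  qed
  finally show ?thesis .
qed

lemma mean_offdiag_form_mult:
  assumes ij: "i < j" "j < N"
  shows "mean (cube {..<N}) (\<lambda>x. offdiag_form N \<tau> x * (x i * x j)) = \<tau> (i, j)"
proof -
  have "mean (cube {..<N}) (\<lambda>x. offdiag_form N \<tau> x * (x i * x j))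
      = (\<Sum>p\<in>offdiag N. mean (cube {..<N}) (\<lambda>x. \<tau> p * (x i * x j * (x (fst p) * x (snd p)))))"
    unfolding offdiag_form_def mean_sum[symmetric] sum_distrib_right
    by (intro mean_cong sum.cong) (auto simp: mult_ac)
  also have "\<dots> = (\<Sum>p\<in>offdiag N. if p = (i, j) then \<tau> p else 0)"
  proof (intro sum.cong refl)
    fix p assume "p \<in> offdiag N"
    then obtain a b where p: "p = (a, b)" "a < b" "b < N" by (auto simp: offdiag_def)
    have "mean (cube {..<N}) (\<lambda>x. x i * x j * (x a * x b)) = (if (a, b) = (i, j) then 1 else 0)"
    proof (cases "i = a \<or> i = b")
      case False
      have "mean (cube {..<N}) (\<lambda>x. x i * (x j * (x a * x b))) = 0"
        using False ij by (intro mean_cube_coordinate_mult) auto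
      then show ?thesis using False by (auto simp: mult_ac)
    next
      case i: True
      show ?thesis
      proof (cases "j = a \<or> j = b")
        case False
        have "mean (cube {..<N}) (\<lambda>x. x j * (x i * (x a * x b))) = 0"
          using False ij by (intro mean_cube_coordinate_mult) auto
        then show ?thesis using False by (auto simp: mult_ac)
      next
        case True
        then have ab: "a = i" "b = j" using i ij p by auto
        have "mean (cube {..<N}) (\<lambda>x. x i * x j * (x i * x j)) = mean (cube {..<N}) (\<lambda>x. 1)"
        proof (rule mean_cong)
          fix x assume x: "x \<in> cube {..<N}"
          have "x i * x j * (x i * x j) = (x i)\<^sup>2 * (x j)\<^sup>2" by (simp add: power2_eq_square)
          then show "x i * x j * (x i * x j) = 1" using x ij by (simp add: cube_square)
        qed
        then show ?thesis unfolding ab by (simp add: mean_const finite_cube cube_not_empty)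
      qed
    qed
    then show "mean (cube {..<N}) (\<lambda>x. \<tau> p * (x i * x j * (x (fst p) * x (snd p)))) = (if p = (i, j) then \<tau> p else 0)"
      unfolding mean_cmult by (simp add: p(1))
  qed
  also have "\<dots> = \<tau> (i, j)"
    using ij finite_offdiag[of N] by (simp add: offdiag_def)
  finally show ?thesis .
qed

text \<open>
  Orthogonality of the characters of the cube picks out of a factorised slack its mean and its
  coefficients at \<open>x i * x j\<close>. The latter are multiples of the signs \<open>\<tau> (i, j)\<close>, so pairing them
  with these signs produces the number of pairs, whatever \<open>\<tau>\<close> is.
\<close>

lemma slack_mean_and_pairing:
  assumes m: "0 < m" "2 * m \<le> n" and \<tau>: "\<tau> \<in> cube (sym_index n)"
    and slack: "\<And>x. x \<in> cube {..<2 * m} \<Longrightarrow>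
      h - ((\<Sum>i<2 * m. \<tau> (i, i)) + sqrt 2 * offdiag_form (2 * m) \<tau> x) / real (2 * m)
        = l0 + (\<Sum>F\<in>\<F>. l F * u F x)"
  shows "h - (\<Sum>i<2 * m. \<tau> (i, i)) / real (2 * m) = l0 + (\<Sum>F\<in>\<F>. l F * mean (cube {..<2 * m}) (u F))"
    and "real m / sqrt 2 = (\<Sum>F\<in>\<F>. l F * - (\<Sum>i<m. \<Sum>j=m..<2 * m.
      \<tau> (i, j) * mean (cube {..<2 * m}) (\<lambda>x. u F x * (x i * x j))))"
proof -
  let ?K = "cube {..<2 * m}" and ?N = "real (2 * m)" and ?T = "\<Sum>i<2 * m. \<tau> (i, i)"
  let ?q = "offdiag_form (2 * m) \<tau>"
  have K: "finite ?K" "?K \<noteq> {}" by (simp_all add: finite_cube cube_not_empty)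
  have s: "h - ?T / ?N - sqrt 2 / ?N * ?q x = l0 + (\<Sum>F\<in>\<F>. l F * u F x)" if "x \<in> ?K" for x
    using slack[OF that] by (simp add: add_divide_distrib)
  have "mean ?K (\<lambda>x. h - ?T / ?N - sqrt 2 / ?N * ?q x) = mean ?K (\<lambda>x. l0 + (\<Sum>F\<in>\<F>. l F * u F x))"
    by (rule mean_cong[OF s])
  then show "h - ?T / ?N = l0 + (\<Sum>F\<in>\<F>. l F * mean ?K (u F))"
    unfolding mean_diff mean_add mean_cmult mean_sum mean_const[OF K] mean_offdiag_form by simp
  have coeff: "- (sqrt 2 / ?N * \<tau> (i, j)) = (\<Sum>F\<in>\<F>. l F * mean ?K (\<lambda>x. u F x * (x i * x j)))"
    if ij: "i < m" "m \<le> j" "j < 2 * m" for i j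
  proof -
    have zero: "mean ?K (\<lambda>x. x i * x j) = 0"
      using ij by (intro mean_cube_coordinate_mult) auto
    have "mean ?K (\<lambda>x. (h - ?T / ?N) * (x i * x j) - sqrt 2 / ?N * (?q x * (x i * x j)))
        = mean ?K (\<lambda>x. l0 * (x i * x j) + (\<Sum>F\<in>\<F>. l F * (u F x * (x i * x j))))"
    proof (rule mean_cong)
      fix x assume "x \<in> ?K"
      from arg_cong[OF s[OF this], of "\<lambda>t. t * (x i * x j)"]
      show "(h - ?T / ?N) * (x i * x j) - sqrt 2 / ?N * (?q x * (x i * x j))
          = l0 * (x i * x j) + (\<Sum>F\<in>\<F>. l F * (u F x * (x i * x j)))"
        by (simp only: left_diff_distrib distrib_right sum_distrib_right mult.assoc)
    qed
    then show ?thesis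
      unfolding mean_diff mean_add mean_cmult mean_sum zero
      using mean_offdiag_form_mult[of i j "2 * m" \<tau>] ij by simp
  qed
  have "(\<Sum>F\<in>\<F>. l F * - (\<Sum>i<m. \<Sum>j=m..<2 * m. \<tau> (i, j) * mean ?K (\<lambda>x. u F x * (x i * x j))))
      = - (\<Sum>F\<in>\<F>. \<Sum>i<m. \<Sum>j=m..<2 * m. \<tau> (i, j) * (l F * mean ?K (\<lambda>x. u F x * (x i * x j))))"
    by (simp add: sum_distrib_left sum_negf mult_ac)
  also have "(\<Sum>F\<in>\<F>. \<Sum>i<m. \<Sum>j=m..<2 * m. \<tau> (i, j) * (l F * mean ?K (\<lambda>x. u F x * (x i * x j))))
      = (\<Sum>i<m. \<Sum>j=m..<2 * m. \<Sum>F\<in>\<F>. \<tau> (i, j) * (l F * mean ?K (\<lambda>x. u F x * (x i * x j))))"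
    by (subst sum.swap, intro sum.cong refl sum.swap)
  also have "\<dots> = (\<Sum>i<m. \<Sum>j=m..<2 * m. - (sqrt 2 / ?N))"
  proof (intro sum.cong refl)
    fix i j assume ij: "i \<in> {..<m}" "j \<in> {m..<2 * m}"
    have "(\<Sum>F\<in>\<F>. \<tau> (i, j) * (l F * mean ?K (\<lambda>x. u F x * (x i * x j)))) = \<tau> (i, j) * - (sqrt 2 / ?N * \<tau> (i, j))"
      using coeff[of i j] ij by (simp flip: sum_distrib_left)
    also have "\<dots> = - (sqrt 2 / ?N) * (\<tau> (i, j))\<^sup>2" by (simp add: power2_eq_square)
    also have "(\<tau> (i, j))\<^sup>2 = 1"
      using \<tau> ij m(2) by (intro cube_square) (auto simp: sym_index_def)
    finally show "(\<Sum>F\<in>\<F>. \<tau> (i, j) * (l F * mean ?K (\<lambda>x. u F x * (x i * x j)))) = - (sqrt 2 / ?N)" by simp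
  qed
  also have "- \<dots> = real m / sqrt 2"
    using m(1) by (simp add: real_div_sqrt field_simps)
  finally show "real m / sqrt 2 = (\<Sum>F\<in>\<F>. l F * - (\<Sum>i<m. \<Sum>j=m..<2 * m.
      \<tau> (i, j) * mean (cube {..<2 * m}) (\<lambda>x. u F x * (x i * x j))))" by simp
qed

text \<open>
  The maximum of \<open>exp \<Lambda>\<close> linear forms in random signs, each of variance at most \<open>R\<^sup>2\<close>, has
  expectation at most of order \<open>R * sqrt \<Lambda>\<close>. The bound \<open>B\<close> replaces the maximum by a sum of
  exponentials, with \<open>\<theta> = sqrt (2 \<Lambda>) / R\<close> as the optimal parameter.
\<close>

lemma max_linear_signs_bound:
  fixes c :: "'f \<Rightarrow> 'i \<Rightarrow> real"
  assumes I: "finite I" and G: "finite \<G>" "real (card \<G>) \<le> exp \<Lambda>" and L: "1 \<le> \<Lambda>" and R: "0 < R"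
    and c: "\<And>F. F \<in> \<G> \<Longrightarrow> (\<Sum>p\<in>I. (c F p)\<^sup>2) \<le> R\<^sup>2"
  obtains B where "\<And>\<tau>. 0 \<le> B \<tau>" "\<And>\<tau> F. F \<in> \<G> \<Longrightarrow> (\<Sum>p\<in>I. \<tau> p * c F p) \<le> B \<tau>"
    "mean (cube I) B \<le> R * (sqrt (2 * \<Lambda>) + 1)"
proof -
  define \<theta> where "\<theta> = sqrt (2 * \<Lambda>) / R"
  define b where "b = R * sqrt (2 * \<Lambda>)"
  have \<theta>: "0 < \<theta>" using R L by (simp add: \<theta>_def)
  have \<theta>b: "\<theta> * b = 2 * \<Lambda>" using R L by (simp add: \<theta>_def b_def)
  have \<theta>R: "\<theta>\<^sup>2 * R\<^sup>2 = 2 * \<Lambda>" using R L by (simp add: \<theta>_def power_divide)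
  let ?S = "\<lambda>F \<tau>. \<Sum>p\<in>I. \<tau> p * c F p"
  define B where "B \<tau> = b + 1 / \<theta> * (\<Sum>F\<in>\<G>. exp (- (\<theta> * b)) * exp (\<Sum>p\<in>I. \<tau> p * (\<theta> * c F p)))" for \<tau>
  show ?thesis
  proof (rule that[of B])
    show "0 \<le> B \<tau>" for \<tau>
      unfolding B_def using \<theta> R L by (intro add_nonneg_nonneg mult_nonneg_nonneg sum_nonneg) (auto simp: b_def)
    show "?S F \<tau> \<le> B \<tau>" if F: "F \<in> \<G>" for \<tau> F
    proof -
      have "1 + (\<theta> * ?S F \<tau> - \<theta> * b) \<le> exp (\<theta> * ?S F \<tau> - \<theta> * b)" by (rule exp_ge_add_one_self)
      also have "\<dots> = exp (- (\<theta> * b)) * exp (\<Sum>p\<in>I. \<tau> p * (\<theta> * c F p))"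
        by (simp add: sum_distrib_left mult_ac flip: exp_add)
      also have "\<dots> \<le> (\<Sum>F\<in>\<G>. exp (- (\<theta> * b)) * exp (\<Sum>p\<in>I. \<tau> p * (\<theta> * c F p)))"
        using F G(1) by (intro member_le_sum) auto
      finally have "\<theta> * ?S F \<tau> \<le> \<theta> * B \<tau>" using \<theta> by (simp add: B_def distrib_left)
      then show ?thesis using \<theta> by simp
    qed
    have "mean (cube I) (\<lambda>\<tau>. exp (\<Sum>p\<in>I. \<tau> p * (\<theta> * c F p))) \<le> exp \<Lambda>" if F: "F \<in> \<G>" for F
    proof -
      have "mean (cube I) (\<lambda>\<tau>. exp (\<Sum>p\<in>I. \<tau> p * (\<theta> * c F p))) \<le> exp ((\<Sum>p\<in>I. (\<theta> * c F p)\<^sup>2) / 2)"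
        by (rule mean_exp_linear_le[OF I])
      also have "(\<Sum>p\<in>I. (\<theta> * c F p)\<^sup>2) = \<theta>\<^sup>2 * (\<Sum>p\<in>I. (c F p)\<^sup>2)"
        by (simp add: power_mult_distrib sum_distrib_left)
      also have "\<theta>\<^sup>2 * (\<Sum>p\<in>I. (c F p)\<^sup>2) / 2 \<le> \<theta>\<^sup>2 * R\<^sup>2 / 2"
        using c[OF F] by (intro divide_right_mono mult_left_mono) auto
      finally show ?thesis by (simp add: \<theta>R)
    qed
    then have "(\<Sum>F\<in>\<G>. exp (- (\<theta> * b)) * mean (cube I) (\<lambda>\<tau>. exp (\<Sum>p\<in>I. \<tau> p * (\<theta> * c F p))))
        \<le> (\<Sum>F\<in>\<G>. exp (- (\<theta> * b)) * exp \<Lambda>)"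
      by (intro sum_mono mult_left_mono) auto
    also have "\<dots> = real (card \<G>) * exp (- \<Lambda>)" by (simp add: \<theta>b flip: exp_add)
    also have "\<dots> \<le> exp \<Lambda> * exp (- \<Lambda>)" using G(2) by (intro mult_right_mono) auto
    also have "\<dots> = 1" by (simp flip: exp_add)
    finally have 1: "(\<Sum>F\<in>\<G>. exp (- (\<theta> * b)) * mean (cube I) (\<lambda>\<tau>. exp (\<Sum>p\<in>I. \<tau> p * (\<theta> * c F p)))) \<le> 1" .
    have "mean (cube I) B = b + 1 / \<theta> * (\<Sum>F\<in>\<G>. exp (- (\<theta> * b)) * mean (cube I) (\<lambda>\<tau>. exp (\<Sum>p\<in>I. \<tau> p * (\<theta> * c F p))))"
      unfolding B_def mean_add mean_cmult mean_sum using I by (simp add: mean_const finite_cube cube_not_empty)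
    also have "\<dots> \<le> b + 1 / \<theta>" using mult_left_mono[OF 1, of "1 / \<theta>"] \<theta> by simp
    also have "1 / \<theta> \<le> R"
    proof -
      have "1 \<le> sqrt (2 * \<Lambda>)" using L by simp
      then have "R / sqrt (2 * \<Lambda>) \<le> R / 1" using R by (intro divide_left_mono) auto
      then show ?thesis by (simp add: \<theta>_def)
    qed
    finally show "mean (cube I) B \<le> R * (sqrt (2 * \<Lambda>) + 1)" by (simp add: b_def distrib_left)
  qed
qed

text \<open>
  Every summand of the slack is at most \<open>V + 3 m\<close>, where \<open>V\<close> is the mean of the slack. So a
  function that exceeds \<open>M\<close> times its mean somewhere has a coefficient of order \<open>1 / M\<close>, and
  \<open>M = 10 k m\<^sup>2\<close> makes all these functions together contribute at most \<open>(V + 3 m) / 10\<close> to the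
  pairing. For the other functions \<open>b\<close> bounds the pairing relative to the mean.
\<close>

lemma slack_pairing_le:
  assumes m: "0 < m" "2 * m \<le> n" and \<tau>: "\<tau> \<in> cube (sym_index n)"
    and slack: "\<And>x. x \<in> cube {..<2 * m} \<Longrightarrow>
      h - ((\<Sum>i<2 * m. \<tau> (i, i)) + sqrt 2 * offdiag_form (2 * m) \<tau> x) / real (2 * m)
        = l0 + (\<Sum>F\<in>\<F>. l F * u F x)"
    and l: "0 \<le> l0" "\<And>F. 0 \<le> l F" and u: "\<And>F x. x \<in> cube {..<2 * m} \<Longrightarrow> 0 \<le> u F x"
    and k: "finite \<F>" "1 \<le> k" "card \<F> \<le> k"
    and b: "0 \<le> b" "\<And>F. F \<in> \<F> \<Longrightarrow>
      \<forall>x\<in>cube {..<2 * m}. u F x \<le> 10 * real k * (real m)\<^sup>2 * mean (cube {..<2 * m}) (u F) \<Longrightarrow>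
      - (\<Sum>i<m. \<Sum>j=m..<2 * m. \<tau> (i, j) * mean (cube {..<2 * m}) (\<lambda>x. u F x * (x i * x j)))
        \<le> mean (cube {..<2 * m}) (u F) * b"
  shows "2 * real m / 5 \<le> (h - (\<Sum>i<2 * m. \<tau> (i, i)) / real (2 * m)) * (b + 1)"
proof -
  let ?K = "cube {..<2 * m}" and ?M = "10 * real k * (real m)\<^sup>2"
  define V where "V = h - (\<Sum>i<2 * m. \<tau> (i, i)) / real (2 * m)"
  define D where "D F = - (\<Sum>i<m. \<Sum>j=m..<2 * m. \<tau> (i, j) * mean ?K (\<lambda>x. u F x * (x i * x j)))" for F
  define a where "a F = mean ?K (u F)" for F
  have V: "V = l0 + (\<Sum>F\<in>\<F>. l F * a F)" and pair: "real m / sqrt 2 = (\<Sum>F\<in>\<F>. l F * D F)"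
    unfolding V_def D_def a_def using slack_mean_and_pairing[OF m \<tau> slack] by simp_all
  have a0: "0 \<le> a F" for F unfolding a_def by (intro mean_nonneg u)
  have V0: "0 \<le> V" unfolding V using l a0 by (intro add_nonneg_nonneg sum_nonneg) auto
  have M: "0 < ?M" using m(1) k(2) by simp
  have \<tau>1: "\<bar>\<tau> (i, j)\<bar> = 1" if "i \<le> j" "j < 2 * m" for i j
    using \<tau> that m(2) by (intro cube_abs) (auto simp: sym_index_def)
  have form: "\<bar>offdiag_form (2 * m) \<tau> x\<bar> \<le> real (2 * m) * real (2 * m)" if x: "x \<in> ?K" for x
  proof -
    have "\<bar>offdiag_form (2 * m) \<tau> x\<bar> \<le> (\<Sum>p\<in>offdiag (2 * m). \<bar>case p of (i, j) \<Rightarrow> \<tau> (i, j) * (x i * x j)\<bar>)"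
      unfolding offdiag_form_def by (rule sum_abs)
    also have "\<dots> = (\<Sum>p\<in>offdiag (2 * m). 1)"
      using \<tau>1 cube_abs[OF x] by (intro sum.cong) (auto simp: offdiag_def abs_mult)
    also have "\<dots> \<le> real (card ({..<2 * m} \<times> {..<2 * m}))"
      by (simp only: sum_constant mult_1_right of_nat_le_iff, intro card_mono) (auto simp: offdiag_def)
    finally show ?thesis by simp
  qed
  have smax: "l F * u F x \<le> V + 3 * real m" if F: "F \<in> \<F>" and x: "x \<in> ?K" for F x
  proof -
    have "l F * u F x \<le> (\<Sum>F\<in>\<F>. l F * u F x)"
      using F k(1) l u[OF x] by (intro member_le_sum) auto
    also have "\<dots> \<le> V - sqrt 2 * offdiag_form (2 * m) \<tau> x / real (2 * m)"
      using slack[OF x] l(1) by (simp add: V_def add_divide_distrib)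
    also have "- (sqrt 2 * offdiag_form (2 * m) \<tau> x / real (2 * m)) \<le> 3 * real m"
    proof -
      have "sqrt 2 * - offdiag_form (2 * m) \<tau> x \<le> 3 / 2 * (real (2 * m) * real (2 * m))"
      proof (rule order_trans[OF mult_left_mono])
        show "- offdiag_form (2 * m) \<tau> x \<le> real (2 * m) * real (2 * m)" using form[OF x] by simp
        have "sqrt 2 \<le> (3 / 2 :: real)" by (rule real_le_lsqrt) (auto simp: power2_eq_square)
        then show "sqrt 2 * (real (2 * m) * real (2 * m)) \<le> 3 / 2 * (real (2 * m) * real (2 * m))"
          by (intro mult_right_mono) auto
      qed simp
      then have "sqrt 2 * - offdiag_form (2 * m) \<tau> x / real (2 * m) \<le> 3 / 2 * (real (2 * m) * real (2 * m)) / real (2 * m)"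
        by (intro divide_right_mono) auto
      then show ?thesis using m(1) by simp
    qed
    then have "V - sqrt 2 * offdiag_form (2 * m) \<tau> x / real (2 * m) \<le> V + 3 * real m" by simp
    finally show ?thesis .
  qed
  have D_le: "D F \<le> (real m)\<^sup>2 * a F" for F
  proof -
    have "D F = (\<Sum>i<m. \<Sum>j=m..<2 * m. - (\<tau> (i, j) * mean ?K (\<lambda>x. u F x * (x i * x j))))"
      by (simp add: D_def sum_negf)
    also have "\<dots> \<le> (\<Sum>i<m. \<Sum>j=m..<2 * m. a F)"
    proof (intro sum_mono)
      fix i j assume ij: "i \<in> {..<m}" "j \<in> {m..<2 * m}"
      have "- (\<tau> (i, j) * mean ?K (\<lambda>x. u F x * (x i * x j))) = mean ?K (\<lambda>x. - \<tau> (i, j) * (u F x * (x i * x j)))"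
        unfolding mean_cmult by simp
      also have "\<dots> \<le> a F"
        unfolding a_def
      proof (rule mean_mono)
        fix x assume x: "x \<in> ?K"
        have "\<bar>- \<tau> (i, j) * (u F x * (x i * x j))\<bar> = u F x"
          using \<tau>1[of i j] cube_abs[OF x] u[OF x] ij by (simp add: abs_mult)
        then show "- \<tau> (i, j) * (u F x * (x i * x j)) \<le> u F x" by (rule abs_le_D1[OF eq_refl])
      qed
      finally show "- (\<tau> (i, j) * mean ?K (\<lambda>x. u F x * (x i * x j))) \<le> a F" .
    qed
    also have "\<dots> = (real m)\<^sup>2 * a F" by (simp add: power2_eq_square)
    finally show ?thesis .
  qed
  have "l F * D F \<le> l F * a F * b + (real m)\<^sup>2 * ((V + 3 * real m) / ?M)" if F: "F \<in> \<F>" for F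
  proof (cases "\<forall>x\<in>?K. u F x \<le> ?M * a F")
    case True
    then have "D F \<le> a F * b" using b(2)[OF F] by (simp add: D_def a_def)
    then have "l F * D F \<le> l F * (a F * b)" using l(2) by (rule mult_left_mono)
    moreover have "0 \<le> (real m)\<^sup>2 * ((V + 3 * real m) / ?M)"
      using V0 M by (intro mult_nonneg_nonneg divide_nonneg_pos) auto
    ultimately show ?thesis by (simp add: mult.assoc)
  next
    case False
    then obtain x where x: "x \<in> ?K" "?M * a F < u F x" by force
    have "l F * (?M * a F) \<le> l F * u F x" using x(2) l(2) by (intro mult_left_mono) auto
    also have "\<dots> \<le> V + 3 * real m" by (rule smax[OF F x(1)])
    finally have "l F * a F \<le> (V + 3 * real m) / ?M" using M by (simp add: pos_le_divide_eq mult_ac)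
    then have "(real m)\<^sup>2 * (l F * a F) \<le> (real m)\<^sup>2 * ((V + 3 * real m) / ?M)" by (rule mult_left_mono) simp
    moreover have "l F * D F \<le> l F * ((real m)\<^sup>2 * a F)" by (rule mult_left_mono[OF D_le l(2)])
    moreover have "0 \<le> l F * a F * b" using l(2) a0 b(1) by simp
    ultimately show ?thesis by (simp add: mult_ac)
  qed
  then have "real m / sqrt 2 \<le> (\<Sum>F\<in>\<F>. l F * a F * b + (real m)\<^sup>2 * ((V + 3 * real m) / ?M))"
    unfolding pair by (rule sum_mono)
  also have "\<dots> = (\<Sum>F\<in>\<F>. l F * a F) * b + real (card \<F>) * ((real m)\<^sup>2 * ((V + 3 * real m) / ?M))"
    by (simp add: sum.distrib sum_distrib_right)
  also have "\<dots> \<le> V * b + real k * ((real m)\<^sup>2 * ((V + 3 * real m) / ?M))"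
    using V l(1) b(1) V0 M k(3)
    by (intro add_mono mult_right_mono mult_nonneg_nonneg divide_nonneg_pos) auto
  also have "real k * ((real m)\<^sup>2 * ((V + 3 * real m) / ?M)) = (V + 3 * real m) / 10"
    using k(2) m(1) by (simp add: field_simps)
  finally have "real m / sqrt 2 \<le> V * b + (V + 3 * real m) / 10" .
  moreover have "7 / 10 * real m \<le> real m / sqrt 2"
  proof -
    have "sqrt 2 \<le> (10 / 7 :: real)" by (rule real_le_lsqrt) (auto simp: power2_eq_square)
    then have "real m / (10 / 7) \<le> real m / sqrt 2" by (intro divide_left_mono) auto
    then show ?thesis by simp
  qed
  ultimately have "7 / 10 * real m \<le> V * b + (V + 3 * real m) / 10" by (rule order_trans[rotated])
  moreover have "V * (b + 1) = V * b + V" by (simp add: distrib_left)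
  ultimately have "2 * real m / 5 \<le> V * (b + 1)" using V0 by argo
  then show ?thesis by (simp add: V_def)
qed


section \<open>The lower bound on the extension complexity\<close>

lemma coefficients_eq_0_if_mean_eq_0:
  assumes "finite A" "\<And>x. x \<in> A \<Longrightarrow> 0 \<le> f x" "\<And>x. x \<in> A \<Longrightarrow> f x \<le> M * mean A f" "mean A f = 0"
  shows "mean A (\<lambda>x. f x * g x) = 0"
proof -
  have "f x = 0" if "x \<in> A" for x using assms(2,3)[OF that] assms(4) by simp
  then show ?thesis by (simp add: mean_def)
qed

text \<open>
  The inequality \<open>2 m / 5 \<le> V * (B + 1)\<close> holds for each sign pattern, and it is averaged by
  bounding \<open>1 / (B + 1)\<close> from below by an affine function of \<open>B\<close>. The mean of \<open>V\<close> is that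
  of \<open>h\<close>, because the diagonal signs have mean \<open>0\<close>.
\<close>

lemma sqrt_le_power_ln_complexity:
  fixes P :: "fin_mat set"
  assumes n: "2 \<le> n" and P: "polytope P" "density_mats n \<subseteq> P"
    and width: "gaussian_width n P \<le> 2 * gaussian_width n (density_mats n)"
    and k: "k = extension_complexity P" "1 \<le> k"
    and L: "\<Lambda> = ln (10 * real k * (real (n div 2))\<^sup>2)"
  shows "sqrt (real n) \<le> 3780 * (\<Lambda> * sqrt \<Lambda>)"
proof -
  define m where "m = n div 2"
  let ?N = "2 * m" and ?M = "10 * real k * (real m)\<^sup>2"
  let ?K = "cube {..<?N}" and ?I = "sym_index n"
  have "n \<le> 3 * m" using n unfolding m_def by presburger
  then have "real n \<le> real (3 * m)" by (simp only: of_nat_le_iff)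
  then have m: "0 < m" "?N \<le> n" "real n \<le> 3 * real m" using n by (auto simp: m_def)
  have K: "finite ?K" "?K \<noteq> {}" by (simp_all add: finite_cube cube_not_empty)
  have C: "finite (cube ?I)" "cube ?I \<noteq> {}" by (simp_all add: finite_cube cube_not_empty finite_sym_index)
  have point: "sign_point n ?N x \<in> P" if "x \<in> ?K" for x
    using sign_point_density[OF that _ m(2)] m(1) P(2) by auto
  have "P \<noteq> {}" using point K(2) by blast
  have km: "1 * 1 \<le> real k * (real m)\<^sup>2" using k(2) m(1) by (intro mult_mono) auto
  have M10: "10 \<le> ?M" using km by simp
  have L1: "1 \<le> \<Lambda>"
  proof -
    have "exp 1 \<le> (3 :: real)" by (rule exp_le)
    then have "exp 1 \<le> ?M" using M10 by simp
    then have "ln (exp 1) \<le> ln ?M" by (subst ln_le_cancel_iff) (use M10 in auto)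
    then show ?thesis by (simp add: L m_def)
  qed
  have expL: "exp \<Lambda> = ?M" using M10 by (simp add: L m_def)

  define h where "h \<tau> = (SUP X\<in>P. trace_inner n (gaussian_mat n \<tau>) X)" for \<tau>
  obtain S where S: "finite S" "P = convex hull S" using P(1) unfolding polytope_def by blast
  have "S \<noteq> {}" using \<open>P \<noteq> {}\<close> S(2) by auto
  have h: "trace_inner n (gaussian_mat n \<tau>) X \<le> h \<tau>" if "X \<in> P" for \<tau> X
    unfolding h_def S(2) SUP_linear_hull[OF linear_trace_inner S(1) \<open>S \<noteq> {}\<close>]
    using that S(2) by (intro linear_le_Max_hull linear_trace_inner S(1)) simp
  obtain \<F> :: "fin_vec set set" and u :: "fin_vec set \<Rightarrow> fin_mat \<Rightarrow> real"
    where F: "finite \<F>" and card: "card \<F> = extension_complexity P"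
      and u0: "\<forall>F. \<forall>X\<in>P. 0 \<le> u F X"
      and fac: "\<forall>\<phi> b. linear \<phi> \<and> (\<forall>X\<in>P. \<phi> X \<le> b) \<longrightarrow>
        (\<exists>l0 l. 0 \<le> l0 \<and> (\<forall>F. 0 \<le> l F) \<and> (\<forall>X\<in>P. b - \<phi> X = l0 + (\<Sum>F\<in>\<F>. l F * u F X)))"
    by (rule slack_factorization[OF P(1) \<open>P \<noteq> {}\<close>]) (rule that)
  have F: "finite \<F>" "card \<F> = k" by (simp_all add: F card k(1))
  define w where "w F x = u F (sign_point n ?N x)" for F x
  define a where "a F = mean ?K (w F)" for F
  define U where "U F i j = mean ?K (\<lambda>x. w F x * (x i * x j))" for F i j
  have w0: "0 \<le> w F x" if "x \<in> ?K" for F x unfolding w_def using u0 point[OF that] by blast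

  define \<G> where "\<G> = {F \<in> \<F>. a F \<noteq> 0 \<and> (\<forall>x\<in>?K. w F x \<le> ?M * a F)}"
  define c where "c F p = (if p \<in> {..<m} \<times> {m..<?N} then - (U F (fst p) (snd p) / a F) else 0)" for F p
  have block: "(\<Sum>p\<in>?I. if p \<in> {..<m} \<times> {m..<?N} then f (fst p) (snd p) else 0) = (\<Sum>i<m. \<Sum>j=m..<?N. f i j)"
    for f :: "nat \<Rightarrow> nat \<Rightarrow> real"
  proof -
    have "(\<Sum>p\<in>?I. if p \<in> {..<m} \<times> {m..<?N} then f (fst p) (snd p) else 0)
        = (\<Sum>p\<in>?I \<inter> {..<m} \<times> {m..<?N}. f (fst p) (snd p))"
      by (rule sum.inter_restrict[OF finite_sym_index, symmetric])
    also have "?I \<inter> {..<m} \<times> {m..<?N} = {..<m} \<times> {m..<?N}"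
      using m(2) by (auto simp: sym_index_def)
    finally show ?thesis by (simp add: sum.cartesian_product split_def)
  qed
  have "(\<Sum>p\<in>?I. (c F p)\<^sup>2) \<le> (3 * \<Lambda>)\<^sup>2" if G: "F \<in> \<G>" for F
  proof -
    have aF: "0 < a F"
      using G mean_nonneg[of ?K "w F"] w0 by (auto simp: \<G>_def a_def less_le)
    have mult: "mean ?K (\<lambda>x. w F x / a F * (x i * x j)) = U F i j / a F" for i j
      using mean_cmult[of ?K "1 / a F" "\<lambda>x. w F x * (x i * x j)"] by (simp add: U_def)
    have "(\<Sum>p\<in>?I. (c F p)\<^sup>2) = (\<Sum>p\<in>?I. if p \<in> {..<m} \<times> {m..<?N} then (U F (fst p) (snd p) / a F)\<^sup>2 else 0)"
      by (intro sum.cong) (auto simp: c_def)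
    also have "\<dots> = (\<Sum>i<m. \<Sum>j=m..<?N. (mean ?K (\<lambda>x. w F x / a F * (x i * x j)))\<^sup>2)"
      unfolding mult by (rule block)
    finally have eq: "(\<Sum>p\<in>?I. (c F p)\<^sup>2) = (\<Sum>i<m. \<Sum>j=m..<?N. (mean ?K (\<lambda>x. w F x / a F * (x i * x j)))\<^sup>2)" .
    have "sqrt (\<Sum>i<m. \<Sum>j=m..<?N. (mean ?K (\<lambda>x. w F x / a F * (x i * x j)))\<^sup>2) \<le> sqrt 2 * (ln ?M + 1 / 2)"
    proof (rule bilinear_correlations_le_ln)
      show "0 \<le> w F x / a F" if "x \<in> ?K" for x using w0[OF that] aF by simp
      show "w F x / a F \<le> ?M" if "x \<in> ?K" for x
        using G that aF by (simp add: \<G>_def pos_divide_le_eq)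
      show "mean ?K (\<lambda>x. w F x / a F) = 1"
        using mean_cmult[of ?K "1 / a F" "w F"] aF by (simp add: a_def)
    qed auto
    also have "\<dots> \<le> 2 * (3 / 2 * \<Lambda>)"
    proof (rule mult_mono)
      show "sqrt 2 \<le> (2 :: real)" by (rule real_le_lsqrt) auto
      show "ln ?M + 1 / 2 \<le> 3 / 2 * \<Lambda>" using L1 by (simp add: L m_def)
    qed (use L1 in \<open>auto simp: L m_def\<close>)
    finally have "sqrt (\<Sum>p\<in>?I. (c F p)\<^sup>2) \<le> 3 * \<Lambda>" by (simp add: eq)
    then have "(sqrt (\<Sum>p\<in>?I. (c F p)\<^sup>2))\<^sup>2 \<le> (3 * \<Lambda>)\<^sup>2" by (intro power_mono) (auto intro: sum_nonneg)
    then show ?thesis by (simp add: sum_nonneg)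
  qed
  moreover have "real (card \<G>) \<le> exp \<Lambda>"
  proof -
    have "card \<G> \<le> k" using card_mono[OF F(1), of \<G>] F(2) by (auto simp: \<G>_def)
    then have "real (card \<G>) \<le> real k * 1" by simp
    also have "\<dots> \<le> real k * (10 * (real m)\<^sup>2)"
    proof (rule mult_left_mono)
      have "1 \<le> (real m)\<^sup>2" using m(1) by simp
      then show "1 \<le> 10 * (real m)\<^sup>2" by linarith
    qed simp
    finally show ?thesis unfolding expL by (simp add: mult_ac)
  qed
  moreover have "finite \<G>" using F(1) by (simp add: \<G>_def)
  ultimately obtain B where B: "\<And>\<tau>. 0 \<le> B \<tau>"
    "\<And>\<tau> F. F \<in> \<G> \<Longrightarrow> (\<Sum>p\<in>?I. \<tau> p * c F p) \<le> B \<tau>"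
    "mean (cube ?I) B \<le> 3 * \<Lambda> * (sqrt (2 * \<Lambda>) + 1)"
    using max_linear_signs_bound[of ?I \<G> \<Lambda> "3 * \<Lambda>" c] finite_sym_index L1 by auto

  define T where "T \<tau> = (\<Sum>i<?N. \<tau> (i, i)) / real ?N" for \<tau> :: "nat \<times> nat \<Rightarrow> real"
  have pointwise: "2 * real m / 5 \<le> (h \<tau> - T \<tau>) * (B \<tau> + 1)" if \<tau>: "\<tau> \<in> cube ?I" for \<tau>
  proof -
    have "linear (trace_inner n (gaussian_mat n \<tau>)) \<and> (\<forall>X\<in>P. trace_inner n (gaussian_mat n \<tau>) X \<le> h \<tau>)"
      by (simp add: linear_trace_inner h)
    from mp[OF spec[OF spec[OF fac]] this] obtain l0 l where
      lf: "0 \<le> l0 \<and> (\<forall>F. 0 \<le> l F) \<and>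
        (\<forall>X\<in>P. h \<tau> - trace_inner n (gaussian_mat n \<tau>) X = l0 + (\<Sum>F\<in>\<F>. l F * u F X))"
      by (elim exE)
    then have l: "0 \<le> l0" "\<And>F. 0 \<le> l F"
      "\<And>X. X \<in> P \<Longrightarrow> h \<tau> - trace_inner n (gaussian_mat n \<tau>) X = l0 + (\<Sum>F\<in>\<F>. l F * u F X)"
      by simp_all
    show ?thesis
      unfolding T_def
    proof (rule slack_pairing_le[OF m(1,2) \<tau> _ l(1,2) w0 F(1) k(2)])
      fix x assume x: "x \<in> ?K"
      show "h \<tau> - ((\<Sum>i<?N. \<tau> (i, i)) + sqrt 2 * offdiag_form ?N \<tau> x) / real ?N = l0 + (\<Sum>F\<in>\<F>. l F * w F x)"
        using l(3)[OF point[OF x]] trace_inner_sign_point[OF x _ m(2), of \<tau>] m(1) by (simp add: w_def)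
    next
      fix F assume FF: "F \<in> \<F>" and le: "\<forall>x\<in>?K. w F x \<le> ?M * mean ?K (w F)"
      have "- (\<Sum>i<m. \<Sum>j=m..<?N. \<tau> (i, j) * U F i j) \<le> a F * B \<tau>"
      proof (cases "a F = 0")
        case True
        then have "U F i j = 0" for i j
          unfolding U_def using le w0
          by (intro coefficients_eq_0_if_mean_eq_0[OF K(1), of "w F" ?M]) (auto simp: a_def)
        then show ?thesis using True by simp
      next
        case False
        then have G: "F \<in> \<G>" and aF: "0 < a F"
          using FF le mean_nonneg[of ?K "w F"] w0 by (auto simp: \<G>_def a_def less_le)
        have "(\<Sum>p\<in>?I. \<tau> p * c F p) = (\<Sum>p\<in>?I. if p \<in> {..<m} \<times> {m..<?N}
            then \<tau> (fst p, snd p) * - (U F (fst p) (snd p) / a F) else 0)"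
          by (intro sum.cong) (auto simp: c_def)
        also have "\<dots> = (\<Sum>i<m. \<Sum>j=m..<?N. \<tau> (i, j) * - (U F i j / a F))"
          by (rule block)
        also have "a F * \<dots> = - (\<Sum>i<m. \<Sum>j=m..<?N. \<tau> (i, j) * U F i j)"
          using aF by (simp add: sum_distrib_left sum_negf)
        finally show ?thesis using mult_left_mono[OF B(2)[OF G, of \<tau>], of "a F"] aF by simp
      qed
      then show "- (\<Sum>i<m. \<Sum>j=m..<?N. \<tau> (i, j) * mean ?K (\<lambda>x. w F x * (x i * x j))) \<le> mean ?K (w F) * B \<tau>"
        by (simp add: U_def a_def)
    qed (use F(2) B(1) in auto)
  qed

  define A where "A = 9 * (\<Lambda> * sqrt \<Lambda>)"
  have sL: "1 \<le> sqrt \<Lambda>" using L1 by simp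
  have A9: "9 \<le> A"
    using mult_mono[OF L1 sL] L1 by (simp add: A_def)
  have meanB: "mean (cube ?I) (\<lambda>\<tau>. B \<tau> + 1) \<le> A"
  proof -
    have "sqrt 2 \<le> (3 / 2 :: real)" by (rule real_le_lsqrt) (auto simp: power2_eq_square)
    then have "sqrt (2 * \<Lambda>) \<le> 3 / 2 * sqrt \<Lambda>"
      unfolding real_sqrt_mult by (intro mult_right_mono) (use L1 in auto)
    then have "3 * \<Lambda> * (sqrt (2 * \<Lambda>) + 1) \<le> 3 * \<Lambda> * (3 / 2 * sqrt \<Lambda> + sqrt \<Lambda>)"
      using L1 sL by (intro mult_left_mono add_mono) auto
    also have "\<dots> = 15 / 2 * (\<Lambda> * sqrt \<Lambda>)" by (simp add: algebra_simps)
    finally have "mean (cube ?I) B \<le> 15 / 2 * (\<Lambda> * sqrt \<Lambda>)" using B(3) by simp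
    moreover have "1 \<le> \<Lambda> * sqrt \<Lambda>" using A9 by (simp add: A_def)
    ultimately show ?thesis by (simp add: mean_add mean_const C A_def)
  qed
  have "2 * real m / 5 * (1 / A) \<le> mean (cube ?I) h"
  proof -
    have "mean (cube ?I) (\<lambda>\<tau>. 2 * real m / 5 * (2 / A - 1 / A\<^sup>2 * (B \<tau> + 1))) \<le> mean (cube ?I) (\<lambda>\<tau>. h \<tau> - T \<tau>)"
    proof (rule mean_mono)
      fix \<tau> assume \<tau>: "\<tau> \<in> cube ?I"
      let ?y = "B \<tau> + 1"
      have y: "0 < ?y" using B(1)[of \<tau>] by simp
      \<comment> \<open>the tangent of \<open>1 / y\<close> at \<open>y = A\<close> lies below the graph\<close>
      have "2 / A - 1 / A\<^sup>2 * ?y \<le> 1 / ?y"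
      proof -
        have "0 \<le> (?y - A)\<^sup>2 / (A\<^sup>2 * ?y)" using y by simp
        also have "\<dots> = 1 / ?y - (2 / A - 1 / A\<^sup>2 * ?y)"
          using y A9 by (simp add: power2_diff field_simps power2_eq_square)
        finally show ?thesis by simp
      qed
      then have "2 * real m / 5 * (2 / A - 1 / A\<^sup>2 * ?y) \<le> 2 * real m / 5 * (1 / ?y)"
        by (rule mult_left_mono) simp
      also have "\<dots> \<le> h \<tau> - T \<tau>" using pointwise[OF \<tau>] unfolding pos_divide_le_eq[OF y, symmetric] by simp
      finally show "2 * real m / 5 * (2 / A - 1 / A\<^sup>2 * ?y) \<le> h \<tau> - T \<tau>" .
    qed
    also have "\<dots> = mean (cube ?I) h"
    proof -
      have "mean (cube ?I) (\<lambda>\<tau>. 1 / real ?N * (\<Sum>i<?N. \<tau> (i, i))) = 1 / real ?N * (\<Sum>i<?N. mean (cube ?I) (\<lambda>\<tau>. \<tau> (i, i)))"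
        unfolding mean_cmult mean_sum ..
      also have "(\<Sum>i<?N. mean (cube ?I) (\<lambda>\<tau>. \<tau> (i, i))) = 0"
      proof (intro sum.neutral ballI)
        fix i assume "i \<in> {..<?N}"
        then show "mean (cube ?I) (\<lambda>\<tau>. \<tau> (i, i)) = 0"
          using mean_cube_coordinate_mult[of "(i, i)" ?I "\<lambda>_. 1"] m(2) by (simp add: sym_index_def)
      qed
      finally have "mean (cube ?I) T = 0" by (simp add: T_def[abs_def])
      then show ?thesis by (simp add: mean_diff)
    qed
    finally have "2 * real m / 5 * (2 / A - 1 / A\<^sup>2 * mean (cube ?I) (\<lambda>\<tau>. B \<tau> + 1)) \<le> mean (cube ?I) h"
      unfolding mean_cmult mean_diff mean_const[OF C] .
    moreover have "1 / A\<^sup>2 * mean (cube ?I) (\<lambda>\<tau>. B \<tau> + 1) \<le> 1 / A\<^sup>2 * A"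
      using meanB by (intro mult_left_mono) auto
    moreover have "1 / A\<^sup>2 * A = 1 / A" using A9 by (simp add: power2_eq_square)
    ultimately have le: "1 / A \<le> 2 / A - 1 / A\<^sup>2 * mean (cube ?I) (\<lambda>\<tau>. B \<tau> + 1)"
      and h': "2 * real m / 5 * (2 / A - 1 / A\<^sup>2 * mean (cube ?I) (\<lambda>\<tau>. B \<tau> + 1)) \<le> mean (cube ?I) h"
      by (simp_all add: add_divide_distrib diff_le_eq le_diff_eq)
    show ?thesis using mult_left_mono[OF le, of "2 * real m / 5"] h' by simp
  qed
  moreover have "1 / 2 * mean (cube ?I) h \<le> 28 * sqrt (real n)"
  proof -
    have "0 \<le> 2 * real m / 5 * (1 / A)" using A9 by simp
    then have h0: "0 \<le> mean (cube ?I) h" using calculation by linarith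
    have "1 / 2 \<le> sqrt (2 / pi)"
      by (rule real_le_rsqrt) (use pi_less_4 in \<open>simp add: power2_eq_square field_simps\<close>)
    then have "1 / 2 * mean (cube ?I) h \<le> sqrt (2 / pi) * mean (cube ?I) h"
      using h0 by (rule mult_right_mono)
    also have "\<dots> \<le> gaussian_width n P"
      using gaussian_width_ge_mean_signs[OF P(1) \<open>P \<noteq> {}\<close>, of n] by (simp add: h_def[abs_def])
    also have "\<dots> \<le> 28 * sqrt (real n)"
      using width gaussian_width_density_le[of n] n by simp
    finally show ?thesis .
  qed
  ultimately have "real m / 5 * (1 / A) \<le> 28 * sqrt (real n)" by simp
  then have "real m \<le> 28 * sqrt (real n) * (5 * A)" using A9 by (simp add: field_simps)
  then have "real n \<le> 3 * (28 * sqrt (real n) * (5 * A))"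
    by (intro order_trans[OF m(3)] mult_left_mono) auto
  then have "sqrt (real n) * sqrt (real n) \<le> 420 * A * sqrt (real n)" by (simp add: mult_ac)
  then have "sqrt (real n) \<le> 420 * A" by (rule mult_right_le_imp_le) (use n in simp)
  then show ?thesis by (simp add: A_def)
qed

lemma cube_root_le_ln_complexity:
  fixes P :: "fin_mat set"
  assumes n: "2 \<le> n" and P: "polytope P" "density_mats n \<subseteq> P"
    and width: "gaussian_width n P \<le> 2 * gaussian_width n (density_mats n)"
    and k: "1 \<le> extension_complexity P"
  shows "real n powr (1 / 3) \<le> 250 * (ln (real (extension_complexity P)) + 2 + 2 * ln (real n))"
proof -
  let ?k = "extension_complexity P" and ?m = "n div 2"
  define \<Lambda> where "\<Lambda> = ln (10 * real ?k * (real ?m)\<^sup>2)"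
  define r where "r = real n powr (1 / 3)"
  have m: "1 \<le> real ?m" "real ?m \<le> real n / 2" using n by auto
  have sq: "sqrt (real n) \<le> 3780 * (\<Lambda> * sqrt \<Lambda>)"
    using sqrt_le_power_ln_complexity[OF n P width refl k \<Lambda>_def] .
  have L0: "0 \<le> \<Lambda>"
  proof -
    have "1 * 1 \<le> real ?k * (real ?m)\<^sup>2" using k m(1) by (intro mult_mono) auto
    then show ?thesis unfolding \<Lambda>_def by (intro ln_ge_zero) simp
  qed
  have "(\<Lambda> * sqrt \<Lambda>)\<^sup>2 = \<Lambda>\<^sup>2 * \<Lambda>" using L0 by (simp add: power_mult_distrib)
  then have square: "(\<Lambda> * sqrt \<Lambda>)\<^sup>2 = \<Lambda> ^ 3" by (simp add: power2_eq_square power3_eq_cube)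
  have "(sqrt (real n))\<^sup>2 \<le> (3780 * (\<Lambda> * sqrt \<Lambda>))\<^sup>2" using sq by (intro power_mono) auto
  then have "(sqrt (real n))\<^sup>2 \<le> 3780\<^sup>2 * \<Lambda> ^ 3"
    by (simp only: power_mult_distrib[of 3780] square)
  also have "\<dots> \<le> 250 ^ 3 * \<Lambda> ^ 3" using L0 by (intro mult_right_mono) auto
  also have "(sqrt (real n))\<^sup>2 = r ^ 3" using n by (simp add: r_def powr_power)
  finally have "r ^ 3 \<le> (250 * \<Lambda>) ^ 3" by (simp add: power_mult_distrib)
  then have "r \<le> 250 * \<Lambda>"
    by (rule iffD1[OF power_mono_iff, rotated 3]) (use L0 in \<open>auto simp: r_def\<close>)
  moreover have "\<Lambda> \<le> ln (real ?k) + 2 + 2 * ln (real n)"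
  proof -
    have k0: "0 < real ?k" and n0: "0 < real n" using k n by auto
    have "(real ?m)\<^sup>2 \<le> (real n / 2)\<^sup>2" using m by (intro power_mono) auto
    moreover have "(real n / 2)\<^sup>2 = (real n)\<^sup>2 / 4" by (simp add: power_divide)
    ultimately have "10 * (real ?m)\<^sup>2 \<le> 4 * (real n)\<^sup>2"
      using zero_le_power2[of "real n"] by linarith
    moreover have "4 \<le> exp (2 :: real)"
    proof -
      have "(2 :: real) * 2 \<le> exp 1 * exp 1"
        using exp_ge_add_one_self[of 1] by (intro mult_mono) auto
      then show ?thesis by (simp flip: exp_add)
    qed
    then have "4 * (real n)\<^sup>2 \<le> exp 2 * (real n)\<^sup>2" by (intro mult_right_mono) auto
    ultimately have "10 * (real ?m)\<^sup>2 \<le> exp 2 * (real n)\<^sup>2" by linarith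
    then have "real ?k * (10 * (real ?m)\<^sup>2) \<le> real ?k * (exp 2 * (real n)\<^sup>2)"
      by (intro mult_left_mono) auto
    then have "\<Lambda> \<le> ln (real ?k * (exp 2 * (real n)\<^sup>2))"
      unfolding \<Lambda>_def using k0 n0 m(1) by (subst ln_le_cancel_iff) (auto simp: mult_ac)
    also have "\<dots> = ln (real ?k) + (2 + 2 * ln (real n))"
      using k0 n0 by (simp add: ln_mult_pos ln_realpow)
    finally show ?thesis by simp
  qed
  ultimately show ?thesis by (simp add: r_def)
qed

lemma two_le_extension_complexity_density_superset:
  assumes n: "2 \<le> n" and P: "polytope P" "density_mats n \<subseteq> P"
  shows "2 \<le> extension_complexity P"
proof -
  let ?E = "\<lambda>a. outer_mat n (\<lambda>i. if i = a then 1 else 0)"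
  have "?E a \<in> P" if "a < n" for a
  proof -
    have "(\<Sum>i<n. (if i = a then 1 else 0 :: real)\<^sup>2) = (\<Sum>i<n. if i = a then 1 else 0)"
      by (intro sum.cong) auto
    then show ?thesis using that P(2) outer_mat_density[of "\<lambda>i. if i = a then 1 else 0" n] by auto
  qed
  then have "?E 0 \<in> P" "?E 1 \<in> P" using n by auto
  moreover have "entry (?E 0) 0 0 \<noteq> entry (?E 1) 0 0" using n by (simp add: entry_outer_mat)
  ultimately show ?thesis using two_le_extension_complexity[OF P(1)] by metis
qed

theorem theorem2:
  shows "\<exists>c::real. c > 0 \<and>
    (\<forall>n::nat. n \<ge> 2 \<longrightarrow>
      (\<forall>P :: fin_mat set.
        polytope P \<and> P \<subseteq> sym_mats n \<and> density_mats n \<subseteq> P \<and>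
        gaussian_width n P \<le> 2 * gaussian_width n (density_mats n) \<longrightarrow>
        exp (c * real n powr (1 / 3)) \<le> real (extension_complexity P)))"
proof -
  have "eventually (\<lambda>n::nat. 250 * (2 + 2 * ln (real n)) \<le> real n powr (1 / 3) / 2) at_top"
    by real_asymp
  then obtain N0 where N0: "\<And>n. N0 \<le> n \<Longrightarrow> 250 * (2 + 2 * ln (real n)) \<le> real n powr (1 / 3) / 2"
    by (auto simp: eventually_at_top_linorder)
  define c where "c = min (1 / 500) (ln 2 / real (Suc N0) powr (1 / 3))"
  have c: "0 < c" "c \<le> 1 / 500" "c \<le> ln 2 / real (Suc N0) powr (1 / 3)"
    unfolding c_def by (simp, rule min.cobounded1, rule min.cobounded2)
  have "exp (c * real n powr (1 / 3)) \<le> real (extension_complexity P)"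
    if n: "2 \<le> n" and P: "polytope P" "density_mats n \<subseteq> P"
      and width: "gaussian_width n P \<le> 2 * gaussian_width n (density_mats n)" for n P
  proof -
    let ?k = "extension_complexity P"
    have k: "2 \<le> ?k" by (rule two_le_extension_complexity_density_superset[OF n P])
    have "c * real n powr (1 / 3) \<le> ln (real ?k)"
    proof (cases "N0 \<le> n")
      case True
      have "real n powr (1 / 3) \<le> 250 * (ln (real ?k) + 2 + 2 * ln (real n))"
        using k by (intro cube_root_le_ln_complexity n P width) simp
      then have "1 / 500 * real n powr (1 / 3) \<le> ln (real ?k)" using N0[OF True] by simp
      moreover have "c * real n powr (1 / 3) \<le> 1 / 500 * real n powr (1 / 3)"
        using c(2) by (rule mult_right_mono) simp
      ultimately show ?thesis by simp
    next
      case False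
      have "c * real n powr (1 / 3) \<le> ln 2 / real (Suc N0) powr (1 / 3) * real (Suc N0) powr (1 / 3)"
        using False c(3) by (intro mult_mono powr_mono2) auto
      also have "\<dots> = ln 2" by simp
      also have "\<dots> \<le> ln (real ?k)" using k by (subst ln_le_cancel_iff) auto
      finally show ?thesis .
    qed
    then show ?thesis using k by (simp add: ln_ge_iff)
  qed
  then show ?thesis using c(1) by blast
qed

end
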